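(* Let $\varepsilon,\delta\in[0,1]$. Let $G=(X\times Y,A\times B,\mu,V)$ be a biregular two-player game, and let $M$ (on vertex sets $(X',X)$) and $P$ (on vertex sets $(Y',Y)$) be two bipartite $\lambda$-spectral expanders. If $\lambda\le\frac{\varepsilon^2\delta}{56}$, then the concatenated game $G'=(M\circ G\circ P)$ is $(\varepsilon,\delta)$-weakly fortified against entangled substrategies; that is, for every entangled substrategy $(|\psi\rangle,\{A_{x'}^{a'}\},\{B_{y'}^{b'}\})$ for $G'$, $$\mathrm{Val}^*(G',|\psi\rangle,\{A_{x'}^{a'}\},\{B_{y'}^{b'}\})\le(\mathrm{Val}^*(G)+\varepsilon)\cdot\mathop{\mathbb E}_{(x,y)\sim\mu}\langle\psi|A_x\otimes B_y|\psi\rangle+\delta .$$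
   Context: Games. A two-player game $G=(X\times Y,A\times B,\mu,V)$ consists of finite question sets $X,Y$, finite answer sets $A,B$, a probability distribution $\mu$ on $X\times Y$, and a predicate $V:A\times B\times X\times Y\to\{0,1\}$. $G$ is biregular if both marginals of $\mu$ are uniform. Entangled substrategies. An entangled (quantum) substrategy for $G$ consists of an integer $d$, a unit vector $|\psi\rangle\in\mathbb C^d\otimes\mathbb C^d$, and positive semidefinite $d\times d$ matrices $A_x^a$ ($x\in X,a\in A$), $B_y^b$ ($y\in Y,b\in B$) with $A_x:=\sum_aA_x^a\le\mathrm{Id}$ and $B_y:=\sum_bB_y^b\le\mathrm{Id}$ for all $x,y$. It is a complete strategy if $A_x=B_y=\mathrm{Id}$ for all $x,y$. Its value is $\mathrm{Val}^*(G,|\psi\rangle,\{A_x^a\},\{B_y^b\})=\mathbb E_{(x,y)\sim\mu}\sum_{a,b}V(a,b,x,y)\langle\psi|A_x^a\otimes B_y^b|\psi\rangle$; $\mathrm{Val}^*(G)$ is the supremum of this over all complete strategies (all $d$). Concatenated games. Let $M,P$ be bipartite graphs on vertex sets $(X',X)$ and $(Y',Y)$; $N(\cdot)$ denotes the set of neighbours of a vertex. In $G'=(M\circ G\circ P)$ the referee samples $(x,y)\sim\mu$ and independent uniformly random neighbours $x'\sim N(x)$ (in $M$) and $y'\sim N(y)$ (in $P$). The players receive $x'$ and $y'$ and answer with maps $a':N(x')\to A$ and $b':N(y')\to B$; they win iff $V(a'(x),b'(y),x,y)=1$. An entangled substrategy for $G'$ is given by a unit vector $|\psi\rangle$ and positive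 semidefinite matrices $A_{x'}^{a'},B_{y'}^{b'}$ with $\sum_{a'}A_{x'}^{a'}\le\mathrm{Id}$, $\sum_{b'}B_{y'}^{b'}\le\mathrm{Id}$, and its value in $G'$ is $$\mathbb E_{(x,y)\sim\mu}\mathbb E_{x'\sim N(x)}\mathbb E_{y'\sim N(y)}\sum_{a',b'}V(a'(x),b'(y),x,y)\langle\psi|A_{x'}^{a'}\otimes B_{y'}^{b'}|\psi\rangle .$$ The induced substrategy on $G$ is $A_x^a=\mathbb E_{x'\sim N(x)}\sum_{a':a'(x)=a}A_{x'}^{a'}$, $B_y^b=\mathbb E_{y'\sim N(y)}\sum_{b':b'(y)=b}B_{y'}^{b'}$; $A_x=\sum_aA_x^a$ and $B_y=\sum_bB_y^b$. Expanders. Bipartite graphs $M=(X'\times X,E)$ here are $X$-regular: $|N(x)|=D\geq 1$ for all $x\in X$. Let $\mu_X(x)=1/|X|$ and $\mu'(x')=\frac{|N(x')|}{D|X|}$. The normalized adjacency matrix $\mathcal M$ has entries $\mathcal M(x,x')=\frac1D\sqrt{\mu_X(x)/\mu'(x')}$ if $x'\in N(x)$ and $0$ otherwise. $M$ is a $\lambda$-spectral expander if the second-largest singular value of $\mathcal M$ is at most $\lambda$. For $P$ the definition is the same with $Y',Y$ in place of $X',X$. *)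

theory Defs
  imports "HOL-Probability.Probability_Mass_Function"
    "Jordan_Normal_Form.Schur_Decomposition"
    "Jordan_Normal_Form.Char_Poly"
begin

no_notation inner (infix "\<bullet>" 70)
no_notation Finite_Cartesian_Product.vec_nth (infixl "$" 90)
hide_const (open) Finite_Cartesian_Product.mat
hide_type (open) Finite_Cartesian_Product.vec

section \<open>Matrices\<close>

definition psd :: "nat \<Rightarrow> complex mat \<Rightarrow> bool" where
  "psd d M \<longleftrightarrow> M \<in> carrier_mat d d \<and> mat_adjoint M = M \<and>
     (\<forall>v \<in> carrier_vec d. 0 \<le> (M *\<^sub>v v) \<bullet>c v)"

definition loewner_le :: "nat \<Rightarrow> complex mat \<Rightarrow> complex mat \<Rightarrow> bool" where
  "loewner_le d M N \<longleftrightarrow> M \<in> carrier_mat d d \<and> N \<in> carrier_mat d d \<and> psd d (N - M)"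

text \<open>The type \<^typ>\<open>complex mat\<close> contains matrices of all sizes and hence has no zero
  usable by \<^const>\<open>sum\<close>; the size of the sum is passed explicitly.\<close>

definition mat_sum :: "nat \<Rightarrow> 'i set \<Rightarrow> ('i \<Rightarrow> complex mat) \<Rightarrow> complex mat" where
  "mat_sum d I F = mat d d (\<lambda>(i, j). \<Sum>k\<in>I. F k $$ (i, j))"

definition mat_avg :: "nat \<Rightarrow> 'i set \<Rightarrow> ('i \<Rightarrow> complex mat) \<Rightarrow> complex mat" where
  "mat_avg d I F = (1 / of_nat (card I)) \<cdot>\<^sub>m mat_sum d I F"

text \<open>Kronecker product: \<open>\<complex>\<^sup>m \<otimes> \<complex>\<^sup>n\<close> is identified with \<open>\<complex>\<^sup>m\<^sup>n\<close>, the basis vector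
  \<open>e\<^sub>i \<otimes> e\<^sub>j\<close> having index \<open>i * n + j\<close>.\<close>

definition kron :: "complex mat \<Rightarrow> complex mat \<Rightarrow> complex mat" where
  "kron M N = mat (dim_row M * dim_row N) (dim_col M * dim_col N)
     (\<lambda>(i, j). M $$ (i div dim_row N, j div dim_col N) * N $$ (i mod dim_row N, j mod dim_col N))"

text \<open>\<open>\<langle>\<psi>|M|\<psi>\<rangle>\<close>, which is real for Hermitian \<open>M\<close>. Note that \<open>\<bullet>c\<close> conjugates its
  second argument.\<close>

definition expval :: "complex vec \<Rightarrow> complex mat \<Rightarrow> real" where
  "expval \<psi> M = Re ((M *\<^sub>v \<psi>) \<bullet>c \<psi>)"

text \<open>The singular values in decreasing order, repeated according to multiplicity. All roots of
  the characteristic polynomial of \<open>A A\<^sup>T\<close> are real and nonnegative; if \<open>A\<close> has more rows than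
  columns, \<^const>\<open>take\<close> drops the surplus zeros.\<close>

definition singular_values :: "real mat \<Rightarrow> real list" where
  "singular_values A = take (min (dim_row A) (dim_col A))
     (rev (sorted_list_of_multiset (image_mset sqrt (proots (char_poly (A * A\<^sup>T))))))"


section \<open>Two-player games and entangled substrategies\<close>

record ('x, 'y, 'a, 'b) game =
  qX :: "'x set"
  qY :: "'y set"
  ansA :: "'a set"
  ansB :: "'b set"
  qdist :: "('x \<times> 'y) pmf"
  pred :: "'a \<Rightarrow> 'b \<Rightarrow> 'x \<Rightarrow> 'y \<Rightarrow> bool"

definition two_player_game :: "('x, 'y, 'a, 'b) game \<Rightarrow> bool" where
  "two_player_game G \<longleftrightarrow> finite (qX G) \<and> finite (qY G) \<and> finite (ansA G) \<and> finite (ansB G) \<and>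
     set_pmf (qdist G) \<subseteq> qX G \<times> qY G"

definition biregular :: "('x, 'y, 'a, 'b) game \<Rightarrow> bool" where
  "biregular G \<longleftrightarrow> map_pmf fst (qdist G) = pmf_of_set (qX G) \<and>
     map_pmf snd (qdist G) = pmf_of_set (qY G)"

text \<open>In the next two definitions the set of answers may depend on the question, as it does in a
  concatenated game.\<close>

definition entangled_substrategy ::
  "'x set \<Rightarrow> ('x \<Rightarrow> 'a set) \<Rightarrow> 'y set \<Rightarrow> ('y \<Rightarrow> 'b set) \<Rightarrow> nat \<Rightarrow> complex vec \<Rightarrow>
   ('x \<Rightarrow> 'a \<Rightarrow> complex mat) \<Rightarrow> ('y \<Rightarrow> 'b \<Rightarrow> complex mat) \<Rightarrow> bool" where
  "entangled_substrategy X RA Y RB d \<psi> A B \<longleftrightarrow>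
     \<psi> \<in> carrier_vec (d * d) \<and> \<psi> \<bullet>c \<psi> = 1 \<and>
     (\<forall>x\<in>X. (\<forall>a\<in>RA x. psd d (A x a)) \<and> loewner_le d (mat_sum d (RA x) (A x)) (1\<^sub>m d)) \<and>
     (\<forall>y\<in>Y. (\<forall>b\<in>RB y. psd d (B y b)) \<and> loewner_le d (mat_sum d (RB y) (B y)) (1\<^sub>m d))"

definition complete_strategy ::
  "'x set \<Rightarrow> ('x \<Rightarrow> 'a set) \<Rightarrow> 'y set \<Rightarrow> ('y \<Rightarrow> 'b set) \<Rightarrow> nat \<Rightarrow> complex vec \<Rightarrow>
   ('x \<Rightarrow> 'a \<Rightarrow> complex mat) \<Rightarrow> ('y \<Rightarrow> 'b \<Rightarrow> complex mat) \<Rightarrow> bool" where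
  "complete_strategy X RA Y RB d \<psi> A B \<longleftrightarrow>
     entangled_substrategy X RA Y RB d \<psi> A B \<and>
     (\<forall>x\<in>X. mat_sum d (RA x) (A x) = 1\<^sub>m d) \<and>
     (\<forall>y\<in>Y. mat_sum d (RB y) (B y) = 1\<^sub>m d)"

definition strategy_value ::
  "('x, 'y, 'a, 'b) game \<Rightarrow> complex vec \<Rightarrow>
   ('x \<Rightarrow> 'a \<Rightarrow> complex mat) \<Rightarrow> ('y \<Rightarrow> 'b \<Rightarrow> complex mat) \<Rightarrow> real" where
  "strategy_value G \<psi> A B = measure_pmf.expectation (qdist G) (\<lambda>(x, y).
     \<Sum>a\<in>ansA G. \<Sum>b\<in>ansB G. of_bool (pred G a b x y) * expval \<psi> (kron (A x a) (B y b)))"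

definition entangled_value :: "('x, 'y, 'a, 'b) game \<Rightarrow> real" where
  "entangled_value G = Sup {strategy_value G \<psi> A B | d \<psi> A B.
     complete_strategy (qX G) (\<lambda>_. ansA G) (qY G) (\<lambda>_. ansB G) d \<psi> A B}"


section \<open>Bipartite expanders\<close>

record ('l, 'r) bigraph =
  lverts :: "'l set"
  rverts :: "'r set"
  edges :: "('l \<times> 'r) set"

definition bipartite_graph :: "('l, 'r) bigraph \<Rightarrow> bool" where
  "bipartite_graph M \<longleftrightarrow> finite (lverts M) \<and> finite (rverts M) \<and> edges M \<subseteq> lverts M \<times> rverts M"

definition lnbrs :: "('l, 'r) bigraph \<Rightarrow> 'r \<Rightarrow> 'l set" where
  "lnbrs M x = {x'. (x', x) \<in> edges M}"

definition rnbrs :: "('l, 'r) bigraph \<Rightarrow> 'l \<Rightarrow> 'r set" where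
  "rnbrs M x' = {x. (x', x) \<in> edges M}"

definition right_regular :: "('l, 'r) bigraph \<Rightarrow> nat \<Rightarrow> bool" where
  "right_regular M D \<longleftrightarrow> D \<ge> 1 \<and> (\<forall>x\<in>rverts M. card (lnbrs M x) = D)"

definition muR :: "('l, 'r) bigraph \<Rightarrow> 'r \<Rightarrow> real" where
  "muR M x = 1 / real (card (rverts M))"

definition muL :: "('l, 'r) bigraph \<Rightarrow> nat \<Rightarrow> 'l \<Rightarrow> real" where
  "muL M D x' = real (card (rnbrs M x')) / (real D * real (card (rverts M)))"

text \<open>Rows are indexed by the right vertices and columns by the left vertices, both through the
  library's fixed enumeration of a finite set; singular values do not depend on this choice.\<close>

definition normalized_adjacency :: "('l, 'r) bigraph \<Rightarrow> nat \<Rightarrow> real mat" where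
  "normalized_adjacency M D = mat (card (rverts M)) (card (lverts M)) (\<lambda>(i, j).
     let x = from_nat_into (rverts M) i; x' = from_nat_into (lverts M) j
     in if x' \<in> lnbrs M x then 1 / real D * sqrt (muR M x / muL M D x') else 0)"

text \<open>A matrix with a single row or column has only one singular value; its second-largest
  singular value is taken to be \<open>0\<close>.\<close>

definition second_singular_value :: "real mat \<Rightarrow> real" where
  "second_singular_value A =
     (if length (singular_values A) \<ge> 2 then singular_values A ! 1 else 0)"

definition spectral_expander :: "('l, 'r) bigraph \<Rightarrow> real \<Rightarrow> bool" where
  "spectral_expander M lam \<longleftrightarrow> bipartite_graph M \<and>
     (\<exists>D. right_regular M D \<and> second_singular_value (normalized_adjacency M D) \<le> lam)"


section \<open>Concatenated games\<close>

text \<open>Answers to \<open>x'\<close> are maps \<open>N(x') \<rightarrow> A\<close>, represented by functions that are undefined outside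
  \<open>N(x')\<close>, so that every map is counted once.\<close>

definition concat_answers :: "('l, 'r) bigraph \<Rightarrow> 'a set \<Rightarrow> 'l \<Rightarrow> ('r \<Rightarrow> 'a) set" where
  "concat_answers M S x' = rnbrs M x' \<rightarrow>\<^sub>E S"

definition concat_substrategy ::
  "('x1, 'x) bigraph \<Rightarrow> ('x, 'y, 'a, 'b) game \<Rightarrow> ('y1, 'y) bigraph \<Rightarrow> nat \<Rightarrow> complex vec \<Rightarrow>
   ('x1 \<Rightarrow> ('x \<Rightarrow> 'a) \<Rightarrow> complex mat) \<Rightarrow> ('y1 \<Rightarrow> ('y \<Rightarrow> 'b) \<Rightarrow> complex mat) \<Rightarrow> bool" where
  "concat_substrategy M G P d \<psi> A B \<longleftrightarrow>
     entangled_substrategy (lverts M) (concat_answers M (ansA G))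
       (lverts P) (concat_answers P (ansB G)) d \<psi> A B"

definition concat_value ::
  "('x1, 'x) bigraph \<Rightarrow> ('x, 'y, 'a, 'b) game \<Rightarrow> ('y1, 'y) bigraph \<Rightarrow> complex vec \<Rightarrow>
   ('x1 \<Rightarrow> ('x \<Rightarrow> 'a) \<Rightarrow> complex mat) \<Rightarrow> ('y1 \<Rightarrow> ('y \<Rightarrow> 'b) \<Rightarrow> complex mat) \<Rightarrow> real" where
  "concat_value M G P \<psi> A B =
     measure_pmf.expectation (qdist G) (\<lambda>(x, y).
       measure_pmf.expectation (pmf_of_set (lnbrs M x)) (\<lambda>x'.
         measure_pmf.expectation (pmf_of_set (lnbrs P y)) (\<lambda>y'.
           \<Sum>a'\<in>concat_answers M (ansA G) x'. \<Sum>b'\<in>concat_answers P (ansB G) y'.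
             of_bool (pred G (a' x) (b' y) x y) * expval \<psi> (kron (A x' a') (B y' b')))))"

definition induced ::
  "nat \<Rightarrow> ('l, 'r) bigraph \<Rightarrow> 'a set \<Rightarrow> ('l \<Rightarrow> ('r \<Rightarrow> 'a) \<Rightarrow> complex mat) \<Rightarrow>
   'r \<Rightarrow> 'a \<Rightarrow> complex mat" where
  "induced d M S A x a = mat_avg d (lnbrs M x) (\<lambda>x'.
     mat_sum d {a' \<in> concat_answers M S x'. a' x = a} (A x'))"

definition induced_total ::
  "nat \<Rightarrow> ('l, 'r) bigraph \<Rightarrow> 'a set \<Rightarrow> ('l \<Rightarrow> ('r \<Rightarrow> 'a) \<Rightarrow> complex mat) \<Rightarrow>
   'r \<Rightarrow> complex mat" where
  "induced_total d M S A x = mat_sum d S (induced d M S A x)"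

definition weakly_fortified ::
  "('x1, 'x) bigraph \<Rightarrow> ('x, 'y, 'a, 'b) game \<Rightarrow> ('y1, 'y) bigraph \<Rightarrow> real \<Rightarrow> real \<Rightarrow> bool" where
  "weakly_fortified M G P \<epsilon> \<delta> \<longleftrightarrow>
     (\<forall>d \<psi> A B. concat_substrategy M G P d \<psi> A B \<longrightarrow>
        concat_value M G P \<psi> A B \<le>
          (entangled_value G + \<epsilon>) *
          measure_pmf.expectation (qdist G) (\<lambda>(x, y). expval \<psi>
            (kron (induced_total d M (ansA G) A x) (induced_total d P (ansB G) B y))) + \<delta>)"

end

theory Submission
  imports Defs "Jordan_Normal_Form.Spectral_Radius"
begin

text \<open>Identify \<open>\<psi>\<close> with a \<open>d \<times> d\<close> matrix, so that \<open>\<langle>\<psi>|M \<otimes> N|\<psi>\<rangle>\<close> becomes the Hilbert-Schmidt product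
  \<open>\<langle>M \<psi> N\<^sup>T, \<psi>\<rangle>\<close>. Applied to every entry of \<open>A\<^bsub>x'\<^esub> \<Theta>\<close>, the expander bound shows that the totals \<open>A\<^sub>x\<close>
  deviate from their mean \<open>A\<close> by at most \<open>s\<close> in root mean square, uniformly over unit vectors \<open>\<Theta>\<close>,
  whenever \<open>s \<ge> \<lambda>\<close>. If all \<open>A\<^sub>x\<close> were equal to \<open>A\<close>, conjugating the substrategy by \<open>A\<^sup>-\<^sup>1\<^sup>/\<^sup>2\<close> and moving
  \<open>A\<^sup>1\<^sup>/\<^sup>2\<close> to the state would give a complete strategy. In general put \<open>Q = A + s\<close>, \<open>L = Q\<^sup>1\<^sup>/\<^sup>2\<close> and
  \<open>R\<^sub>x = 1/2 (Q + A\<^sub>x) L\<^sup>-\<^sup>1\<close>. Then \<open>R\<^sub>x R\<^sub>x\<^sup>* - A\<^sub>x = 1/4 (Q - A\<^sub>x) Q\<^sup>-\<^sup>1 (Q - A\<^sub>x)\<close> is positive, so the operators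
  \<open>R\<^sub>x\<^sup>-\<^sup>1 A\<^sub>x\<^sup>a R\<^sub>x\<^sup>-\<^sup>*\<close> form a substrategy, and it acts on the states \<open>R\<^sub>x\<^sup>* \<psi>\<close>, which are within \<open>s/2\<close> of
  \<open>L \<psi>\<close> in mean square. Replacing first the measurements of one player and then those of the other
  compares the value of the substrategy with the entangled value times the squared norm of
  \<open>(A + s)\<^sup>1\<^sup>/\<^sup>2 \<otimes> (B + s)\<^sup>1\<^sup>/\<^sup>2 \<psi>\<close>, which is \<open>\<langle>A\<^sub>x \<otimes> B\<^sub>y\<rangle>\<close> on average up to \<open>O(s)\<close>.\<close>

section \<open>Hermitian matrices\<close>

text \<open>The obstacle is that \<open>A_x\<close> need not commute with its mean \<open>A\<close>
  and that \<open>A\<close> may be singular, so the square roots of the two cannot be compared at a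
  cost linear in their difference. \<open>R_x\<close> avoids square roots of \<open>A_x\<close>: it
  equals 1/2 (L + \<open>A_x\<close> L^-1), one Newton step from L towards such a root. Like the
  Newton iteration for numbers it overshoots, a matrix form of the inequality between arithmetic and
  geometric mean. It is affine in \<open>A_x\<close>, so its adjoint differs from L by exactly 1/2
  L^-1 (\<open>A_x\<close> - Q). The shift s balances two costs: L^-2 is at most 1/s while
  \<open>A_x\<close> - Q has mean square at most 2 s^2, which leaves s/2, and the shift itself
  enlarges the final state by O(s) only. States are compared by |a + b|^2 \<le> (1 + t) |a|^2 + (1 +
  1/t) |b|^2. The factor (1 + t)^2 multiplies the main term, so it is paid by the allowance
  \<epsilon> on the mass of the substrategy, and the additive error of order s/t is paid by
  \<delta>. The choice t = \<epsilon>/3 meets the first demand, and the size of s meets the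
  second.\<close>

lemma mat_adjoint_dim [simp]:
  "dim_row (mat_adjoint A) = dim_col A" "dim_col (mat_adjoint A) = dim_row A"
  by (auto simp: mat_adjoint_def)

lemma mat_adjoint_carrier [simp]: "A \<in> carrier_mat n m \<Longrightarrow> mat_adjoint A \<in> carrier_mat m n"
  by auto

lemma mat_adjoint_index [simp]:
  fixes A :: "complex mat"
  assumes "i < dim_col A" "j < dim_row A"
  shows "mat_adjoint A $$ (i, j) = cnj (A $$ (j, i))"
  using assms by (auto simp: mat_adjoint_def mat_of_rows_index conjugate_complex_def)

lemma mat_adjoint_adjoint [simp]: "mat_adjoint (mat_adjoint A) = (A :: complex mat)"
  by (rule eq_matI) auto

lemma mat_adjoint_mult:
  fixes A B :: "complex mat"
  assumes "A \<in> carrier_mat n m" "B \<in> carrier_mat m k"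
  shows "mat_adjoint (A * B) = mat_adjoint B * mat_adjoint A"
  using assms by (intro eq_matI) (auto simp: scalar_prod_def mult.commute intro!: sum.cong)

lemma mat_adjoint_add:
  fixes A B :: "complex mat"
  assumes "A \<in> carrier_mat n m" "B \<in> carrier_mat n m"
  shows "mat_adjoint (A + B) = mat_adjoint A + mat_adjoint B"
  using assms by (intro eq_matI) auto

lemma mat_adjoint_minus:
  fixes A B :: "complex mat"
  assumes "A \<in> carrier_mat n m" "B \<in> carrier_mat n m"
  shows "mat_adjoint (A - B) = mat_adjoint A - mat_adjoint B"
  using assms by (intro eq_matI) auto

lemma mat_adjoint_smult_real [simp]: "mat_adjoint (complex_of_real c \<cdot>\<^sub>m A) = complex_of_real c \<cdot>\<^sub>m mat_adjoint A"
  by (intro eq_matI) auto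

lemma mat_adjoint_one [simp]: "mat_adjoint (1\<^sub>m n :: complex mat) = 1\<^sub>m n"
  by (intro eq_matI) auto

text \<open>The eigenvalues are a function rather than a list, so that functional calculus amounts
  to changing \<open>b\<close> while the unitary stays fixed.\<close>

definition diag_real :: "nat \<Rightarrow> (nat \<Rightarrow> real) \<Rightarrow> complex mat" where
  "diag_real n b = mat n n (\<lambda>(i, j). if i = j then complex_of_real (b i) else 0)"

lemma diag_real_carrier [simp]: "diag_real n b \<in> carrier_mat n n"
  by (simp add: diag_real_def)

lemma mat_adjoint_diag_real [simp]: "mat_adjoint (diag_real n b) = diag_real n b"
  by (intro eq_matI) (auto simp: diag_real_def)

lemma diag_real_mult: "diag_real n b * diag_real n c = diag_real n (\<lambda>i. b i * c i)"
  by (intro eq_matI) (auto simp: diag_real_def scalar_prod_def if_distrib cong: if_cong)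

section \<open>Unitary diagonalization\<close>

lemma unitary_completion:
  fixes v :: "complex vec"
  assumes v: "v \<in> carrier_vec n" "v \<noteq> 0\<^sub>v n"
  obtains W c where "W \<in> carrier_mat n n" "mat_adjoint W * W = 1\<^sub>m n" "W * mat_adjoint W = 1\<^sub>m n"
    "col W 0 = c \<cdot>\<^sub>v v"
proof -
  interpret cof_vec_space n "TYPE(complex)" .
  define b where "b = basis_completion v"
  define ws where "ws = gram_schmidt n b"
  note bc = basis_completion[OF v, folded b_def]
  have n: "n \<noteq> 0" using v by auto
  then obtain vs where bv: "b = v # vs" using bc(6,7) by (cases b) auto
  from gram_schmidt_result[OF bc(2) bc(4) bc(5) refl, folded ws_def] bc(6)
  have ws: "set ws \<subseteq> carrier_vec n" "corthogonal ws" "length ws = n" by auto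
  from gram_schmidt_hd[OF v(1), of vs, folded bv] have hd: "hd ws = v" unfolding ws_def .
  have ws0: "ws ! 0 = v" using hd ws(3) n by (cases ws) auto
  have wsc: "ws ! i \<in> carrier_vec n" if "i < n" for i using ws that by auto
  define N where "N i = Re (ws ! i \<bullet>c ws ! i)" for i
  have NN: "ws ! i \<bullet>c ws ! i = complex_of_real (N i) \<and> N i > 0" if "i < n" for i
  proof -
    have "ws ! i \<bullet>c ws ! i \<ge> 0" by (rule conjugate_square_ge_0_vec[OF])
    moreover have "ws ! i \<bullet>c ws ! i \<noteq> 0" using corthogonalD[OF ws(2), of i i] that ws(3) by auto
    ultimately show ?thesis by (auto simp: N_def less_eq_complex_def complex_eq_iff)
  qed
  \<comment> \<open>Gram-Schmidt keeps \<open>v\<close> as its head and returns orthogonal, not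
    orthonormal, vectors. Dividing by the norms makes the columns orthonormal, which is why column 0
    is only a multiple of \<open>v\<close>.\<close>
  define W where "W = mat n n (\<lambda>(i, j). ws ! j $ i / complex_of_real (sqrt (N j)))"
  have W: "W \<in> carrier_mat n n" by (simp add: W_def)
  have WW: "mat_adjoint W * W = 1\<^sub>m n"
  proof (rule eq_matI)
    fix i j assume ij: "i < dim_row (1\<^sub>m n :: complex mat)" "j < dim_col (1\<^sub>m n :: complex mat)"
    hence ij: "i < n" "j < n" by auto
    have "(mat_adjoint W * W) $$ (i, j)
        = (\<Sum>k<n. cnj (ws ! i $ k) * ws ! j $ k / (complex_of_real (sqrt (N i)) * complex_of_real (sqrt (N j))))"
      using ij W by (auto simp: scalar_prod_def W_def atLeast0LessThan intro!: sum.cong)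
    also have "\<dots> = (ws ! j \<bullet>c ws ! i) / (complex_of_real (sqrt (N i)) * complex_of_real (sqrt (N j)))"
      using wsc[OF ij(1)] wsc[OF ij(2)]
      by (simp add: scalar_prod_def sum_divide_distrib atLeast0LessThan mult.commute conjugate_complex_def)
    also have "\<dots> = (if i = j then 1 else 0)"
    proof (cases "i = j")
      case True
      then show ?thesis using NN[OF ij(1)]
        by (simp flip: of_real_mult)
    next
      case False
      then show ?thesis using corthogonalD[OF ws(2), of j i] ij ws(3) by simp
    qed
    finally show "(mat_adjoint W * W) $$ (i, j) = 1\<^sub>m n $$ (i, j)" using ij by simp
  qed (use W in auto)
  moreover have "W * mat_adjoint W = 1\<^sub>m n"
    using mat_mult_left_right_inverse[OF _ W WW] W by simp
  moreover have "col W 0 = (1 / complex_of_real (sqrt (N 0))) \<cdot>\<^sub>v v"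
    using n wsc[of 0] ws0 by (intro eq_vecI) (auto simp: W_def)
  ultimately show thesis using that W by blast
qed

text \<open>Induction on the dimension: conjugation by a unitary whose column 0 is an eigenvector
  clears the rest of column 0, Hermitian symmetry clears the rest of row 0, and the remaining block
  is Hermitian again.\<close>

theorem hermitian_diagonalization:
  assumes "A \<in> carrier_mat n n" "mat_adjoint A = (A :: complex mat)"
  obtains U b where "U \<in> carrier_mat n n" "mat_adjoint U * U = 1\<^sub>m n" "U * mat_adjoint U = 1\<^sub>m n"
    "A = U * diag_real n b * mat_adjoint U"
proof -
  have "\<exists>U b. U \<in> carrier_mat n n \<and> mat_adjoint U * U = 1\<^sub>m n \<and> U * mat_adjoint U = 1\<^sub>m n \<and>
    A = U * diag_real n b * mat_adjoint U"
    using assms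
  proof (induction n arbitrary: A)
    case 0
    then show ?case by (intro exI[of _ "1\<^sub>m 0"] exI[of _ "\<lambda>_. 0"]) (auto intro!: eq_matI)
  next
    case (Suc n)
    note A = Suc.prems
    from spectrum_non_empty[OF A(1)] obtain e where "eigenvalue A e"
      by (auto simp: spectrum_def)
    then obtain v where v: "v \<in> carrier_vec (Suc n)" "v \<noteq> 0\<^sub>v (Suc n)" "A *\<^sub>v v = e \<cdot>\<^sub>v v"
      using A by (auto simp: eigenvalue_def eigenvector_def)
    obtain W c where W: "W \<in> carrier_mat (Suc n) (Suc n)" and WW: "mat_adjoint W * W = 1\<^sub>m (Suc n)"
      "W * mat_adjoint W = 1\<^sub>m (Suc n)" and colW: "col W 0 = c \<cdot>\<^sub>v v"
      using unitary_completion[OF v(1,2)] by metis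
    have Wa: "mat_adjoint W \<in> carrier_mat (Suc n) (Suc n)" using W by simp
    define A' where "A' = mat_adjoint W * A * W"
    have cl: "X * Y \<in> carrier_mat (Suc n) (Suc n)"
      if "X \<in> carrier_mat (Suc n) (Suc n)" "Y \<in> carrier_mat (Suc n) (Suc n)" for X Y :: "complex mat"
      using that by simp
    note as = assoc_mult_mat[where n\<^sub>1="Suc n" and n\<^sub>2="Suc n" and n\<^sub>3="Suc n" and n\<^sub>4="Suc n"]
    have A': "A' \<in> carrier_mat (Suc n) (Suc n)" using A W Wa by (simp add: A'_def cl)
    have hA': "mat_adjoint A' = A'"
      unfolding A'_def using A W Wa
      by (simp add: mat_adjoint_mult[where n="Suc n" and m="Suc n" and k="Suc n"] as cl)
    have c0: "A' $$ (i, 0) = (if i = 0 then e else 0)" if i: "i < Suc n" for i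
    proof -
      have "A' = mat_adjoint W * (A * W)" using A W Wa by (simp add: A'_def as cl)
      hence "col A' 0 = mat_adjoint W *\<^sub>v col (A * W) 0"
        by (simp only: col_mult2[OF Wa cl[OF A(1) W] zero_less_Suc])
      also have "col (A * W) 0 = A *\<^sub>v col W 0" by (rule col_mult2[OF A(1) W zero_less_Suc])
      also have "\<dots> = e \<cdot>\<^sub>v col W 0"
        unfolding colW using v A by (simp add: mult_mat_vec smult_smult_assoc mult.commute)
      also have "mat_adjoint W *\<^sub>v (e \<cdot>\<^sub>v col W 0) = e \<cdot>\<^sub>v (mat_adjoint W *\<^sub>v col W 0)"
        by (rule mult_mat_vec[OF Wa]) (use W col_dim[of W 0] in simp)
      also have "mat_adjoint W *\<^sub>v col W 0 = col (mat_adjoint W * W) 0"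
        by (rule col_mult2[OF Wa W zero_less_Suc, symmetric])
      finally have "col A' 0 = e \<cdot>\<^sub>v unit_vec (Suc n) 0" using WW by simp
      hence "col A' 0 $ i = (e \<cdot>\<^sub>v unit_vec (Suc n) 0) $ i" by simp
      thus ?thesis using i A' by auto
    qed
    have r0: "A' $$ (0, j) = (if j = 0 then cnj e else 0)" if j: "j < Suc n" for j
    proof -
      have "A' $$ (0, j) = cnj (A' $$ (j, 0))"
        by (subst hA'[symmetric]) (use j A' in auto)
      thus ?thesis using c0[OF j] by simp
    qed
    \<comment> \<open>The corner entry is \<open>e\<close> when read in the column and
      \<open>cnj e\<close> when read in the row, so the eigenvalue is real.\<close>
    have e: "complex_of_real (Re e) = e" using r0[of 0] c0[of 0] by (simp add: complex_eq_iff)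
    define A3 where "A3 = mat n n (\<lambda>(i, j). A' $$ (Suc i, Suc j))"
    have A3: "A3 \<in> carrier_mat n n" by (simp add: A3_def)
    have "mat_adjoint A3 = A3"
    proof (rule eq_matI)
      fix i j assume "i < dim_row A3" "j < dim_col A3"
      hence ij: "i < n" "j < n" using A3 by auto
      have "cnj (A' $$ (Suc j, Suc i)) = mat_adjoint A' $$ (Suc i, Suc j)" using A' ij by simp
      thus "mat_adjoint A3 $$ (i, j) = A3 $$ (i, j)" using ij A3 hA' by (simp add: A3_def)
    qed (use A3 in auto)
    from Suc.IH[OF A3 this] obtain U3 b3 where U3: "U3 \<in> carrier_mat n n"
      and UU3: "mat_adjoint U3 * U3 = 1\<^sub>m n" "U3 * mat_adjoint U3 = 1\<^sub>m n"
      and A3U: "A3 = U3 * diag_real n b3 * mat_adjoint U3" by blast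
    have U3a: "mat_adjoint U3 \<in> carrier_mat n n" using U3 by simp
    define blk where "blk x X = four_block_mat (mat 1 1 (\<lambda>_. x)) (0\<^sub>m 1 n) (0\<^sub>m n 1) X" for x :: complex and X
    have blk: "blk x X \<in> carrier_mat (Suc n) (Suc n)" if "X \<in> carrier_mat n n" for x X
      using that by (auto simp: blk_def)
    have blkm: "blk x X * blk y Y = blk (x * y) (X * Y)" if "X \<in> carrier_mat n n" "Y \<in> carrier_mat n n" for x y X Y
    proof -
      have "blk x X * blk y Y = four_block_mat
        (mat 1 1 (\<lambda>_. x) * mat 1 1 (\<lambda>_. y) + 0\<^sub>m 1 n * 0\<^sub>m n 1) (mat 1 1 (\<lambda>_. x) * 0\<^sub>m 1 n + 0\<^sub>m 1 n * Y)
        (0\<^sub>m n 1 * mat 1 1 (\<lambda>_. y) + X * 0\<^sub>m n 1) (0\<^sub>m n 1 * 0\<^sub>m 1 n + X * Y)"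
        unfolding blk_def by (rule mult_four_block_mat) (use that in auto)
      also have "\<dots> = blk (x * y) (X * Y)"
        unfolding blk_def
        by (rule cong_four_block_mat) (use that in \<open>auto simp: scalar_prod_def\<close>)
      finally show ?thesis .
    qed
    have blka: "mat_adjoint (blk x X) = blk (cnj x) (mat_adjoint X)" if "X \<in> carrier_mat n n" for x X
      using that by (intro eq_matI) (auto simp: blk_def)
    have blk1: "blk 1 (1\<^sub>m n) = 1\<^sub>m (Suc n)" by (intro eq_matI) (auto simp: blk_def)
    have blkd: "blk e (diag_real n b3) = diag_real (Suc n) (case_nat (Re e) b3)"
      by (intro eq_matI) (auto simp: blk_def diag_real_def e split: nat.splits)
    have A'b: "A' = blk e A3"
    proof (rule eq_matI)
      fix i j assume "i < dim_row (blk e A3)" "j < dim_col (blk e A3)"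
      hence "i < Suc n" "j < Suc n" using blk[OF A3, of e] by auto
      thus "A' $$ (i, j) = blk e A3 $$ (i, j)"
        using c0[of i] r0[of j] by (auto simp: blk_def A3_def)
    qed (use A' blk[OF A3, of e] in auto)
    define V where "V = blk 1 U3"
    have V: "V \<in> carrier_mat (Suc n) (Suc n)" and Va: "mat_adjoint V \<in> carrier_mat (Suc n) (Suc n)"
      using blk[OF U3] by (auto simp: V_def)
    have VV: "mat_adjoint V * V = 1\<^sub>m (Suc n)" "V * mat_adjoint V = 1\<^sub>m (Suc n)"
      using U3 U3a by (auto simp: V_def blka blkm UU3 blk1)
    define D where "D = diag_real (Suc n) (case_nat (Re e) b3)"
    have D: "D \<in> carrier_mat (Suc n) (Suc n)" by (simp add: D_def)
    have "V * D * mat_adjoint V = blk e (U3 * diag_real n b3) * mat_adjoint V"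
      unfolding V_def D_def blkd[symmetric] by (subst blkm) (use U3 in auto)
    also have "\<dots> = blk e A3"
      unfolding V_def blka[OF U3] A3U by (subst blkm) (use U3 in auto)
    finally have A'V: "A' = V * D * mat_adjoint V" using A'b by simp
    define U where "U = W * V"
    have U: "U \<in> carrier_mat (Suc n) (Suc n)" using W V by (simp add: U_def)
    have Ua: "mat_adjoint U = mat_adjoint V * mat_adjoint W"
      unfolding U_def by (rule mat_adjoint_mult[OF W V])
    have "mat_adjoint U * U = mat_adjoint V * ((mat_adjoint W * W) * V)"
      unfolding Ua unfolding U_def using W V Wa Va by (simp add: as cl)
    hence 1: "mat_adjoint U * U = 1\<^sub>m (Suc n)" using V VV WW by simp
    have 2: "U * mat_adjoint U = 1\<^sub>m (Suc n)"
      using mat_mult_left_right_inverse[OF _ U 1] U by simp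
    have "U * D * mat_adjoint U = W * (V * D * mat_adjoint V) * mat_adjoint W"
      unfolding Ua unfolding U_def using W V Wa Va D by (simp add: as cl)
    also have "\<dots> = (W * mat_adjoint W) * A * (W * mat_adjoint W)"
      unfolding A'V[symmetric] A'_def using W Wa A by (simp add: as cl)
    also have "\<dots> = A" using A WW by simp
    finally have 3: "A = U * diag_real (Suc n) (case_nat (Re e) b3) * mat_adjoint U" by (simp add: D_def)
    show ?case using U 1 2 3 by blast
  qed
  thus thesis using that by blast
qed

section \<open>Hilbert-Schmidt product and positive matrices\<close>

text \<open>Taking the real part makes the complex matrices a real Euclidean space: the product is
  symmetric and all estimates are between real numbers.\<close>

definition hs_inner :: "nat \<Rightarrow> complex mat \<Rightarrow> complex mat \<Rightarrow> real" where
  "hs_inner d X Y = Re (\<Sum>i<d. \<Sum>j<d. X $$ (i, j) * cnj (Y $$ (i, j)))"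

definition bip_form :: "nat \<Rightarrow> complex mat \<Rightarrow> complex mat \<Rightarrow> complex mat \<Rightarrow> real" where
  "bip_form d M N X = hs_inner d (M * X * N\<^sup>T) X"

lemma mult_square_carrier [simp]:
  "A \<in> carrier_mat d d \<Longrightarrow> B \<in> carrier_mat d d \<Longrightarrow> A * B \<in> carrier_mat d d"
  by simp

lemma assoc_square:
  "A \<in> carrier_mat d d \<Longrightarrow> B \<in> carrier_mat d d \<Longrightarrow> C \<in> carrier_mat d d \<Longrightarrow>
   A * B * C = A * (B * (C :: complex mat))"
  by simp

lemma hs_inner_add:
  assumes "X \<in> carrier_mat d d" "Y \<in> carrier_mat d d"
  shows "hs_inner d (X + Y) Z = hs_inner d X Z + hs_inner d Y Z"
  using assms by (simp add: hs_inner_def algebra_simps sum.distrib)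

lemma hs_inner_diff:
  assumes "X \<in> carrier_mat d d" "Y \<in> carrier_mat d d"
  shows "hs_inner d (X - Y) Z = hs_inner d X Z - hs_inner d Y Z"
  using assms by (simp add: hs_inner_def algebra_simps sum_subtractf)

lemma hs_inner_smult:
  assumes "X \<in> carrier_mat d d"
  shows "hs_inner d (complex_of_real c \<cdot>\<^sub>m X) Z = c * hs_inner d X Z"
  using assms by (simp add: hs_inner_def sum_distrib_left algebra_simps)

lemma hs_inner_commute: "hs_inner d X Y = hs_inner d Y X"
  by (simp add: hs_inner_def mult.commute)

lemma hs_inner_self: "hs_inner d X X = (\<Sum>i<d. \<Sum>j<d. (cmod (X $$ (i, j)))\<^sup>2)"
  by (simp add: hs_inner_def cmod_power2 sum.distrib flip: power2_eq_square)

lemma hs_inner_self_nonneg [simp]: "0 \<le> hs_inner d X X"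
  by (simp add: hs_inner_self sum_nonneg)

lemma hs_inner_transpose:
  assumes "X \<in> carrier_mat d d" "Y \<in> carrier_mat d d"
  shows "hs_inner d X\<^sup>T Y\<^sup>T = hs_inner d X Y"
proof -
  have "(\<Sum>i<d. \<Sum>j<d. X\<^sup>T $$ (i, j) * cnj (Y\<^sup>T $$ (i, j))) = (\<Sum>i<d. \<Sum>j<d. X $$ (j, i) * cnj (Y $$ (j, i)))"
    using assms by (intro sum.cong) auto
  also have "\<dots> = (\<Sum>i<d. \<Sum>j<d. X $$ (i, j) * cnj (Y $$ (i, j)))" by (rule sum.swap)
  finally show ?thesis by (simp add: hs_inner_def)
qed

lemma hs_inner_mult_left:
  assumes "F \<in> carrier_mat d d" "X \<in> carrier_mat d d" "Y \<in> carrier_mat d d"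
  shows "hs_inner d (F * X) Y = hs_inner d X (mat_adjoint F * Y)"
proof -
  have "(\<Sum>i<d. \<Sum>j<d. (F * X) $$ (i, j) * cnj (Y $$ (i, j)))
      = (\<Sum>i<d. \<Sum>j<d. \<Sum>k<d. F $$ (i, k) * X $$ (k, j) * cnj (Y $$ (i, j)))"
    using assms by (auto simp: scalar_prod_def sum_distrib_right atLeast0LessThan intro!: sum.cong)
  also have "\<dots> = (\<Sum>j<d. \<Sum>k<d. \<Sum>i<d. F $$ (i, k) * X $$ (k, j) * cnj (Y $$ (i, j)))"
    by (subst sum.swap) (intro sum.cong refl sum.swap)
  also have "\<dots> = (\<Sum>k<d. \<Sum>j<d. \<Sum>i<d. F $$ (i, k) * X $$ (k, j) * cnj (Y $$ (i, j)))"
    by (rule sum.swap)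
  also have "\<dots> = (\<Sum>k<d. \<Sum>j<d. X $$ (k, j) * cnj ((mat_adjoint F * Y) $$ (k, j)))"
    using assms by (auto simp: scalar_prod_def sum_distrib_left atLeast0LessThan mult_ac intro!: sum.cong)
  finally show ?thesis by (simp add: hs_inner_def)
qed

lemma transpose_mat_adjoint: "mat_adjoint (A\<^sup>T) = (mat_adjoint (A :: complex mat))\<^sup>T"
  by (intro eq_matI) auto

lemma hs_inner_mult_right:
  assumes "G \<in> carrier_mat d d" "X \<in> carrier_mat d d" "Y \<in> carrier_mat d d"
  shows "hs_inner d (X * G) Y = hs_inner d X (Y * mat_adjoint G)"
proof -
  have "hs_inner d (X * G) Y = hs_inner d (G\<^sup>T * X\<^sup>T) Y\<^sup>T"
    using assms by (subst hs_inner_transpose[symmetric, of _ d])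
      (auto simp: transpose_mult[where nr=d and n=d and nc=d])
  also have "\<dots> = hs_inner d X\<^sup>T ((mat_adjoint G)\<^sup>T * Y\<^sup>T)"
    using assms by (subst hs_inner_mult_left) (auto simp: transpose_mat_adjoint)
  also have "(mat_adjoint G)\<^sup>T * Y\<^sup>T = (Y * mat_adjoint G)\<^sup>T"
    using assms by (intro transpose_mult[symmetric, where nr=d and n=d and nc=d]) auto
  also have "hs_inner d X\<^sup>T \<dots> = hs_inner d X (Y * mat_adjoint G)"
    using assms by (intro hs_inner_transpose) auto
  finally show ?thesis .
qed

lemma hs_inner_eq_0:
  assumes "hs_inner d X X = 0" "i < d" "j < d"
  shows "X $$ (i, j) = 0"
proof -
  have "(\<Sum>j<d. (cmod (X $$ (i, j)))\<^sup>2) = 0"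
    using assms(1,2) by (simp add: hs_inner_self sum_nonneg_eq_0_iff sum_nonneg)
  thus ?thesis using assms(3) by (simp add: sum_nonneg_eq_0_iff)
qed

lemma hs_inner_smult_self:
  assumes "X \<in> carrier_mat d d"
  shows "hs_inner d (complex_of_real c \<cdot>\<^sub>m X) (complex_of_real c \<cdot>\<^sub>m X) = c\<^sup>2 * hs_inner d X X"
  using assms hs_inner_smult[OF assms, of c X] hs_inner_smult[OF assms, of c "complex_of_real c \<cdot>\<^sub>m X"]
    hs_inner_commute[of d X "complex_of_real c \<cdot>\<^sub>m X"]
  by (simp add: power2_eq_square)

lemma hs_inner_diff_smult:
  assumes "X \<in> carrier_mat d d" "Y \<in> carrier_mat d d"
  shows "hs_inner d (X - complex_of_real c \<cdot>\<^sub>m Y) (X - complex_of_real c \<cdot>\<^sub>m Y)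
    = hs_inner d X X - 2 * c * hs_inner d X Y + c\<^sup>2 * hs_inner d Y Y"
proof -
  let ?W = "X - complex_of_real c \<cdot>\<^sub>m Y"
  have l: "hs_inner d ?W Z = hs_inner d X Z - c * hs_inner d Y Z" for Z
    using assms by (simp add: hs_inner_diff[where d=d] hs_inner_smult)
  have "hs_inner d ?W ?W = hs_inner d ?W X - c * hs_inner d ?W Y"
    unfolding l[of ?W] by (simp add: hs_inner_commute)
  also have "\<dots> = hs_inner d X X - 2 * c * hs_inner d X Y + c\<^sup>2 * hs_inner d Y Y"
    unfolding l using hs_inner_commute[of d X Y] by (simp add: algebra_simps power2_eq_square)
  finally show ?thesis .
qed

text \<open>The right side minus the left side is 1/t times the squared norm of X - (1 + t) Y. A
  small \<open>t\<close> keeps the factor of the main term near 1 at the price of a large factor on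
  the error.\<close>

lemma hs_inner_diff_weighted:
  assumes "X \<in> carrier_mat d d" "Y \<in> carrier_mat d d" "t > 0"
  shows "hs_inner d X X \<le> (1 + t) * hs_inner d Y Y + (1 + 1 / t) * hs_inner d (X - Y) (X - Y)"
proof -
  define x y z where "x = hs_inner d X X" and "y = hs_inner d Y Y" and "z = hs_inner d X Y"
  have "complex_of_real 1 \<cdot>\<^sub>m Y = Y" by (intro eq_matI) auto
  hence xy: "hs_inner d (X - Y) (X - Y) = x + y - 2 * z"
    using hs_inner_diff_smult[OF assms(1,2), of 1] by (simp add: x_def y_def z_def)
  have "0 \<le> hs_inner d (X - complex_of_real (1 + t) \<cdot>\<^sub>m Y) (X - complex_of_real (1 + t) \<cdot>\<^sub>m Y)" by simp
  hence "0 \<le> (x - 2 * (1 + t) * z + (1 + t)\<^sup>2 * y) / t"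
    using assms unfolding hs_inner_diff_smult[OF assms(1,2)] x_def y_def z_def by (intro divide_nonneg_pos)
  also have "\<dots> = (1 + t) * y + (1 + 1 / t) * (x + y - 2 * z) - x"
    using assms by (simp add: field_simps power2_eq_square)
  finally show ?thesis unfolding xy by (simp add: x_def y_def)
qed

section \<open>Positive matrices and their square roots\<close>

lemma psd_carrier: "psd d M \<Longrightarrow> M \<in> carrier_mat d d"
  by (simp add: psd_def)

lemma psd_hermitian: "psd d M \<Longrightarrow> mat_adjoint M = M"
  by (simp add: psd_def)

lemma cscalar_adjoint:
  fixes F :: "complex mat"
  assumes "F \<in> carrier_mat n m" "v \<in> carrier_vec m" "w \<in> carrier_vec n"
  shows "(F *\<^sub>v v) \<bullet>c w = v \<bullet>c (mat_adjoint F *\<^sub>v w)"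
proof -
  have "(F *\<^sub>v v) \<bullet>c w = (\<Sum>i<n. \<Sum>k<m. F $$ (i, k) * v $ k * cnj (w $ i))"
    using assms by (auto simp: scalar_prod_def sum_distrib_right atLeast0LessThan conjugate_complex_def intro!: sum.cong)
  also have "\<dots> = (\<Sum>k<m. \<Sum>i<n. F $$ (i, k) * v $ k * cnj (w $ i))" by (rule sum.swap)
  also have "\<dots> = v \<bullet>c (mat_adjoint F *\<^sub>v w)"
    using assms by (auto simp: scalar_prod_def sum_distrib_left atLeast0LessThan conjugate_complex_def mult_ac intro!: sum.cong)
  finally show ?thesis .
qed

lemma psd_gram:
  assumes F: "F \<in> carrier_mat d d"
  shows "psd d (F * mat_adjoint F)"
  unfolding psd_def
proof (intro conjI ballI)
  show "F * mat_adjoint F \<in> carrier_mat d d" using F by simp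
  show "mat_adjoint (F * mat_adjoint F) = F * mat_adjoint F"
    using F by (subst mat_adjoint_mult[of _ d d _ d]) auto
  fix v :: "complex vec" assume v: "v \<in> carrier_vec d"
  have Fa: "mat_adjoint F \<in> carrier_mat d d" using F by simp
  have Fv: "mat_adjoint F *\<^sub>v v \<in> carrier_vec d" by (rule mult_mat_vec_carrier[OF Fa v])
  have "(F * mat_adjoint F *\<^sub>v v) \<bullet>c v = (F *\<^sub>v (mat_adjoint F *\<^sub>v v)) \<bullet>c v"
    by (subst assoc_mult_mat_vec[OF F Fa v]) simp
  also have "\<dots> = (mat_adjoint F *\<^sub>v v) \<bullet>c (mat_adjoint F *\<^sub>v v)"
    by (rule cscalar_adjoint[OF F Fv v])
  also have "0 \<le> \<dots>" by (rule conjugate_square_ge_0_vec)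
  finally show "0 \<le> (F * mat_adjoint F *\<^sub>v v) \<bullet>c v" .
qed

lemma psd_add: "psd d M \<Longrightarrow> psd d N \<Longrightarrow> psd d (M + N)"
  unfolding psd_def
  by (auto simp: mat_adjoint_add[of _ d d] add_mult_distrib_mat_vec[of _ d d]
      add_scalar_prod_distrib[of _ d] intro!: add_nonneg_nonneg)

lemma psd_smult:
  assumes "psd d M" "0 \<le> c"
  shows "psd d (complex_of_real c \<cdot>\<^sub>m M)"
  unfolding psd_def
proof (intro conjI ballI)
  show "complex_of_real c \<cdot>\<^sub>m M \<in> carrier_mat d d" using assms by (simp add: psd_def)
  show "mat_adjoint (complex_of_real c \<cdot>\<^sub>m M) = complex_of_real c \<cdot>\<^sub>m M" using assms by (simp add: psd_def)
  fix v :: "complex vec" assume v: "v \<in> carrier_vec d"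
  have M: "M \<in> carrier_mat d d" using assms by (simp add: psd_def)
  have "(complex_of_real c \<cdot>\<^sub>m M *\<^sub>v v) \<bullet>c v = complex_of_real c * ((M *\<^sub>v v) \<bullet>c v)"
    using M v by (auto simp: scalar_prod_def sum_distrib_left mult_ac intro!: sum.cong)
  also have "0 \<le> \<dots>" using assms v by (intro mult_nonneg_nonneg) (auto simp: psd_def less_eq_complex_def)
  finally show "0 \<le> (complex_of_real c \<cdot>\<^sub>m M *\<^sub>v v) \<bullet>c v" .
qed

text \<open>Each \<open>b i\<close> is nonnegative because it is the value of the form of
  \<open>M\<close> at the i-th column of \<open>U\<close>.\<close>

lemma psd_spectral:
  assumes "psd d M"
  obtains U b where "U \<in> carrier_mat d d" "mat_adjoint U * U = 1\<^sub>m d" "U * mat_adjoint U = 1\<^sub>m d"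
    "M = U * diag_real d b * mat_adjoint U" "\<And>i. i < d \<Longrightarrow> 0 \<le> b i"
proof -
  have M: "M \<in> carrier_mat d d" "mat_adjoint M = M" using assms by (auto simp: psd_def)
  from hermitian_diagonalization[OF M] obtain U b where U: "U \<in> carrier_mat d d"
    "mat_adjoint U * U = 1\<^sub>m d" "U * mat_adjoint U = 1\<^sub>m d" "M = U * diag_real d b * mat_adjoint U" by metis
  have "0 \<le> b i" if i: "i < d" for i
  proof -
    have Ua: "mat_adjoint U \<in> carrier_mat d d" using U by simp
    have D: "diag_real d b \<in> carrier_mat d d" by simp
    have UD: "U * diag_real d b \<in> carrier_mat d d" using U D by simp
    let ?e = "unit_vec d i :: complex vec"
    have e: "?e \<in> carrier_vec d" by simp
    have Ue: "U *\<^sub>v ?e \<in> carrier_vec d" by (rule mult_mat_vec_carrier[OF U(1) e])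
    have De: "diag_real d b *\<^sub>v ?e = complex_of_real (b i) \<cdot>\<^sub>v ?e"
      using i by (intro eq_vecI) (auto simp: diag_real_def)
    have UUe: "mat_adjoint U *\<^sub>v (U *\<^sub>v ?e) = ?e"
      using U Ua e by (subst assoc_mult_mat_vec[OF Ua U(1) e, symmetric]) simp
    have "M *\<^sub>v (U *\<^sub>v ?e) = U *\<^sub>v (diag_real d b *\<^sub>v (mat_adjoint U *\<^sub>v (U *\<^sub>v ?e)))"
      unfolding U(4) by (subst assoc_mult_mat_vec[OF UD Ua Ue], subst assoc_mult_mat_vec[OF U(1) D])
        (use Ua Ue in \<open>auto intro: mult_mat_vec_carrier\<close>)
    hence "(M *\<^sub>v (U *\<^sub>v ?e)) \<bullet>c (U *\<^sub>v ?e) = (U *\<^sub>v (complex_of_real (b i) \<cdot>\<^sub>v ?e)) \<bullet>c (U *\<^sub>v ?e)"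
      unfolding UUe De by simp
    also have "\<dots> = (complex_of_real (b i) \<cdot>\<^sub>v ?e) \<bullet>c (mat_adjoint U *\<^sub>v (U *\<^sub>v ?e))"
      by (rule cscalar_adjoint[OF U(1) _ Ue]) simp
    also have "\<dots> = complex_of_real (b i)" unfolding UUe using i by simp
    finally have "0 \<le> complex_of_real (b i)" using assms Ue by (auto simp: psd_def)
    thus ?thesis by (simp add: less_eq_complex_def)
  qed
  thus thesis using that U by blast
qed

text \<open>Functional calculus for a fixed unitary: products of matrices are pointwise products of
  eigenvalue functions, so square roots and inverses are found by choosing the function.\<close>

lemma spectral_mult:
  assumes "U \<in> carrier_mat d d" "mat_adjoint U * U = 1\<^sub>m d"
  shows "(U * diag_real d b * mat_adjoint U) * (U * diag_real d c * mat_adjoint U)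
    = U * diag_real d (\<lambda>i. b i * c i) * mat_adjoint U"
proof -
  let ?a = "mat_adjoint U" and ?B = "diag_real d b" and ?C = "diag_real d c"
  have c: "?a \<in> carrier_mat d d" "?B \<in> carrier_mat d d" "?C \<in> carrier_mat d d" using assms by auto
  have "(U * ?B * ?a) * (U * ?C * ?a) = U * ?B * (?a * U) * (?C * ?a)"
    using assms(1) c by (simp add: assoc_square[where d=d])
  also have "\<dots> = U * (?B * ?C) * ?a"
    unfolding assms(2) using assms(1) c by (simp add: assoc_square[where d=d] left_mult_one_mat[of _ d d])
  finally show ?thesis by (simp add: diag_real_mult)
qed

lemma spectral_hermitian:
  assumes "U \<in> carrier_mat d d"
  shows "mat_adjoint (U * diag_real d b * mat_adjoint U) = U * diag_real d b * mat_adjoint U"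
  using assms by (simp add: mat_adjoint_mult[of _ d d _ d] assoc_square[where d=d])

lemma psd_sqrt:
  assumes "psd d M"
  obtains F where "F \<in> carrier_mat d d" "mat_adjoint F = F" "M = F * F"
proof -
  obtain U b where U: "U \<in> carrier_mat d d" "mat_adjoint U * U = 1\<^sub>m d"
    "M = U * diag_real d b * mat_adjoint U" and b: "\<And>i. i < d \<Longrightarrow> 0 \<le> b i"
    using psd_spectral[OF assms] by metis
  have "diag_real d (\<lambda>i. sqrt (b i) * sqrt (b i)) = diag_real d b"
    using b by (intro eq_matI) (auto simp: diag_real_def simp flip: of_real_mult)
  hence "M = (U * diag_real d (\<lambda>i. sqrt (b i)) * mat_adjoint U) * (U * diag_real d (\<lambda>i. sqrt (b i)) * mat_adjoint U)"
    using spectral_mult[OF U(1,2)] U(3) by simp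
  moreover have "U * diag_real d (\<lambda>i. sqrt (b i)) * mat_adjoint U \<in> carrier_mat d d"
    using U(1) by simp
  ultimately show thesis using that spectral_hermitian[OF U(1)] by blast
qed

lemma psd_conj:
  assumes "psd d M" "F \<in> carrier_mat d d"
  shows "psd d (F * M * mat_adjoint F)"
proof -
  obtain S where S: "S \<in> carrier_mat d d" "mat_adjoint S = S" "M = S * S" using psd_sqrt[OF assms(1)] .
  have "F * M * mat_adjoint F = (F * S) * mat_adjoint (F * S)"
    using S assms by (simp add: mat_adjoint_mult[of _ d d _ d] assoc_square[where d=d])
  thus ?thesis using psd_gram[of "F * S" d] S assms by simp
qed

section \<open>The form of a tensor product\<close>

lemma bip_form_expand:
  assumes "M \<in> carrier_mat d d" "N \<in> carrier_mat d d" "X \<in> carrier_mat d d"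
  shows "bip_form d M N X = Re (\<Sum>i<d. \<Sum>j<d. \<Sum>k<d. \<Sum>l<d.
    M $$ (i, k) * N $$ (j, l) * X $$ (k, l) * cnj (X $$ (i, j)))"
proof -
  have "(M * X * N\<^sup>T) $$ (i, j) = (\<Sum>k<d. \<Sum>l<d. M $$ (i, k) * N $$ (j, l) * X $$ (k, l))"
    if "i < d" "j < d" for i j
    using that assms by (auto simp: scalar_prod_def sum_distrib_left atLeast0LessThan mult_ac intro!: sum.cong)
  thus ?thesis by (simp add: bip_form_def hs_inner_def sum_distrib_right)
qed

text \<open>Transposing the matrix of the state exchanges the players. Facts are proved for the left
  factor and carried to the right one through this identity.\<close>

lemma bip_form_transpose:
  assumes "M \<in> carrier_mat d d" "N \<in> carrier_mat d d" "X \<in> carrier_mat d d"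
  shows "bip_form d M N X = bip_form d N M X\<^sup>T"
proof -
  have "hs_inner d (M * X * N\<^sup>T) X = hs_inner d (M * X * N\<^sup>T)\<^sup>T X\<^sup>T"
    using assms by (intro hs_inner_transpose[symmetric]) auto
  also have "(M * X * N\<^sup>T)\<^sup>T = N * X\<^sup>T * M\<^sup>T"
    using assms by (simp add: transpose_mult[of _ d d _ d] assoc_square[where d=d])
  finally show ?thesis by (simp add: bip_form_def)
qed

lemma mat_sum_carrier [simp]: "mat_sum d I F \<in> carrier_mat d d"
  by (simp add: mat_sum_def)

lemma mat_sum_dim [simp]: "dim_row (mat_sum d I F) = d" "dim_col (mat_sum d I F) = d"
  by (simp_all add: mat_sum_def)

lemma mat_sum_index [simp]: "i < d \<Longrightarrow> j < d \<Longrightarrow> mat_sum d I F $$ (i, j) = (\<Sum>k\<in>I. F k $$ (i, j))"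
  by (simp add: mat_sum_def)

lemma mat_avg_carrier [simp]: "mat_avg d I F \<in> carrier_mat d d"
  by (simp add: mat_avg_def)

lemma mat_sum_empty: "mat_sum d {} F = 0\<^sub>m d d"
  by (intro eq_matI) auto

lemma mat_sum_insert:
  assumes "finite I" "k \<notin> I" "F k \<in> carrier_mat d d"
  shows "mat_sum d (insert k I) F = F k + mat_sum d I F"
  using assms by (intro eq_matI) auto

lemma mat_sum_cong: "(\<And>k. k \<in> I \<Longrightarrow> F k = G k) \<Longrightarrow> mat_sum d I F = mat_sum d I G"
  by (intro eq_matI) auto

lemma psd_zero: "psd d (0\<^sub>m d d)"
  using psd_gram[of "0\<^sub>m d d" d] by simp

lemma psd_one: "psd d (1\<^sub>m d)"
  using psd_gram[of "1\<^sub>m d" d] by simp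

lemma psd_mat_sum:
  assumes "finite I" "\<And>k. k \<in> I \<Longrightarrow> psd d (F k)"
  shows "psd d (mat_sum d I F)"
  using assms
  by (induction I rule: finite_induct) (auto simp: mat_sum_empty psd_zero mat_sum_insert psd_add psd_carrier)

lemma mat_sum_mult:
  assumes "finite I" "\<And>k. k \<in> I \<Longrightarrow> F k \<in> carrier_mat d d" "A \<in> carrier_mat d d" "B \<in> carrier_mat d d"
  shows "A * mat_sum d I F * B = mat_sum d I (\<lambda>k. A * F k * B)"
  using assms
proof (induction I rule: finite_induct)
  case empty
  then show ?case by (simp add: mat_sum_empty)
next
  case (insert k I)
  have "A * mat_sum d (insert k I) F * B = A * F k * B + A * mat_sum d I F * B"
    using insert by (simp add: mat_sum_insert mult_add_distrib_mat[of _ d d _ d] add_mult_distrib_mat[of _ d d _ _ d])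
  thus ?case using insert by (simp add: mat_sum_insert)
qed

lemma bip_form_add_left:
  assumes "M \<in> carrier_mat d d" "M' \<in> carrier_mat d d" "N \<in> carrier_mat d d" "X \<in> carrier_mat d d"
  shows "bip_form d (M + M') N X = bip_form d M N X + bip_form d M' N X"
  using assms by (simp add: bip_form_def add_mult_distrib_mat[of _ d d _ _ d] hs_inner_add)

lemma bip_form_diff_left:
  assumes "M \<in> carrier_mat d d" "M' \<in> carrier_mat d d" "N \<in> carrier_mat d d" "X \<in> carrier_mat d d"
  shows "bip_form d (M - M') N X = bip_form d M N X - bip_form d M' N X"
  using assms by (simp add: bip_form_def minus_mult_distrib_mat[of _ d d _ _ d] hs_inner_diff)

lemma bip_form_smult_left:
  assumes "M \<in> carrier_mat d d" "N \<in> carrier_mat d d" "X \<in> carrier_mat d d"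
  shows "bip_form d (complex_of_real c \<cdot>\<^sub>m M) N X = c * bip_form d M N X"
  using assms by (simp add: bip_form_def mult_smult_assoc_mat[of _ d d _ d] hs_inner_smult)

lemma bip_form_zero_left:
  assumes "N \<in> carrier_mat d d" "X \<in> carrier_mat d d"
  shows "bip_form d (0\<^sub>m d d) N X = 0"
  using assms by (simp add: bip_form_expand)

lemma bip_form_sum_left:
  assumes "finite I" "\<And>k. k \<in> I \<Longrightarrow> F k \<in> carrier_mat d d" "N \<in> carrier_mat d d" "X \<in> carrier_mat d d"
  shows "bip_form d (mat_sum d I F) N X = (\<Sum>k\<in>I. bip_form d (F k) N X)"
  using assms
  by (induction I rule: finite_induct)
    (auto simp: mat_sum_empty mat_sum_insert bip_form_zero_left bip_form_add_left)

lemma bip_form_avg_left: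
  assumes "finite I" "\<And>k. k \<in> I \<Longrightarrow> F k \<in> carrier_mat d d" "N \<in> carrier_mat d d" "X \<in> carrier_mat d d"
  shows "bip_form d (mat_avg d I F) N X = (\<Sum>k\<in>I. bip_form d (F k) N X) / real (card I)"
proof -
  have "mat_avg d I F = complex_of_real (1 / real (card I)) \<cdot>\<^sub>m mat_sum d I F"
    by (simp add: mat_avg_def)
  thus ?thesis using assms by (simp only: bip_form_smult_left mat_sum_carrier bip_form_sum_left) simp
qed

lemma bip_form_sum_right:
  assumes "finite I" "\<And>k. k \<in> I \<Longrightarrow> F k \<in> carrier_mat d d" "M \<in> carrier_mat d d" "X \<in> carrier_mat d d"
  shows "bip_form d M (mat_sum d I F) X = (\<Sum>k\<in>I. bip_form d M (F k) X)"
  using assms bip_form_sum_left[of I F d M "X\<^sup>T"]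
  by (simp add: bip_form_transpose[of M d _ X])

lemma bip_form_avg_right:
  assumes "finite I" "\<And>k. k \<in> I \<Longrightarrow> F k \<in> carrier_mat d d" "M \<in> carrier_mat d d" "X \<in> carrier_mat d d"
  shows "bip_form d M (mat_avg d I F) X = (\<Sum>k\<in>I. bip_form d M (F k) X) / real (card I)"
  using assms bip_form_avg_left[of I F d M "X\<^sup>T"]
  by (simp add: bip_form_transpose[of M d _ X])

text \<open>Moves a conjugation from the measurement to the state, which turns a change of
  measurements into a change of the vector, where norm estimates apply.\<close>

lemma bip_form_sandwich_left:
  assumes "F \<in> carrier_mat d d" "M \<in> carrier_mat d d" "N \<in> carrier_mat d d" "X \<in> carrier_mat d d"
  shows "bip_form d (F * M * mat_adjoint F) N X = bip_form d M N (mat_adjoint F * X)"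
  using assms by (simp add: bip_form_def assoc_square[where d=d] hs_inner_mult_left)

lemma bip_form_sandwich_both:
  assumes "F \<in> carrier_mat d d" "mat_adjoint F = F" "G \<in> carrier_mat d d" "mat_adjoint G = G" "X \<in> carrier_mat d d"
  shows "bip_form d (F * F) (G * G) X = hs_inner d (F * X * G\<^sup>T) (F * X * G\<^sup>T)"
proof -
  have "bip_form d (F * F) (G * G) X = hs_inner d (F * (F * X * G\<^sup>T * G\<^sup>T)) X"
    using assms by (simp add: bip_form_def assoc_square[where d=d] transpose_mult[of _ d d _ d])
  also have "\<dots> = hs_inner d (F * X * G\<^sup>T * G\<^sup>T) (F * X)"
    using assms by (subst hs_inner_mult_left) auto
  also have "\<dots> = hs_inner d (F * X * G\<^sup>T) (F * X * G\<^sup>T)"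
    using assms by (subst hs_inner_mult_right) (auto simp: transpose_mat_adjoint)
  finally show ?thesis .
qed

lemma bip_form_nonneg:
  assumes "psd d M" "psd d N" "X \<in> carrier_mat d d"
  shows "0 \<le> bip_form d M N X"
proof -
  obtain F where F: "F \<in> carrier_mat d d" "mat_adjoint F = F" "M = F * F" by (rule psd_sqrt[OF assms(1)])
  obtain G where G: "G \<in> carrier_mat d d" "mat_adjoint G = G" "N = G * G" by (rule psd_sqrt[OF assms(2)])
  show ?thesis unfolding F(3) G(3) using F G assms by (subst bip_form_sandwich_both) auto
qed

text \<open>With square roots \<open>F\<close> of \<open>M\<close> and \<open>G\<close> of
  \<open>N\<close> the form is the squared norm of \<open>F * X * G\<^sup>T\<close>, hence a squared
  seminorm in the state, and the weighted estimate for norms carries over.\<close>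

lemma bip_form_diff_weighted:
  assumes "psd d M" "psd d N" "X \<in> carrier_mat d d" "Y \<in> carrier_mat d d" "t > 0"
  shows "bip_form d M N X \<le> (1 + t) * bip_form d M N Y + (1 + 1 / t) * bip_form d M N (X - Y)"
proof -
  obtain F where F: "F \<in> carrier_mat d d" "mat_adjoint F = F" "M = F * F" by (rule psd_sqrt[OF assms(1)])
  obtain G where G: "G \<in> carrier_mat d d" "mat_adjoint G = G" "N = G * G" by (rule psd_sqrt[OF assms(2)])
  have "F * (X - Y) * G\<^sup>T = F * X * G\<^sup>T - F * Y * G\<^sup>T"
    using F G assms by (simp add: mult_minus_distrib_mat[of _ d d _ d] minus_mult_distrib_mat[of _ d d _ _ d])
  thus ?thesis unfolding F(3) G(3)
    using F G assms hs_inner_diff_weighted[of "F * X * G\<^sup>T" d "F * Y * G\<^sup>T" t]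
    by (simp only: bip_form_sandwich_both minus_carrier_mat) (simp add: bip_form_sandwich_both)
qed

lemma bip_form_mono_left:
  assumes "M \<in> carrier_mat d d" "psd d (M' - M)" "M' \<in> carrier_mat d d" "psd d N" "X \<in> carrier_mat d d"
  shows "bip_form d M N X \<le> bip_form d M' N X"
  using bip_form_nonneg[OF assms(2,4,5)] assms psd_carrier[of d N] by (simp add: bip_form_diff_left)

lemma bip_form_mono_right:
  assumes "N \<in> carrier_mat d d" "psd d (N' - N)" "N' \<in> carrier_mat d d" "psd d M" "X \<in> carrier_mat d d"
  shows "bip_form d M N X \<le> bip_form d M N' X"
  using bip_form_mono_left[of N d N' M "X\<^sup>T"] assms psd_carrier[of d M]
  by (simp add: bip_form_transpose[of M d _ X])

lemma bip_form_one: "X \<in> carrier_mat d d \<Longrightarrow> bip_form d (1\<^sub>m d) (1\<^sub>m d) X = hs_inner d X X"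
  by (simp add: bip_form_def)

lemma bip_form_square:
  assumes "F \<in> carrier_mat d d" "mat_adjoint F = F" "X \<in> carrier_mat d d"
  shows "bip_form d (F * F) (1\<^sub>m d) X = hs_inner d (F * X) (F * X)"
  using assms bip_form_sandwich_both[of F d "1\<^sub>m d" X] by simp

section \<open>States as square matrices\<close>

definition unvec :: "nat \<Rightarrow> complex vec \<Rightarrow> complex mat" where
  "unvec d \<psi> = mat d d (\<lambda>(i, j). \<psi> $ (i * d + j))"

lemma unvec_carrier [simp]: "unvec d \<psi> \<in> carrier_mat d d"
  by (simp add: unvec_def)

lemma sum_square_split: "(\<Sum>q<d * d. f q) = (\<Sum>k<d. \<Sum>l<d. f (k * d + l :: nat))"
proof -
  have "sum f {m * d..<m * d + d} = (\<Sum>l<d. f (m * d + l))" for m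
    using sum.shift_bounds_nat_ivl[of f 0 "m * d" d] by (simp add: atLeast0LessThan add.commute)
  thus ?thesis by (simp flip: sum.nat_group)
qed

text \<open>The row-major numbering i * d + j is shared by \<open>kron\<close> and
  \<open>unvec\<close>; under it the second tensor factor acts by multiplication with its transpose
  from the right.\<close>

lemma expval_kron:
  assumes "M \<in> carrier_mat d d" "N \<in> carrier_mat d d" "\<psi> \<in> carrier_vec (d * d)"
  shows "expval \<psi> (kron M N) = bip_form d M N (unvec d \<psi>)"
proof -
  have dm: "k * d + l < d * d" if "k < d" "l < d" for k l
  proof -
    have "k * d + l < k * d + d" using that by simp
    also have "\<dots> = Suc k * d" by simp
    also have "\<dots> \<le> d * d" using that by (intro mult_right_mono) auto
    finally show ?thesis .
  qed
  have "(kron M N *\<^sub>v \<psi>) \<bullet>c \<psi> = (\<Sum>p<d * d. \<Sum>q<d * d. M $$ (p div d, q div d) * N $$ (p mod d, q mod d) * \<psi> $ q * cnj (\<psi> $ p))"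
    using assms by (auto simp: kron_def scalar_prod_def atLeast0LessThan conjugate_complex_def sum_distrib_right intro!: sum.cong)
  also have "\<dots> = (\<Sum>i<d. \<Sum>j<d. \<Sum>k<d. \<Sum>l<d.
      M $$ (i, k) * N $$ (j, l) * \<psi> $ (k * d + l) * cnj (\<psi> $ (i * d + j)))"
    unfolding sum_square_split by (intro sum.cong refl) auto
  finally show ?thesis using assms by (simp add: expval_def bip_form_expand unvec_def)
qed

lemma hs_inner_unvec:
  assumes "\<psi> \<in> carrier_vec (d * d)"
  shows "hs_inner d (unvec d \<psi>) (unvec d \<psi>) = Re (\<psi> \<bullet>c \<psi>)"
  using assms by (simp add: hs_inner_def unvec_def scalar_prod_def conjugate_complex_def atLeast0LessThan sum_square_split)

section \<open>Functional calculus and the shifted square root\<close>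

lemma spectral_add:
  assumes "U \<in> carrier_mat d d"
  shows "U * diag_real d b * mat_adjoint U + U * diag_real d c * mat_adjoint U
    = U * diag_real d (\<lambda>i. b i + c i) * mat_adjoint U"
proof -
  have "diag_real d (\<lambda>i. b i + c i) = diag_real d b + diag_real d c"
    by (intro eq_matI) (auto simp: diag_real_def)
  thus ?thesis using assms
    by (simp add: mult_add_distrib_mat[of _ d d _ d] add_mult_distrib_mat[of _ d d _ _ d])
qed

lemma spectral_const:
  assumes "U \<in> carrier_mat d d" "U * mat_adjoint U = 1\<^sub>m d"
  shows "U * diag_real d (\<lambda>_. c) * mat_adjoint U = complex_of_real c \<cdot>\<^sub>m 1\<^sub>m d"
proof -
  have "diag_real d (\<lambda>_. c) = complex_of_real c \<cdot>\<^sub>m 1\<^sub>m d"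
    by (intro eq_matI) (auto simp: diag_real_def)
  thus ?thesis using assms
    by (simp add: mult_smult_distrib[of _ d d _ d] mult_smult_assoc_mat[of _ d d _ d] right_mult_one_mat[of _ d d])
qed

lemma spectral_psd:
  assumes "U \<in> carrier_mat d d" "mat_adjoint U * U = 1\<^sub>m d" "\<And>i. i < d \<Longrightarrow> 0 \<le> b i"
  shows "psd d (U * diag_real d b * mat_adjoint U)"
proof -
  let ?F = "U * diag_real d (\<lambda>i. sqrt (b i)) * mat_adjoint U"
  have "diag_real d (\<lambda>i. sqrt (b i) * sqrt (b i)) = diag_real d b"
    using assms(3) by (intro eq_matI) (auto simp: diag_real_def simp flip: of_real_mult)
  hence "?F * mat_adjoint ?F = U * diag_real d b * mat_adjoint U"
    using spectral_mult[OF assms(1,2)] spectral_hermitian[OF assms(1)] by simp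
  thus ?thesis using psd_gram[of ?F d] assms(1) by simp
qed

text \<open>In an eigenbasis of \<open>A\<close> the matrix \<open>L\<close> has the entries sqrt (b
  i + s), and \<open>Z\<close> is its inverse. The shift makes \<open>L\<close> invertible even if
  \<open>A\<close> is singular; since the \<open>b i\<close> are nonnegative, the square of the
  inverse is at most 1/s.\<close>

lemma shifted_root:
  assumes "psd d A" "0 < s"
  obtains L Z where "L \<in> carrier_mat d d" "Z \<in> carrier_mat d d" "mat_adjoint L = L" "mat_adjoint Z = Z"
    "L * L = A + complex_of_real s \<cdot>\<^sub>m 1\<^sub>m d" "L * Z = 1\<^sub>m d" "Z * L = 1\<^sub>m d"
    "psd d (complex_of_real (1 / s) \<cdot>\<^sub>m 1\<^sub>m d - Z * Z)"
proof -
  obtain U b where U: "U \<in> carrier_mat d d" "mat_adjoint U * U = 1\<^sub>m d" "U * mat_adjoint U = 1\<^sub>m d"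
    "A = U * diag_real d b * mat_adjoint U" and b: "\<And>i. i < d \<Longrightarrow> 0 \<le> b i"
    using psd_spectral[OF assms(1)] by metis
  let ?f = "\<lambda>b. U * diag_real d b * mat_adjoint U"
  define L Z where "L = ?f (\<lambda>i. sqrt (b i + s))" and "Z = ?f (\<lambda>i. 1 / sqrt (b i + s))"
  have eqI: "?f c = ?f c'" if "\<And>i. i < d \<Longrightarrow> c i = c' i" for c c'
  proof -
    have "diag_real d c = diag_real d c'" using that by (intro eq_matI) (auto simp: diag_real_def)
    thus ?thesis by simp
  qed
  have bs: "b i + s > 0" if "i < d" for i using b[OF that] assms(2) by simp
  have one: "?f (\<lambda>_. 1) = 1\<^sub>m d" using spectral_const[OF U(1,3), of 1]
    by (simp add: \<open>U \<in> carrier_mat d d\<close>) (intro eq_matI; simp)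
  have c: "L \<in> carrier_mat d d" "Z \<in> carrier_mat d d" using U(1) by (auto simp: L_def Z_def)
  moreover have "mat_adjoint L = L" "mat_adjoint Z = Z" unfolding L_def Z_def
    by (rule spectral_hermitian[OF U(1)])+
  moreover have "L * L = A + complex_of_real s \<cdot>\<^sub>m 1\<^sub>m d"
  proof -
    have "L * L = ?f (\<lambda>i. b i + s)"
      unfolding L_def spectral_mult[OF U(1,2)] by (rule eqI) (use bs in \<open>auto simp: less_imp_le\<close>)
    also have "\<dots> = A + ?f (\<lambda>_. s)" unfolding U(4) spectral_add[OF U(1)] ..
    finally show ?thesis by (simp only: spectral_const[OF U(1,3)])
  qed
  moreover have "L * Z = 1\<^sub>m d"
    unfolding L_def Z_def spectral_mult[OF U(1,2)] one[symmetric] by (rule eqI) (use bs in force)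
  moreover have "Z * L = 1\<^sub>m d"
    unfolding L_def Z_def spectral_mult[OF U(1,2)] one[symmetric] by (rule eqI) (use bs in force)
  moreover have "psd d (complex_of_real (1 / s) \<cdot>\<^sub>m 1\<^sub>m d - Z * Z)"
  proof -
    have "Z * Z = ?f (\<lambda>i. 1 / (b i + s))"
      unfolding Z_def spectral_mult[OF U(1,2)] by (rule eqI) (use bs in \<open>auto simp: less_imp_le\<close>)
    moreover have "?f (\<lambda>i. 1 / s - 1 / (b i + s)) + ?f (\<lambda>i. 1 / (b i + s)) = complex_of_real (1 / s) \<cdot>\<^sub>m 1\<^sub>m d"
      unfolding spectral_add[OF U(1)] spectral_const[OF U(1,3), symmetric] by (rule eqI) simp
    moreover have diff: "Q - R = P" if "P + R = Q" "P \<in> carrier_mat d d" "R \<in> carrier_mat d d" for P Q R :: "complex mat"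
      unfolding that(1)[symmetric] using that(2,3) by (intro eq_matI) auto
    ultimately have "complex_of_real (1 / s) \<cdot>\<^sub>m 1\<^sub>m d - Z * Z = ?f (\<lambda>i. 1 / s - 1 / (b i + s))"
      using U(1) by (metis diff diag_real_carrier mult_square_carrier mat_adjoint_carrier)
    moreover have "psd d (?f (\<lambda>i. 1 / s - 1 / (b i + s)))"
      by (rule spectral_psd[OF U(1,2)]) (use b assms(2) in \<open>simp add: frac_le\<close>)
    ultimately show ?thesis by simp
  qed
  ultimately show thesis using that by blast
qed

section \<open>Replacing the measurements of one player\<close>

text \<open>\<open>X\<close> is the total at one question and \<open>A\<close> the mean of the
  totals. \<open>R\<close> is the Newton step from \<open>L\<close>, and \<open>J\<close> is its
  inverse, which turns the positivity of R R^* - X into the bound J X J^* \<le> 1. The deviation of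
  R^* from \<open>L\<close> is \<open>Z\<close> times half of \<open>X - L * L\<close>, and the
  bound on \<open>Z * Z\<close> produces 1 / (4 s).\<close>

lemma measurement_correction:
  assumes A: "psd d A" and X: "psd d X" and s: "0 < s"
    and L: "L \<in> carrier_mat d d" "mat_adjoint L = L"
    and Z: "Z \<in> carrier_mat d d" "mat_adjoint Z = Z"
    and LL: "L * L = A + complex_of_real s \<cdot>\<^sub>m 1\<^sub>m d" and LZ: "L * Z = 1\<^sub>m d" and ZL: "Z * L = 1\<^sub>m d"
    and ZZ: "psd d (complex_of_real (1 / s) \<cdot>\<^sub>m 1\<^sub>m d - Z * Z)"
  obtains J R where "J \<in> carrier_mat d d" "R \<in> carrier_mat d d" "R * J = 1\<^sub>m d"
    "psd d (1\<^sub>m d - J * X * mat_adjoint J)"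
    "\<And>\<Theta>. \<Theta> \<in> carrier_mat d d \<Longrightarrow>
      hs_inner d ((mat_adjoint R - L) * \<Theta>) ((mat_adjoint R - L) * \<Theta>)
      \<le> 1 / (4 * s) * hs_inner d ((X - L * L) * \<Theta>) ((X - L * L) * \<Theta>)"
proof -
  note as = assoc_square[where d=d]
  define Q where "Q = L * L"
  have Ac: "A \<in> carrier_mat d d" and Xc: "X \<in> carrier_mat d d" using A X by (auto dest: psd_carrier)
  have Qc: "Q \<in> carrier_mat d d" using L by (simp add: Q_def)
  have Qh: "mat_adjoint Q = Q" using L by (simp add: Q_def mat_adjoint_mult[of _ d d _ d])
  have Xh: "mat_adjoint X = X" using X by (rule psd_hermitian)
  define S where "S = Q + X"
  have Sc: "S \<in> carrier_mat d d" using Qc Xc by (simp add: S_def)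
  have Sh: "mat_adjoint S = S" using Qc Xc Qh Xh by (simp add: S_def mat_adjoint_add[of _ d d])
  \<comment> \<open>\<open>S\<close> is the positive matrix \<open>A + X\<close> shifted by
    \<open>s\<close>, so it is the square of an invertible matrix. This is the source of an explicit
    inverse \<open>W\<close> of \<open>S\<close>.\<close>
  obtain L' Z' where L': "L' \<in> carrier_mat d d" "L' * L' = (A + X) + complex_of_real s \<cdot>\<^sub>m 1\<^sub>m d"
    and Z': "Z' \<in> carrier_mat d d" and LZ': "L' * Z' = 1\<^sub>m d" "Z' * L' = 1\<^sub>m d"
    using shifted_root[OF psd_add[OF A X] s] by metis
  have SL': "S = L' * L'" unfolding L'(2) S_def Q_def LL
    using Ac Xc by (intro eq_matI) auto
  define W where "W = Z' * Z'"
  have Wc: "W \<in> carrier_mat d d" using Z' by (simp add: W_def)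
  have "S * W = L' * (L' * Z') * Z'" using L'(1) Z' by (simp add: SL' W_def as)
  hence SW: "S * W = 1\<^sub>m d" using L' LZ' by simp
  have "W * S = Z' * (Z' * L') * L'" using L'(1) Z' by (simp add: SL' W_def as)
  hence WS: "W * S = 1\<^sub>m d" using Z' LZ' by simp
  define R J where "R = complex_of_real (1 / 2) \<cdot>\<^sub>m (S * Z)" and "J = complex_of_real 2 \<cdot>\<^sub>m (L * W)"
  have Rc: "R \<in> carrier_mat d d" and Jc: "J \<in> carrier_mat d d"
    using Sc Z L Wc by (auto simp: R_def J_def)
  have Ja: "mat_adjoint J \<in> carrier_mat d d" and Ra: "mat_adjoint R \<in> carrier_mat d d" using Jc Rc by simp_all
  have sm: "(complex_of_real a \<cdot>\<^sub>m M) * (complex_of_real b \<cdot>\<^sub>m N) = complex_of_real (a * b) \<cdot>\<^sub>m (M * N)"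
    if "M \<in> carrier_mat d d" "N \<in> carrier_mat d d" for a b M N
  proof -
    have "(complex_of_real a \<cdot>\<^sub>m M) * (complex_of_real b \<cdot>\<^sub>m N) = complex_of_real b \<cdot>\<^sub>m (complex_of_real a \<cdot>\<^sub>m (M * N))"
      using that by (simp add: mult_smult_distrib[of _ d d _ d] mult_smult_assoc_mat[of _ d d _ d])
    also have "\<dots> = complex_of_real (a * b) \<cdot>\<^sub>m (M * N)" by (intro eq_matI) auto
    finally show ?thesis .
  qed
  have one: "complex_of_real 1 \<cdot>\<^sub>m M = M" for M by (intro eq_matI) auto
  have "R * J = S * Z * (L * W)"
    unfolding R_def J_def using sm[of "S * Z" "L * W" "1/2" 2] Sc Z L Wc one by simp
  also have "\<dots> = S * (Z * L) * W" using Sc Z L Wc by (simp add: as)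
  finally have RJ: "R * J = 1\<^sub>m d" using ZL Sc SW by simp
  have "J * R = L * W * (S * Z)"
    unfolding R_def J_def using sm[of "L * W" "S * Z" 2 "1/2"] Sc Z L Wc one by simp
  also have "\<dots> = L * (W * S) * Z" using Sc Z L Wc by (simp add: as)
  finally have JR: "J * R = 1\<^sub>m d" using LZ L WS by simp
  have Rh: "mat_adjoint R = complex_of_real (1 / 2) \<cdot>\<^sub>m (Z * S)"
    unfolding R_def mat_adjoint_smult_real using Sc Sh Z by (simp add: mat_adjoint_mult[of _ d d _ d])
  define T where "T = X * Z"
  have Tc: "T \<in> carrier_mat d d" using Xc Z by (simp add: T_def)
  have Th: "mat_adjoint T = Z * X" using Xc Xh Z by (simp add: T_def mat_adjoint_mult[of _ d d _ d])
  have Tac: "mat_adjoint T \<in> carrier_mat d d" using Tc by simp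
  have "Q * Z = L * (L * Z)" unfolding Q_def using L Z by (simp add: as)
  hence QZ: "Q * Z = L" using L LZ by simp
  have "Z * Q = (Z * L) * L" unfolding Q_def using L Z by (simp add: as)
  hence ZQ: "Z * Q = L" using L ZL by simp
  have "L * mat_adjoint T = (L * Z) * X" unfolding Th using L Z Xc by (simp add: as)
  hence LT: "L * mat_adjoint T = X" using LZ Xc by simp
  have "T * L = X * (Z * L)" unfolding T_def using L Z Xc by (simp add: as)
  hence TL: "T * L = X" using ZL Xc by simp
  have SZ: "S * Z = L + T" unfolding S_def T_def QZ[symmetric] using Qc Xc Z
    by (simp add: add_mult_distrib_mat[of _ d d _ _ d])
  have ZS: "Z * S = L + mat_adjoint T" unfolding S_def Th ZQ[symmetric] using Qc Xc Z
    by (simp add: mult_add_distrib_mat[of _ d d _ d])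
  define TT where "TT = T * mat_adjoint T"
  have TTc: "TT \<in> carrier_mat d d" using Tc by (simp add: TT_def)
  have "(L + T) * (L + mat_adjoint T) = (L * L + T * L) + (L * mat_adjoint T + T * mat_adjoint T)"
    using L Tc Tac by (simp add: add_mult_distrib_mat[of _ d d _ _ d] mult_add_distrib_mat[of _ d d _ d])
  hence pp: "(L + T) * (L + mat_adjoint T) = (Q + X) + (X + TT)"
    unfolding LT TL TT_def Q_def .
  have "(T - L) * (mat_adjoint T - L) = (T * mat_adjoint T - L * mat_adjoint T) - (T * L - L * L)"
    using L Tc Tac by (simp add: minus_mult_distrib_mat[of _ d d _ _ d] mult_minus_distrib_mat[of _ d d _ d] minus_carrier_mat)
  hence nn: "(T - L) * (mat_adjoint T - L) = (TT - X) - (X - Q)"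
    unfolding LT TL TT_def Q_def .
  \<comment> \<open>No commutation is used: \<open>L * mat_adjoint T\<close> and
    \<open>T * L\<close> are both \<open>X\<close>. Hence the product with plus signs exceeds the
    product with minus signs by exactly 4 X, and a quarter of this is the subtracted
    \<open>X\<close>.\<close>
  have RR: "R * mat_adjoint R - X = complex_of_real (1 / 4) \<cdot>\<^sub>m ((T - L) * mat_adjoint (T - L))"
  proof -
    have "R * mat_adjoint R = complex_of_real (1 / 4) \<cdot>\<^sub>m ((L + T) * (L + mat_adjoint T))"
      unfolding Rh unfolding R_def SZ ZS using sm[of "L + T" "L + mat_adjoint T" "1/2" "1/2"] L Tc Tac by simp
    moreover have "mat_adjoint (T - L) = mat_adjoint T - L"
      using L Tc by (simp add: mat_adjoint_minus[of _ d d])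
    ultimately show ?thesis unfolding pp
      using Qc Xc TTc by (simp only: nn) (intro eq_matI; simp add: field_simps)
  qed
  have "psd d (R * mat_adjoint R - X)"
    unfolding RR by (rule psd_smult[OF psd_gram]) (use Tc L in auto)
  hence "psd d (J * (R * mat_adjoint R - X) * mat_adjoint J)" by (rule psd_conj[OF _ Jc])
  also have "J * (R * mat_adjoint R - X) * mat_adjoint J = J * (R * mat_adjoint R) * mat_adjoint J - J * X * mat_adjoint J"
    using Jc Rc Ja Ra Xc by (simp add: minus_mult_distrib_mat[of _ d d _ _ d] mult_minus_distrib_mat[of _ d d _ d])
  also have "J * (R * mat_adjoint R) * mat_adjoint J = (J * R) * mat_adjoint (J * R)"
    using Jc Rc Ja Ra by (simp add: mat_adjoint_mult[of _ d d _ d] as)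
  also have "\<dots> = 1\<^sub>m d" unfolding JR by simp
  finally have JX: "psd d (1\<^sub>m d - J * X * mat_adjoint J)" .
  define Y where "Y = X - L * L"
  have Yc: "Y \<in> carrier_mat d d" using Xc L by (simp add: Y_def minus_carrier_mat)
  have "hs_inner d ((mat_adjoint R - L) * \<Theta>) ((mat_adjoint R - L) * \<Theta>) \<le> 1 / (4 * s) * hs_inner d (Y * \<Theta>) (Y * \<Theta>)"
    if \<Theta>: "\<Theta> \<in> carrier_mat d d" for \<Theta>
  proof -
    have ZY: "Z * Y = mat_adjoint T - L"
    proof -
      have "Z * Y = Z * X - Z * Q"
        unfolding Y_def Q_def[symmetric] using Z Xc Qc by (simp add: mult_minus_distrib_mat[of _ d d _ d])
      thus ?thesis by (simp only: ZQ Th)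
    qed
    have "mat_adjoint R - L = complex_of_real (1 / 2) \<cdot>\<^sub>m (Z * Y)"
      unfolding Rh ZS ZY using L Tc by (intro eq_matI; simp add: field_simps)
    hence "(mat_adjoint R - L) * \<Theta> = complex_of_real (1 / 2) \<cdot>\<^sub>m (Z * (Y * \<Theta>))"
      using Z Yc \<Theta> by (simp add: mult_smult_assoc_mat[of _ d d _ d] as)
    hence "hs_inner d ((mat_adjoint R - L) * \<Theta>) ((mat_adjoint R - L) * \<Theta>)
        = (1 / 2)\<^sup>2 * hs_inner d (Z * (Y * \<Theta>)) (Z * (Y * \<Theta>))"
      using Z Yc \<Theta> by (simp only: hs_inner_smult_self[where d=d] mult_square_carrier)
    also have "hs_inner d (Z * (Y * \<Theta>)) (Z * (Y * \<Theta>)) = bip_form d (Z * Z) (1\<^sub>m d) (Y * \<Theta>)"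
      using Z Yc \<Theta> by (simp add: bip_form_square)
    also have "\<dots> \<le> bip_form d (complex_of_real (1 / s) \<cdot>\<^sub>m 1\<^sub>m d) (1\<^sub>m d) (Y * \<Theta>)"
      using Z Yc \<Theta> by (intro bip_form_mono_left[OF _ ZZ] psd_one) auto
    also have "\<dots> = 1 / s * hs_inner d (Y * \<Theta>) (Y * \<Theta>)"
      using Yc \<Theta> by (simp only: bip_form_smult_left bip_form_one one_carrier_mat mult_square_carrier)
    finally show ?thesis by (simp add: field_simps power2_eq_square)
  qed
  thus thesis using that[OF Jc Rc RJ JX] by (simp add: Y_def)
qed

text \<open>The value as a functional of an arbitrary matrix, since conjugation destroys the
  normalization of the state. Explicit weights on pairs allow the roles of the players to be
  exchanged.\<close>

definition game_form ::
  "nat \<Rightarrow> 'x set \<Rightarrow> 'y set \<Rightarrow> ('x \<Rightarrow> 'y \<Rightarrow> real) \<Rightarrow> 'a set \<Rightarrow> 'b set \<Rightarrow> ('a \<Rightarrow> 'b \<Rightarrow> 'x \<Rightarrow> 'y \<Rightarrow> bool) \<Rightarrow>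
   ('x \<Rightarrow> 'a \<Rightarrow> complex mat) \<Rightarrow> ('y \<Rightarrow> 'b \<Rightarrow> complex mat) \<Rightarrow> complex mat \<Rightarrow> real" where
  "game_form d X Y w SA SB V A B \<Psi> = (\<Sum>x\<in>X. \<Sum>y\<in>Y. w x y *
     (\<Sum>a\<in>SA. \<Sum>b\<in>SB. of_bool (V a b x y) * bip_form d (A x a) (B y b) \<Psi>))"

lemma game_form_transpose:
  assumes "\<And>x a. x \<in> X \<Longrightarrow> a \<in> SA \<Longrightarrow> A x a \<in> carrier_mat d d"
    "\<And>y b. y \<in> Y \<Longrightarrow> b \<in> SB \<Longrightarrow> B y b \<in> carrier_mat d d" "\<Psi> \<in> carrier_mat d d"
  shows "game_form d X Y w SA SB V A B \<Psi>
    = game_form d Y X (\<lambda>y x. w x y) SB SA (\<lambda>b a y x. V a b x y) B A \<Psi>\<^sup>T"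
proof -
  have "game_form d X Y w SA SB V A B \<Psi> = (\<Sum>y\<in>Y. \<Sum>x\<in>X. w x y *
     (\<Sum>b\<in>SB. \<Sum>a\<in>SA. of_bool (V a b x y) * bip_form d (A x a) (B y b) \<Psi>))"
    unfolding game_form_def by (subst sum.swap, intro sum.cong refl arg_cong2[of _ _ _ _ "(*)"] sum.swap)
  also have "\<dots> = game_form d Y X (\<lambda>y x. w x y) SB SA (\<lambda>b a y x. V a b x y) B A \<Psi>\<^sup>T"
    unfolding game_form_def using assms
    by (intro sum.cong refl arg_cong2[of _ _ _ _ "(*)"] bip_form_transpose) auto
  finally show ?thesis .
qed

text \<open>Conjugating the measurement at question x by \<open>J x\<close> puts the adjoint of
  \<open>R x\<close> on the state. Exchanging it for \<open>L\<close>, which is common to all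
  questions, leaves one state again, as the value of a game requires. \<open>L\<close> and
  \<open>A'\<close> are chosen before the state and \<open>t\<close>, so the estimate can be reused
  on a state that another replacement has changed.\<close>

lemma substrategy_replacement:
  fixes w :: "'x \<Rightarrow> 'y \<Rightarrow> real"
  assumes fin: "finite X" "finite Y" "finite SA" "finite SB" and X0: "X \<noteq> {}"
    and w0: "\<And>x y. 0 \<le> w x y" and marg: "\<And>x. x \<in> X \<Longrightarrow> (\<Sum>y\<in>Y. w x y) = 1 / real (card X)"
    and A: "\<And>x a. x \<in> X \<Longrightarrow> a \<in> SA \<Longrightarrow> psd d (A x a)"
    and B: "\<And>y b. y \<in> Y \<Longrightarrow> b \<in> SB \<Longrightarrow> psd d (B y b)"
    and B1: "\<And>y. y \<in> Y \<Longrightarrow> psd d (1\<^sub>m d - mat_sum d SB (B y))"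
    and mean: "Am = mat_avg d X (\<lambda>x. mat_sum d SA (A x))" and Am: "psd d Am"
    and s: "0 < s"
    and spread: "\<And>\<Theta>. \<Theta> \<in> carrier_mat d d \<Longrightarrow>
      (\<Sum>x\<in>X. hs_inner d ((mat_sum d SA (A x) - Am) * \<Theta>) ((mat_sum d SA (A x) - Am) * \<Theta>)) / real (card X)
      \<le> s\<^sup>2 * hs_inner d \<Theta> \<Theta>"
  obtains L A' where "L \<in> carrier_mat d d" "mat_adjoint L = L" "L * L = Am + complex_of_real s \<cdot>\<^sub>m 1\<^sub>m d"
    "\<And>x a. x \<in> X \<Longrightarrow> a \<in> SA \<Longrightarrow> psd d (A' x a)"
    "\<And>x. x \<in> X \<Longrightarrow> psd d (1\<^sub>m d - mat_sum d SA (A' x))"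
    "\<And>\<Psi> t. \<Psi> \<in> carrier_mat d d \<Longrightarrow> 0 < t \<Longrightarrow> game_form d X Y w SA SB V A B \<Psi>
      \<le> (1 + t) * game_form d X Y w SA SB V A' B (L * \<Psi>) + (1 + 1 / t) * (s / 2) * hs_inner d \<Psi> \<Psi>"
proof -
  define T where "T x = mat_sum d SA (A x)" for x
  have T: "psd d (T x)" if "x \<in> X" for x unfolding T_def using that fin A by (intro psd_mat_sum)
  have Tc: "T x \<in> carrier_mat d d" for x by (simp add: T_def)
  have Amc: "Am \<in> carrier_mat d d" by (rule psd_carrier[OF Am])
  obtain L Z where L: "L \<in> carrier_mat d d" "mat_adjoint L = L"
    and Z: "Z \<in> carrier_mat d d" "mat_adjoint Z = Z"
    and LL: "L * L = Am + complex_of_real s \<cdot>\<^sub>m 1\<^sub>m d" and LZ: "L * Z = 1\<^sub>m d" "Z * L = 1\<^sub>m d"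
    and ZZ: "psd d (complex_of_real (1 / s) \<cdot>\<^sub>m 1\<^sub>m d - Z * Z)"
    using shifted_root[OF Am s] by metis
  define good where "good x J R \<longleftrightarrow> J \<in> carrier_mat d d \<and> R \<in> carrier_mat d d \<and> R * J = 1\<^sub>m d \<and>
    psd d (1\<^sub>m d - J * T x * mat_adjoint J) \<and>
    (\<forall>\<Theta>\<in>carrier_mat d d. hs_inner d ((mat_adjoint R - L) * \<Theta>) ((mat_adjoint R - L) * \<Theta>)
      \<le> 1 / (4 * s) * hs_inner d ((T x - L * L) * \<Theta>) ((T x - L * L) * \<Theta>))" for x J R
  have "\<exists>J R. good x J R" if "x \<in> X" for x
    using measurement_correction[OF Am T[OF that] s L Z LL LZ ZZ] unfolding good_def by metis
  then obtain J R where good: "\<And>x. x \<in> X \<Longrightarrow> good x (J x) (R x)" by metis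
  define A' where "A' x a = J x * A x a * mat_adjoint (J x)" for x a
  have JR: "J x \<in> carrier_mat d d" "R x \<in> carrier_mat d d" "R x * J x = 1\<^sub>m d" if "x \<in> X" for x
    using good[OF that] by (auto simp: good_def)
  have A': "psd d (A' x a)" if "x \<in> X" "a \<in> SA" for x a
    unfolding A'_def by (intro psd_conj A JR that)
  have A'1: "psd d (1\<^sub>m d - mat_sum d SA (A' x))" if "x \<in> X" for x
  proof -
    have "mat_sum d SA (A' x) = J x * T x * mat_adjoint (J x)"
      unfolding A'_def T_def using fin that A JR psd_carrier by (intro mat_sum_mult[symmetric]) auto
    thus ?thesis using good[OF that] by (simp add: good_def)
  qed
  have recover: "R x * A' x a * mat_adjoint (R x) = A x a" if "x \<in> X" "a \<in> SA" for x a
  proof -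
    have Ac: "A x a \<in> carrier_mat d d" using A[OF that] by (rule psd_carrier)
    have "R x * A' x a * mat_adjoint (R x) = (R x * J x) * A x a * mat_adjoint (R x * J x)"
      using JR(1,2)[OF that(1)] Ac unfolding A'_def
      by (subst mat_adjoint_mult[of _ d d _ d]) (simp_all add: assoc_square[where d=d])
    thus ?thesis using JR[OF that(1)] Ac by simp
  qed
  have pt: "(\<Sum>a\<in>SA. \<Sum>b\<in>SB. of_bool (V a b x y) * bip_form d (A x a) (B y b) \<Psi>)
     \<le> (1 + t) * (\<Sum>a\<in>SA. \<Sum>b\<in>SB. of_bool (V a b x y) * bip_form d (A' x a) (B y b) (L * \<Psi>))
       + (1 + 1 / t) * (1 / (4 * s) * hs_inner d ((T x - L * L) * \<Psi>) ((T x - L * L) * \<Psi>))"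
    if xy: "x \<in> X" "y \<in> Y" and \<Psi>: "\<Psi> \<in> carrier_mat d d" and t: "0 < t" for x y \<Psi> t
  proof -
    define \<Theta> where "\<Theta> = (mat_adjoint (R x) - L) * \<Psi>"
    have Ra: "mat_adjoint (R x) \<in> carrier_mat d d" using JR[OF xy(1)] by simp
    have \<Theta>: "\<Theta> \<in> carrier_mat d d" using Ra L \<Psi> by (simp add: \<Theta>_def minus_carrier_mat)
    have \<Theta>': "\<Theta> = mat_adjoint (R x) * \<Psi> - L * \<Psi>"
      unfolding \<Theta>_def by (rule minus_mult_distrib_mat[OF Ra L(1) \<Psi>])
    \<comment> \<open>The predicate is kept on the main term only. The error term is nonnegative, so
      it may be extended to all pairs of answers; these then add up to the totals, which are at most
      1.\<close>
    have "(\<Sum>a\<in>SA. \<Sum>b\<in>SB. of_bool (V a b x y) * bip_form d (A x a) (B y b) \<Psi>)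
      \<le> (\<Sum>a\<in>SA. \<Sum>b\<in>SB. (1 + t) * (of_bool (V a b x y) * bip_form d (A' x a) (B y b) (L * \<Psi>))
          + (1 + 1 / t) * bip_form d (A' x a) (B y b) \<Theta>)"
    proof (intro sum_mono)
      fix a b assume ab: "a \<in> SA" "b \<in> SB"
      have A'xa: "psd d (A' x a)" and Byb: "psd d (B y b)" using A' B ab xy by auto
      have "bip_form d (A x a) (B y b) \<Psi> = bip_form d (A' x a) (B y b) (mat_adjoint (R x) * \<Psi>)"
        using JR[OF xy(1)] A'xa Byb \<Psi>
        by (subst recover[OF xy(1) ab(1), symmetric], subst bip_form_sandwich_left) (auto simp: psd_carrier)
      also have "\<dots> \<le> (1 + t) * bip_form d (A' x a) (B y b) (L * \<Psi>) + (1 + 1 / t) * bip_form d (A' x a) (B y b) \<Theta>"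
        unfolding \<Theta>' using Ra L \<Psi> by (intro bip_form_diff_weighted A'xa Byb t) auto
      finally show "of_bool (V a b x y) * bip_form d (A x a) (B y b) \<Psi>
          \<le> (1 + t) * (of_bool (V a b x y) * bip_form d (A' x a) (B y b) (L * \<Psi>))
          + (1 + 1 / t) * bip_form d (A' x a) (B y b) \<Theta>"
        using bip_form_nonneg[OF A'xa Byb \<Theta>] t by (cases "V a b x y") auto
    qed
    also have "\<dots> = (1 + t) * (\<Sum>a\<in>SA. \<Sum>b\<in>SB. of_bool (V a b x y) * bip_form d (A' x a) (B y b) (L * \<Psi>))
       + (1 + 1 / t) * (\<Sum>a\<in>SA. \<Sum>b\<in>SB. bip_form d (A' x a) (B y b) \<Theta>)"
      by (simp add: sum.distrib sum_distrib_left)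
    also have "(\<Sum>a\<in>SA. \<Sum>b\<in>SB. bip_form d (A' x a) (B y b) \<Theta>)
        = bip_form d (mat_sum d SA (A' x)) (mat_sum d SB (B y)) \<Theta>"
      using fin A' B xy \<Theta> psd_carrier by (subst bip_form_sum_left) (auto simp: bip_form_sum_right)
    also have "\<dots> \<le> bip_form d (1\<^sub>m d) (mat_sum d SB (B y)) \<Theta>"
      using A'1[OF xy(1)] fin B xy \<Theta> by (intro bip_form_mono_left psd_mat_sum) auto
    also have "\<dots> \<le> bip_form d (1\<^sub>m d) (1\<^sub>m d) \<Theta>"
      using B1[OF xy(2)] \<Theta> by (intro bip_form_mono_right psd_one) auto
    also have "\<dots> \<le> 1 / (4 * s) * hs_inner d ((T x - L * L) * \<Psi>) ((T x - L * L) * \<Psi>)"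
      unfolding bip_form_one[OF \<Theta>] unfolding \<Theta>_def using good[OF xy(1)] \<Psi> by (auto simp: good_def)
    finally show ?thesis using t by (simp add: mult_left_mono)
  qed
  \<comment> \<open>The deviation is measured from \<open>L * L\<close>, which is the mean plus
    \<open>s\<close>. The cross term averages to zero, so the spread s^2 and the squared shift s^2
    add up to 2 s^2; times 1 / (4 s) this is the s/2 of the conclusion.\<close>
  have avg: "(\<Sum>x\<in>X. hs_inner d ((T x - L * L) * \<Psi>) ((T x - L * L) * \<Psi>)) / real (card X) \<le> 2 * s\<^sup>2 * hs_inner d \<Psi> \<Psi>"
    if \<Psi>: "\<Psi> \<in> carrier_mat d d" for \<Psi>
  proof -
    have n: "real (card X) > 0" using fin X0 by (simp add: card_gt_0_iff)
    have eq: "hs_inner d ((T x - L * L) * \<Psi>) ((T x - L * L) * \<Psi>)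
       = hs_inner d ((T x - Am) * \<Psi>) ((T x - Am) * \<Psi>) - 2 * s * (bip_form d (T x) (1\<^sub>m d) \<Psi> - bip_form d Am (1\<^sub>m d) \<Psi>)
         + s\<^sup>2 * hs_inner d \<Psi> \<Psi>" for x
    proof -
      have DA: "T x - Am \<in> carrier_mat d d" using Amc by (simp add: minus_carrier_mat)
      have "T x - L * L = (T x - Am) - complex_of_real s \<cdot>\<^sub>m 1\<^sub>m d"
        unfolding LL using Tc[of x] Amc by (intro eq_matI) auto
      hence "(T x - L * L) * \<Psi> = (T x - Am) * \<Psi> - complex_of_real s \<cdot>\<^sub>m \<Psi>"
        using DA \<Psi> by (simp add: minus_mult_distrib_mat[of _ d d _ _ d] mult_smult_assoc_mat[of _ d d _ d] left_mult_one_mat[of _ d d])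
      hence "hs_inner d ((T x - L * L) * \<Psi>) ((T x - L * L) * \<Psi>) = hs_inner d ((T x - Am) * \<Psi>) ((T x - Am) * \<Psi>)
          - 2 * s * hs_inner d ((T x - Am) * \<Psi>) \<Psi> + s\<^sup>2 * hs_inner d \<Psi> \<Psi>"
        using DA \<Psi> by (simp add: hs_inner_diff_smult)
      also have "hs_inner d ((T x - Am) * \<Psi>) \<Psi> = bip_form d (T x - Am) (1\<^sub>m d) \<Psi>"
        using DA \<Psi> by (simp add: bip_form_def right_mult_one_mat[of _ d d])
      also have "\<dots> = bip_form d (T x) (1\<^sub>m d) \<Psi> - bip_form d Am (1\<^sub>m d) \<Psi>"
        using Tc[of x] Amc \<Psi> by (simp add: bip_form_diff_left)
      finally show ?thesis .
    qed
    have "(\<Sum>x\<in>X. bip_form d (T x) (1\<^sub>m d) \<Psi>) = real (card X) * bip_form d Am (1\<^sub>m d) \<Psi>"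
      unfolding mean using fin \<Psi> n by (subst bip_form_avg_left) (auto simp: T_def)
    hence "(\<Sum>x\<in>X. hs_inner d ((T x - L * L) * \<Psi>) ((T x - L * L) * \<Psi>))
       = (\<Sum>x\<in>X. hs_inner d ((T x - Am) * \<Psi>) ((T x - Am) * \<Psi>)) + real (card X) * (s\<^sup>2 * hs_inner d \<Psi> \<Psi>)"
      unfolding eq by (simp add: sum.distrib sum_subtractf algebra_simps flip: sum_distrib_left)
    hence "(\<Sum>x\<in>X. hs_inner d ((T x - L * L) * \<Psi>) ((T x - L * L) * \<Psi>)) / real (card X)
      = (\<Sum>x\<in>X. hs_inner d ((T x - Am) * \<Psi>) ((T x - Am) * \<Psi>)) / real (card X) + s\<^sup>2 * hs_inner d \<Psi> \<Psi>"
      using n by (simp add: field_simps)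
    thus ?thesis using spread[OF \<Psi>, folded T_def] by linarith
  qed
  have main: "game_form d X Y w SA SB V A B \<Psi>
      \<le> (1 + t) * game_form d X Y w SA SB V A' B (L * \<Psi>) + (1 + 1 / t) * (s / 2) * hs_inner d \<Psi> \<Psi>"
    if \<Psi>: "\<Psi> \<in> carrier_mat d d" and t: "0 < t" for \<Psi> t
  proof -
    let ?g = "\<lambda>x y. \<Sum>a\<in>SA. \<Sum>b\<in>SB. of_bool (V a b x y) * bip_form d (A' x a) (B y b) (L * \<Psi>)"
    let ?h = "\<lambda>x. hs_inner d ((T x - L * L) * \<Psi>) ((T x - L * L) * \<Psi>)"
    have "game_form d X Y w SA SB V A B \<Psi>
        \<le> (\<Sum>x\<in>X. \<Sum>y\<in>Y. w x y * ((1 + t) * ?g x y + (1 + 1 / t) * (1 / (4 * s) * ?h x)))"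
      unfolding game_form_def by (intro sum_mono mult_left_mono pt \<Psi> t w0)
    also have "\<dots> = (1 + t) * game_form d X Y w SA SB V A' B (L * \<Psi>)
        + (1 + 1 / t) * (1 / (4 * s)) * (\<Sum>x\<in>X. (\<Sum>y\<in>Y. w x y) * ?h x)"
      unfolding game_form_def
      by (simp only: distrib_left sum.distrib sum_distrib_left sum_distrib_right mult_ac)
    also have "(\<Sum>x\<in>X. (\<Sum>y\<in>Y. w x y) * ?h x) = (\<Sum>x\<in>X. ?h x) / real (card X)"
      by (simp add: marg sum_divide_distrib)
    also have "(1 + 1 / t) * (1 / (4 * s)) * \<dots> \<le> (1 + 1 / t) * (1 / (4 * s)) * (2 * s\<^sup>2 * hs_inner d \<Psi> \<Psi>)"
      by (intro mult_left_mono avg \<Psi>) (use s t in auto)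
    also have "\<dots> = (1 + 1 / t) * (s / 2) * hs_inner d \<Psi> \<Psi>"
      using s by (simp add: power2_eq_square)
    finally show ?thesis by simp
  qed
  show thesis by (rule that[OF L LL A' A'1 main])
qed

section \<open>Spectral expanders\<close>

lemma char_poly_spectral:
  assumes U: "U \<in> carrier_mat n n" "mat_adjoint U * U = 1\<^sub>m n" "U * mat_adjoint U = 1\<^sub>m n"
  shows "char_poly (U * diag_real n b * mat_adjoint U) = (\<Prod>i\<leftarrow>[0..<n]. [:- complex_of_real (b i), 1:])"
proof -
  have "similar_mat_wit (U * diag_real n b * mat_adjoint U) (diag_real n b) U (mat_adjoint U)"
    by (rule similar_mat_witI[of _ _ n]) (use U in auto)
  hence "char_poly (U * diag_real n b * mat_adjoint U) = char_poly (diag_real n b)"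
    by (intro char_poly_similar) (auto simp: similar_mat_def)
  also have "\<dots> = (\<Prod>a\<leftarrow>diag_mat (diag_real n b). [:- a, 1:])"
    by (rule char_poly_upper_triangular[of _ n]) (auto simp: diag_real_def upper_triangular_def)
  also have "diag_mat (diag_real n b) = map (\<lambda>i. complex_of_real (b i)) [0..<n]"
    by (auto simp: diag_mat_def diag_real_def)
  finally show ?thesis by (simp add: o_def)
qed

text \<open>Singular values are defined by roots of a real polynomial, while the diagonalization is
  complex. The two are linked by embedding the coefficients into the complex numbers, which is
  injective.\<close>

lemma proots_char_poly_symmetric:
  fixes N :: "real mat"
  assumes N: "N \<in> carrier_mat n n"
    and U: "U \<in> carrier_mat n n" "mat_adjoint U * U = 1\<^sub>m n" "U * mat_adjoint U = 1\<^sub>m n"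
    and NU: "map_mat complex_of_real N = U * diag_real n b * mat_adjoint U"
  shows "proots (char_poly N) = mset (map b [0..<n])"
proof -
  have map_prod: "map_poly complex_of_real (\<Prod>i\<leftarrow>xs. [:- b i, 1:]) = (\<Prod>i\<leftarrow>xs. [:- complex_of_real (b i), 1:])" for xs
  proof (induction xs)
    case (Cons x xs)
    interpret h: map_poly_comm_ring_hom complex_of_real ..
    have "map_poly complex_of_real (\<Prod>i\<leftarrow>x # xs. [:- b i, 1:])
        = map_poly complex_of_real [:- b x, 1:] * map_poly complex_of_real (\<Prod>i\<leftarrow>xs. [:- b i, 1:])"
      by (simp only: list.map prod_list.Cons h.hom_mult)
    thus ?case unfolding Cons.IH by simp
  qed simp
  have "map_poly complex_of_real (char_poly N) = map_poly complex_of_real (\<Prod>i\<leftarrow>[0..<n]. [:- b i, 1:])"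
    unfolding map_prod of_real_hom.char_poly_hom[OF N, symmetric] NU by (rule char_poly_spectral[OF U])
  hence "char_poly N = (\<Prod>i\<leftarrow>[0..<n]. [:- b i, 1:])"
    by (simp add: poly_eq_iff coeff_map_poly)
  moreover have "proots (\<Prod>i\<leftarrow>xs. [:- b i, 1:]) = mset (map b xs)" for xs
  proof (induction xs)
    case (Cons x xs)
    have "(\<Prod>i\<leftarrow>xs. [:- b i, 1:]) \<noteq> 0" by (auto simp: prod_list_zero_iff)
    hence "proots (\<Prod>i\<leftarrow>x # xs. [:- b i, 1:]) = proots [:- b x, 1:] + proots (\<Prod>i\<leftarrow>xs. [:- b i, 1:])"
      by (simp only: list.map prod_list.Cons) (rule proots_mult, auto)
    thus ?case using Cons by simp
  qed simp
  ultimately show ?thesis by simp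
qed

lemma filter_gt_second:
  fixes l :: "real list"
  assumes "sorted (rev l)" "length l \<ge> 2" "l ! 1 \<le> s"
  shows "length (filter (\<lambda>x. s < x) l) \<le> 1"
proof -
  obtain a c l' where l: "l = a # c # l'"
    using assms(2) by (cases l; cases "tl l") auto
  have "c \<le> s" using assms(3) l by simp
  moreover have "x \<le> c" if "x \<in> set l'" for x
    using assms(1) that unfolding l by (auto simp: sorted_append)
  ultimately have "filter (\<lambda>x. s < x) (c # l') = []" by (force simp: filter_empty_conv)
  thus ?thesis unfolding l by simp
qed

text \<open>Complexified, \<open>A A\<^sup>T\<close> has an orthonormal eigenbasis and at most one eigenvalue above
  \<open>s\<^sup>2\<close>; as \<open>s < 1\<close>, this is the eigenvalue \<open>1\<close> of \<open>u\<close>, so \<open>u\<close> spans that eigenspace.\<close>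

lemma second_singular_value_bound:
  fixes A :: "real mat" and u v :: "nat \<Rightarrow> real"
  assumes A: "A \<in> carrier_mat n m" and nm: "2 \<le> n" "2 \<le> m"
    and s: "second_singular_value A \<le> s" "0 \<le> s" "s < 1"
    and eig: "\<And>i. i < n \<Longrightarrow> (\<Sum>j<m. A $$ (i, j) * (\<Sum>k<n. A $$ (k, j) * u k)) = u i"
    and u0: "\<exists>i<n. u i \<noteq> 0" and orth: "(\<Sum>i<n. u i * v i) = 0"
  shows "(\<Sum>j<m. (\<Sum>i<n. A $$ (i, j) * v i)\<^sup>2) \<le> s\<^sup>2 * (\<Sum>i<n. (v i)\<^sup>2)"
proof -
  define N where "N = A * A\<^sup>T"
  have N: "N \<in> carrier_mat n n" using A by (simp add: N_def)
  have Nij: "N $$ (i, k) = (\<Sum>j<m. A $$ (i, j) * A $$ (k, j))" if "i < n" "k < n" for i k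
    using that A by (simp add: N_def scalar_prod_def atLeast0LessThan)
  define C where "C = map_mat complex_of_real N"
  have C: "C \<in> carrier_mat n n" using N by (simp add: C_def)
  have "mat_adjoint C = C"
    using C N by (intro eq_matI) (auto simp: C_def Nij mult.commute)
  from hermitian_diagonalization[OF C this] obtain U b where U: "U \<in> carrier_mat n n"
    "mat_adjoint U * U = 1\<^sub>m n" "U * mat_adjoint U = 1\<^sub>m n" and CU: "C = U * diag_real n b * mat_adjoint U" by metis
  have Ua: "mat_adjoint U \<in> carrier_mat n n" using U by simp
  define xs where "xs = map (\<lambda>i. sqrt (b i)) [0..<n]"
  define l where "l = rev (sort xs)"
  have sv: "singular_values A = take (min n m) l"
    using A proots_char_poly_symmetric[OF N U CU[unfolded C_def]]
    by (simp add: singular_values_def N_def l_def xs_def o_def flip: mset_map)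
  have len: "length l = n" by (simp add: l_def xs_def)
  \<comment> \<open>With at least two rows and two columns the truncated list still has two entries,
    so \<open>second_singular_value\<close> is not its default 0 but really the entry with index
    1.\<close>
  hence "l ! 1 \<le> s" using s(1) nm sv by (auto simp: second_singular_value_def)
  hence "length (filter (\<lambda>x. s < x) l) \<le> 1" using nm len by (intro filter_gt_second) (auto simp: l_def)
  moreover have "length (filter (\<lambda>x. s < x) l) = card {i. i < n \<and> s < sqrt (b i)}"
  proof -
    have "mset l = mset xs" by (simp add: l_def)
    hence "length (filter (\<lambda>x. s < x) l) = length (filter (\<lambda>x. s < x) xs)"
      by (metis mset_filter size_mset)
    also have "\<dots> = card {i. i < n \<and> s < xs ! i}"
      by (subst length_filter_conv_card) (simp add: xs_def)
    also have "{i. i < n \<and> s < xs ! i} = {i. i < n \<and> s < sqrt (b i)}" by (auto simp: xs_def)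
    finally show ?thesis .
  qed
  ultimately have "card {i. i < n \<and> s < sqrt (b i)} \<le> 1" by simp
  hence one: "i = j" if "i < n" "j < n" "s < sqrt (b i)" "s < sqrt (b j)" for i j
    using that card_le_Suc0_iff_eq[of "{i. i < n \<and> s < sqrt (b i)}"] by auto
  \<comment> \<open>Coordinates in the orthonormal eigenbasis. Below, \<open>ip\<close> states that
    they preserve inner products and \<open>cvN\<close> that \<open>N\<close> acts on them
    diagonally.\<close>
  define cv where "cv w = mat_adjoint U *\<^sub>v Matrix.vec n (\<lambda>i. complex_of_real (w i))" for w
  have cv: "cv w \<in> carrier_vec n" for w using Ua by (auto simp: cv_def intro: mult_mat_vec_carrier)
  have Ucv: "U *\<^sub>v cv w = Matrix.vec n (\<lambda>i. complex_of_real (w i))" for w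
    unfolding cv_def using U Ua by (subst assoc_mult_mat_vec[OF U(1) Ua, symmetric]) auto
  have ip: "complex_of_real (\<Sum>i<n. w i * z i) = (\<Sum>i<n. cv w $ i * cnj (cv z $ i))" for w z
  proof -
    have "complex_of_real (\<Sum>i<n. w i * z i) = (U *\<^sub>v cv w) \<bullet>c Matrix.vec n (\<lambda>i. complex_of_real (z i))"
      unfolding Ucv by (simp add: scalar_prod_def atLeast0LessThan conjugate_complex_def)
    also have "\<dots> = cv w \<bullet>c cv z"
      by (subst cscalar_adjoint[OF U(1) cv]) (simp_all add: cv_def)
    finally show ?thesis using carrier_vecD[OF cv] by (simp add: scalar_prod_def atLeast0LessThan conjugate_complex_def)
  qed
  have cvN: "cv (\<lambda>i. \<Sum>k<n. N $$ (i, k) * w k) $ i = complex_of_real (b i) * cv w $ i" if "i < n" for w i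
  proof -
    let ?w = "Matrix.vec n (\<lambda>i. complex_of_real (w i))"
    have w: "?w \<in> carrier_vec n" by simp
    have D: "diag_real n b \<in> carrier_mat n n" by simp
    have UD: "U * diag_real n b \<in> carrier_mat n n" using U by simp
    have Dc: "diag_real n b *\<^sub>v cv w \<in> carrier_vec n" using cv by (intro mult_mat_vec_carrier[OF D])
    have "Matrix.vec n (\<lambda>i. complex_of_real (\<Sum>k<n. N $$ (i, k) * w k)) = C *\<^sub>v ?w"
      using N by (intro eq_vecI) (auto simp: C_def scalar_prod_def atLeast0LessThan)
    also have "\<dots> = U *\<^sub>v (diag_real n b *\<^sub>v cv w)"
      unfolding CU cv_def using assoc_mult_mat_vec[OF UD Ua w]
        assoc_mult_mat_vec[OF U(1) D mult_mat_vec_carrier[OF Ua w]] by simp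
    finally have "cv (\<lambda>i. \<Sum>k<n. N $$ (i, k) * w k) = mat_adjoint U *\<^sub>v (U *\<^sub>v (diag_real n b *\<^sub>v cv w))"
      by (simp add: cv_def)
    also have "\<dots> = diag_real n b *\<^sub>v cv w"
      using assoc_mult_mat_vec[OF Ua U(1) Dc] Dc U(2) by simp
    finally have "cv (\<lambda>i. \<Sum>k<n. N $$ (i, k) * w k) $ i = (diag_real n b *\<^sub>v cv w) $ i" by simp
    also have "\<dots> = (\<Sum>k<n. (if i = k then complex_of_real (b i) else 0) * cv w $ k)"
      using that carrier_vecD[OF cv[of w]] by (simp add: diag_real_def scalar_prod_def atLeast0LessThan)
    also have "\<dots> = complex_of_real (b i) * cv w $ i" using that by (simp add: if_distrib if_distribR cong: if_cong)
    finally show ?thesis .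
  qed
  have Nu: "(\<Sum>k<n. N $$ (i, k) * u k) = u i" if "i < n" for i
  proof -
    have "(\<Sum>k<n. N $$ (i, k) * u k) = (\<Sum>k<n. \<Sum>j<m. A $$ (i, j) * (A $$ (k, j) * u k))"
      using that by (intro sum.cong) (auto simp: Nij sum_distrib_left sum_distrib_right mult_ac)
    also have "\<dots> = (\<Sum>j<m. A $$ (i, j) * (\<Sum>k<n. A $$ (k, j) * u k))"
      by (subst sum.swap) (simp add: sum_distrib_left)
    finally show ?thesis using eig that by simp
  qed
  have cu: "cv u $ i = complex_of_real (b i) * cv u $ i" if "i < n" for i
  proof -
    have "Matrix.vec n (\<lambda>i. complex_of_real (\<Sum>k<n. N $$ (i, k) * u k)) = Matrix.vec n (\<lambda>i. complex_of_real (u i))"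
      using Nu by (intro eq_vecI) (auto simp del: of_real_sum)
    thus ?thesis using cvN[OF that, of u] by (simp add: cv_def)
  qed
  have "\<exists>i<n. cv u $ i \<noteq> 0"
  proof (rule ccontr)
    assume "\<not> ?thesis"
    hence "cv u $ i * cnj (cv u $ i) = 0" if "i < n" for i using that by auto
    hence "complex_of_real (\<Sum>i<n. u i * u i) = 0" unfolding ip by simp
    hence "(\<Sum>i<n. u i * u i) = 0" by (simp only: of_real_eq_0_iff)
    thus False using u0 by (auto simp: sum_nonneg_eq_0_iff)
  qed
  then obtain p where p: "p < n" "cv u $ p \<noteq> 0" by blast
  have "(complex_of_real (b p) - 1) * cv u $ p = 0" using cu[OF p(1)] by (simp add: algebra_simps)
  hence bp: "b p = 1" using p(2) by auto
  have bi: "b i \<le> s\<^sup>2" if "i < n" "i \<noteq> p" for i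
  proof -
    have "sqrt (b i) \<le> s" using one[OF that(1) p(1)] that(2) bp s by force
    thus ?thesis by (rule sqrt_le_D)
  qed
  have cui: "cv u $ i = 0" if "i < n" "i \<noteq> p" for i
  proof -
    have "s\<^sup>2 < 1" using s by (simp add: power_less_one_iff)
    hence "b i \<noteq> 1" using bi[OF that] by simp
    moreover have "(complex_of_real (b i) - 1) * cv u $ i = 0" using cu[OF that(1)] by (simp add: algebra_simps)
    ultimately show ?thesis by auto
  qed
  have "(\<Sum>i<n. cv u $ i * cnj (cv v $ i)) = 0" using ip[of u v] orth by simp
  also have "(\<Sum>i<n. cv u $ i * cnj (cv v $ i)) = (\<Sum>i<n. if i = p then cv u $ p * cnj (cv v $ p) else 0)"
    using cui by (intro sum.cong) auto
  \<comment> \<open>The only nonzero coordinate of \<open>u\<close> is at \<open>p\<close>, so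
    orthogonality to \<open>u\<close> removes exactly the component of \<open>v\<close> whose
    eigenvalue may exceed s^2.\<close>
  finally have cvp: "cv v $ p = 0" using p by simp
  have "(\<Sum>j<m. (\<Sum>i<n. A $$ (i, j) * v i)\<^sup>2) = (\<Sum>j<m. \<Sum>i<n. \<Sum>k<n. A $$ (i, j) * v i * (A $$ (k, j) * v k))"
    by (simp add: power2_eq_square sum_product)
  also have "\<dots> = (\<Sum>i<n. \<Sum>k<n. \<Sum>j<m. A $$ (i, j) * v i * (A $$ (k, j) * v k))"
    by (subst sum.swap) (intro sum.cong refl sum.swap)
  also have "\<dots> = (\<Sum>i<n. (\<Sum>k<n. N $$ (i, k) * v k) * v i)"
    by (intro sum.cong) (auto simp: Nij sum_distrib_left sum_distrib_right mult_ac)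
  finally have lhs: "(\<Sum>j<m. (\<Sum>i<n. A $$ (i, j) * v i)\<^sup>2) = (\<Sum>i<n. (\<Sum>k<n. N $$ (i, k) * v k) * v i)" .
  have "complex_of_real (\<Sum>i<n. (\<Sum>k<n. N $$ (i, k) * v k) * v i) = (\<Sum>i<n. complex_of_real (b i) * (cv v $ i * cnj (cv v $ i)))"
    unfolding ip by (intro sum.cong) (auto simp: cvN)
  also have "\<dots> = complex_of_real (\<Sum>i<n. b i * (cmod (cv v $ i))\<^sup>2)"
    by (simp add: complex_norm_square[symmetric])
  finally have "(\<Sum>i<n. (\<Sum>k<n. N $$ (i, k) * v k) * v i) = (\<Sum>i<n. b i * (cmod (cv v $ i))\<^sup>2)"
    by (simp only: of_real_eq_iff)
  also have "\<dots> \<le> (\<Sum>i<n. s\<^sup>2 * (cmod (cv v $ i))\<^sup>2)"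
  proof (rule sum_mono)
    fix i assume "i \<in> {..<n}"
    thus "b i * (cmod (cv v $ i))\<^sup>2 \<le> s\<^sup>2 * (cmod (cv v $ i))\<^sup>2"
      using bi[of i] cvp by (cases "i = p") (auto intro: mult_right_mono)
  qed
  also have "\<dots> = s\<^sup>2 * (\<Sum>i<n. (cmod (cv v $ i))\<^sup>2)" by (simp add: sum_distrib_left)
  also have "complex_of_real (\<Sum>i<n. (cmod (cv v $ i))\<^sup>2) = complex_of_real (\<Sum>i<n. v i * v i)"
    unfolding ip by (simp add: complex_norm_square[symmetric])
  hence "(\<Sum>i<n. (cmod (cv v $ i))\<^sup>2) = (\<Sum>i<n. (v i)\<^sup>2)" by (simp only: of_real_eq_iff power2_eq_square)
  finally show ?thesis unfolding lhs .
qed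

text \<open>The values lie in any real vector space, so that one definition serves real quantities
  and complex matrix entries.\<close>

definition nbr_avg :: "('l, 'r) bigraph \<Rightarrow> ('l \<Rightarrow> 'b::real_vector) \<Rightarrow> 'r \<Rightarrow> 'b" where
  "nbr_avg M f x = (\<Sum>x'\<in>lnbrs M x. f x') /\<^sub>R real (card (lnbrs M x))"

lemma finite_nbrs:
  assumes "bipartite_graph M"
  shows "finite (lnbrs M x)" "finite (rnbrs M x')" "lnbrs M x \<subseteq> lverts M" "rnbrs M x' \<subseteq> rverts M"
  using assms unfolding bipartite_graph_def lnbrs_def rnbrs_def
  by (auto intro: finite_subset[of _ "lverts M"] finite_subset[of _ "rverts M"])

lemma sum_edges_swap:
  fixes g :: "'r \<Rightarrow> 'l \<Rightarrow> real"
  assumes "bipartite_graph M"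
  shows "(\<Sum>x\<in>rverts M. \<Sum>x'\<in>lnbrs M x. g x x') = (\<Sum>x'\<in>lverts M. \<Sum>x\<in>rnbrs M x'. g x x')"
proof -
  have "(\<Sum>x\<in>rverts M. \<Sum>x'\<in>lnbrs M x. g x x') = (\<Sum>x\<in>rverts M. \<Sum>x'\<in>{x' \<in> lverts M. (x', x) \<in> edges M}. g x x')"
    using finite_nbrs(3)[OF assms] by (intro sum.cong) (auto simp: lnbrs_def)
  also have "\<dots> = (\<Sum>x'\<in>lverts M. \<Sum>x\<in>{x \<in> rverts M. (x', x) \<in> edges M}. g x x')"
    using assms by (intro sum.swap_restrict) (auto simp: bipartite_graph_def)
  also have "\<dots> = (\<Sum>x'\<in>lverts M. \<Sum>x\<in>rnbrs M x'. g x x')"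
    using finite_nbrs(4)[OF assms] by (intro sum.cong) (auto simp: rnbrs_def)
  finally show ?thesis .
qed

lemma sum_from_nat_into:
  assumes "finite S"
  shows "(\<Sum>i<card S. g (from_nat_into S i)) = (\<Sum>x\<in>S. g x)"
  by (rule sum.reindex_bij_betw[OF bij_betw_from_nat_into_finite[OF assms]])

text \<open>The left side is the squared norm of the transposed adjacency matrix applied to
  \<open>v\<close>, because the entry at an edge simplifies to 1 / sqrt (D k) with k the degree of
  the left vertex. By right regularity the constant vector is fixed by the adjacency matrix times
  its transpose, and \<open>orth\<close> says that \<open>v\<close> is orthogonal to it.\<close>

lemma expander_contraction:
  fixes v :: "'r \<Rightarrow> real"
  assumes M: "bipartite_graph M" and D: "right_regular M D"
    and sv: "second_singular_value (normalized_adjacency M D) \<le> s" "0 \<le> s" "s < 1"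
    and card: "2 \<le> card (rverts M)" "2 \<le> card (lverts M)"
    and orth: "(\<Sum>x\<in>rverts M. v x) = 0"
  shows "(\<Sum>x'\<in>lverts M. (\<Sum>x\<in>rnbrs M x'. v x)\<^sup>2 / (real D * real (card (rnbrs M x'))))
    \<le> s\<^sup>2 * (\<Sum>x\<in>rverts M. (v x)\<^sup>2)"
proof -
  let ?n = "card (rverts M)" and ?m = "card (lverts M)"
  let ?r = "from_nat_into (rverts M)" and ?l = "from_nat_into (lverts M)"
  have fin: "finite (rverts M)" "finite (lverts M)" using M by (auto simp: bipartite_graph_def)
  have Dpos: "real D > 0" using D by (simp add: right_regular_def)
  define a where "a x x' = (if x' \<in> lnbrs M x then 1 / real D * sqrt (muR M x / muL M D x') else 0)" for x x'
  define A where "A = normalized_adjacency M D"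
  have A: "A \<in> carrier_mat ?n ?m" by (simp add: A_def normalized_adjacency_def)
  have Aij: "A $$ (i, j) = a (?r i) (?l j)" if "i < ?n" "j < ?m" for i j
    using that by (simp add: A_def normalized_adjacency_def a_def Let_def)
  have a_val: "a x x' = (if x \<in> rnbrs M x' then 1 / sqrt (real D * real (card (rnbrs M x'))) else 0)"
    if "x \<in> rverts M" for x x'
  proof (cases "x \<in> rnbrs M x'")
    case True
    hence "card (rnbrs M x') > 0" using finite_nbrs(2)[OF M] by (auto simp: card_gt_0_iff)
    moreover have "card (rverts M) > 0" using card by simp
    ultimately have "muR M x / muL M D x' = real D / real (card (rnbrs M x'))"
      by (simp add: muR_def muL_def)
    hence "1 / real D * sqrt (muR M x / muL M D x') = 1 / sqrt (real D * real (card (rnbrs M x')))"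
      using Dpos \<open>card (rnbrs M x') > 0\<close>
      by (simp add: real_sqrt_divide real_sqrt_mult frac_eq_eq)
    thus ?thesis using True by (simp add: a_def lnbrs_def rnbrs_def)
  next
    case False
    thus ?thesis by (simp add: a_def lnbrs_def rnbrs_def)
  qed
  have col: "(\<Sum>i<?n. A $$ (i, j) * w (?r i)) = (\<Sum>x\<in>rnbrs M (?l j). w x) / sqrt (real D * real (card (rnbrs M (?l j))))"
    if "j < ?m" for j w
  proof -
    have "(\<Sum>i<?n. A $$ (i, j) * w (?r i)) = (\<Sum>i<?n. a (?r i) (?l j) * w (?r i))"
      using that by (simp add: Aij)
    also have "\<dots> = (\<Sum>x\<in>rverts M. a x (?l j) * w x)"
      by (rule sum_from_nat_into[OF fin(1)])
    also have "\<dots> = (\<Sum>x\<in>rverts M. if x \<in> rnbrs M (?l j) then w x / sqrt (real D * real (card (rnbrs M (?l j)))) else 0)"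
      by (intro sum.cong) (auto simp: a_val)
    also have "\<dots> = (\<Sum>x\<in>rverts M \<inter> rnbrs M (?l j). w x / sqrt (real D * real (card (rnbrs M (?l j)))))"
      by (simp add: sum.inter_restrict[OF fin(1)])
    also have "rverts M \<inter> rnbrs M (?l j) = rnbrs M (?l j)" using finite_nbrs(4)[OF M] by auto
    finally show ?thesis by (simp add: sum_divide_distrib)
  qed
  have "(\<Sum>j<?m. (\<Sum>i<?n. A $$ (i, j) * v (?r i))\<^sup>2) \<le> s\<^sup>2 * (\<Sum>i<?n. (v (?r i))\<^sup>2)"
  proof (rule second_singular_value_bound[OF A card sv(1)[folded A_def] sv(2,3), where u = "\<lambda>_. 1"])
    fix i assume i: "i < ?n"
    have x: "?r i \<in> rverts M" using i card by (intro from_nat_into) auto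
    have "(\<Sum>j<?m. A $$ (i, j) * (\<Sum>k<?n. A $$ (k, j) * 1))
      = (\<Sum>j<?m. a (?r i) (?l j) * (real (card (rnbrs M (?l j))) / sqrt (real D * real (card (rnbrs M (?l j))))))"
      using i col[of _ "\<lambda>_. 1"] by (intro sum.cong) (auto simp: Aij)
    also have "\<dots> = (\<Sum>x'\<in>lverts M. a (?r i) x' * (real (card (rnbrs M x')) / sqrt (real D * real (card (rnbrs M x')))))"
      by (rule sum_from_nat_into[OF fin(2)])
    also have "\<dots> = (\<Sum>x'\<in>lverts M. if x' \<in> lnbrs M (?r i) then 1 / real D else 0)"
    proof (intro sum.cong refl)
      fix x' assume "x' \<in> lverts M"
      show "a (?r i) x' * (real (card (rnbrs M x')) / sqrt (real D * real (card (rnbrs M x')))) = (if x' \<in> lnbrs M (?r i) then 1 / real D else 0)"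
      proof (cases "x' \<in> lnbrs M (?r i)")
        case True
        hence r: "?r i \<in> rnbrs M x'" by (simp add: lnbrs_def rnbrs_def)
        hence "real (card (rnbrs M x')) > 0" using finite_nbrs(2)[OF M] by (auto simp: card_gt_0_iff)
        thus ?thesis using True r Dpos by (simp add: a_val[OF x] flip: times_divide_times_eq)
      next
        case False
        thus ?thesis by (simp add: a_def)
      qed
    qed
    also have "\<dots> = (\<Sum>x'\<in>lverts M \<inter> lnbrs M (?r i). 1 / real D)"
      by (rule sum.inter_restrict[OF fin(2), symmetric])
    also have "lverts M \<inter> lnbrs M (?r i) = lnbrs M (?r i)" using finite_nbrs(3)[OF M] by auto
    also have "(\<Sum>x'\<in>lnbrs M (?r i). 1 / real D) = 1" using D x Dpos by (simp add: right_regular_def)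
    finally show "(\<Sum>j<?m. A $$ (i, j) * (\<Sum>k<?n. A $$ (k, j) * 1)) = 1" .
  next
    show "\<exists>i<?n. (1::real) \<noteq> 0" using card by (intro exI[of _ 0]) auto
    show "(\<Sum>i<?n. 1 * v (?r i)) = 0" using sum_from_nat_into[OF fin(1), of v] orth by simp
  qed
  also have "(\<Sum>i<?n. (v (?r i))\<^sup>2) = (\<Sum>x\<in>rverts M. (v x)\<^sup>2)"
    by (rule sum_from_nat_into[OF fin(1)])
  also have "(\<Sum>j<?m. (\<Sum>i<?n. A $$ (i, j) * v (?r i))\<^sup>2)
      = (\<Sum>j<?m. (\<Sum>x\<in>rnbrs M (?l j). v x)\<^sup>2 / (real D * real (card (rnbrs M (?l j)))))"
    by (intro sum.cong) (auto simp: col power_divide)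
  also have "\<dots> = (\<Sum>x'\<in>lverts M. (\<Sum>x\<in>rnbrs M x'. v x)\<^sup>2 / (real D * real (card (rnbrs M x'))))"
    by (rule sum_from_nat_into[OF fin(2)])
  finally show ?thesis .
qed

text \<open>A duality argument. The squared norm of the deviation \<open>v\<close> is the pairing of
  \<open>v\<close> with the averages of \<open>f\<close>; summed over edges from the other side, it
  is a pairing of the transposed adjacency matrix applied to \<open>v\<close> with a weighted copy
  of \<open>f\<close>. Cauchy-Schwarz and the contraction of \<open>v\<close> leave one factor of
  the norm to cancel.\<close>

lemma expander_deviation_real:
  fixes f :: "'l \<Rightarrow> real"
  assumes M: "bipartite_graph M" and D: "right_regular M D"
    and sv: "second_singular_value (normalized_adjacency M D) \<le> s" "0 \<le> s" "s < 1"
    and m: "real (card (rverts M)) * m = (\<Sum>x\<in>rverts M. nbr_avg M f x)"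
  shows "(\<Sum>x\<in>rverts M. (nbr_avg M f x - m)\<^sup>2) \<le> s\<^sup>2 * (\<Sum>x\<in>rverts M. nbr_avg M (\<lambda>x'. (f x')\<^sup>2) x)"
    (is "_ \<le> s\<^sup>2 * ?F")
proof -
  have fin: "finite (rverts M)" "finite (lverts M)" using M by (auto simp: bipartite_graph_def)
  have Dpos: "real D > 0" using D by (simp add: right_regular_def)
  have cD: "card (lnbrs M x) = D" if "x \<in> rverts M" for x using D that by (simp add: right_regular_def)
  define v where "v x = nbr_avg M f x - m" for x
  have Fnn: "0 \<le> ?F" by (simp add: nbr_avg_def sum_nonneg)
  have triv: ?thesis if "\<And>x. x \<in> rverts M \<Longrightarrow> v x = 0"
    using that Fnn sv(2) by (simp add: v_def)
  have sumv: "(\<Sum>x\<in>rverts M. v x) = 0" using m by (simp add: v_def sum_subtractf)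
  show ?thesis
  proof (cases "2 \<le> card (rverts M) \<and> 2 \<le> card (lverts M)")
    \<comment> \<open>With at most one vertex on a side the second singular value is the default 0
      and says nothing about the graph. The deviations vanish for a direct reason: there is at most
      one average, or all averages are the value of \<open>f\<close> at the same vertex.\<close>
    case False
    show ?thesis
    proof (cases "card (rverts M) \<le> 1")
      case True
      then obtain x where "rverts M \<subseteq> {x}"
        using fin by (metis card_le_Suc0_iff_eq One_nat_def subsetI singletonI insert_iff)
      hence "rverts M = {} \<or> rverts M = {x}" by auto
      thus ?thesis using sumv by (intro triv) auto
    next
      case False
      hence l1: "card (lverts M) \<le> 1" and r: "card (rverts M) > 0" using \<open>\<not> (2 \<le> card (rverts M) \<and> _)\<close> by auto
      obtain x' where x': "lverts M \<subseteq> {x'}"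
        using fin l1 by (metis card_le_Suc0_iff_eq One_nat_def subsetI singletonI insert_iff)
      have "nbr_avg M f x = f x'" if "x \<in> rverts M" for x
      proof -
        have "lnbrs M x \<subseteq> {x'}" using finite_nbrs(3)[OF M] x' by blast
        moreover have "card (lnbrs M x) \<noteq> 0" using cD[OF that] Dpos by simp
        ultimately have "lnbrs M x = {x'}" by (metis card.empty subset_singletonD)
        thus ?thesis by (simp add: nbr_avg_def)
      qed
      moreover from this have "m = f x'" using m r by simp
      ultimately show ?thesis by (intro triv) (simp add: v_def)
    qed
  next
    case True
    let ?k = "\<lambda>x'. real (card (rnbrs M x'))"
    let ?V = "\<Sum>x\<in>rverts M. (v x)\<^sup>2"
    have con: "(\<Sum>x'\<in>lverts M. (\<Sum>x\<in>rnbrs M x'. v x)\<^sup>2 / (real D * ?k x')) \<le> s\<^sup>2 * ?V"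
      using expander_contraction[OF M D sv _ _ sumv] True by simp
    \<comment> \<open>The deviations sum to zero, so the mean may be dropped from one of the two
      factors of the square.\<close>
    have "?V = (\<Sum>x\<in>rverts M. v x * nbr_avg M f x) - m * (\<Sum>x\<in>rverts M. v x)"
      by (simp add: v_def power2_eq_square algebra_simps sum_subtractf sum_distrib_left sum.distrib)
    also have "\<dots> = (\<Sum>x\<in>rverts M. \<Sum>x'\<in>lnbrs M x. v x * f x' / real D)"
      unfolding sumv by (simp add: nbr_avg_def cD sum_distrib_left sum_divide_distrib divide_inverse mult_ac)
    also have "\<dots> = (\<Sum>x'\<in>lverts M. \<Sum>x\<in>rnbrs M x'. v x * f x' / real D)" by (rule sum_edges_swap[OF M])
    \<comment> \<open>The degree is split so that the squares of the first factors form the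
      contraction estimate and those of the second factors sum, over edges, to the averages of the
      square of \<open>f\<close>. An isolated left vertex contributes 0 on both sides.\<close>
    also have "\<dots> = (\<Sum>x'\<in>lverts M. ((\<Sum>x\<in>rnbrs M x'. v x) / sqrt (real D * ?k x')) * (sqrt (?k x' / real D) * f x'))"
    proof (intro sum.cong refl)
      fix x'
      have "(\<Sum>x\<in>rnbrs M x'. v x * f x' / real D) = (\<Sum>x\<in>rnbrs M x'. v x) * f x' / real D"
        by (simp add: sum_distrib_right sum_divide_distrib)
      also have "\<dots> = ((\<Sum>x\<in>rnbrs M x'. v x) / sqrt (real D * ?k x')) * (sqrt (?k x' / real D) * f x')"
      proof (cases "rnbrs M x' = {}")
        case False
        hence "?k x' > 0" using finite_nbrs(2)[OF M] by (simp add: card_gt_0_iff)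
        thus ?thesis using Dpos by (simp add: real_sqrt_divide real_sqrt_mult)
      qed simp
      finally show "(\<Sum>x\<in>rnbrs M x'. v x * f x' / real D) = \<dots>" .
    qed
    finally have "?V\<^sup>2 = (\<Sum>x'\<in>lverts M. ((\<Sum>x\<in>rnbrs M x'. v x) / sqrt (real D * ?k x')) * (sqrt (?k x' / real D) * f x'))\<^sup>2"
      by simp
    also have "\<dots> \<le> (\<Sum>x'\<in>lverts M. ((\<Sum>x\<in>rnbrs M x'. v x) / sqrt (real D * ?k x'))\<^sup>2) * (\<Sum>x'\<in>lverts M. (sqrt (?k x' / real D) * f x')\<^sup>2)"
      by (rule Cauchy_Schwarz_ineq_sum)
    also have "(\<Sum>x'\<in>lverts M. (sqrt (?k x' / real D) * f x')\<^sup>2) = (\<Sum>x'\<in>lverts M. \<Sum>x\<in>rnbrs M x'. (f x')\<^sup>2 / real D)"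
      using Dpos by (simp add: power_mult_distrib)
    also have "\<dots> = ?F"
      unfolding sum_edges_swap[OF M, symmetric]
      by (simp add: nbr_avg_def cD sum_distrib_left sum_divide_distrib divide_inverse mult_ac)
    also have "(\<Sum>x'\<in>lverts M. ((\<Sum>x\<in>rnbrs M x'. v x) / sqrt (real D * ?k x'))\<^sup>2) * ?F \<le> (s\<^sup>2 * ?V) * ?F"
      using con Fnn Dpos by (intro mult_right_mono) (simp_all add: power_divide)
    finally have VV: "?V * ?V \<le> ?V * (s\<^sup>2 * ?F)" by (simp add: power2_eq_square mult_ac)
    have "0 \<le> ?V" by (simp add: sum_nonneg)
    hence "?V \<le> s\<^sup>2 * ?F" using VV Fnn by (cases "?V = 0") (auto simp: mult_le_cancel_left)
    thus ?thesis by (simp add: v_def)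
  qed
qed

lemma expander_deviation:
  fixes f :: "'l \<Rightarrow> complex"
  assumes M: "bipartite_graph M" and D: "right_regular M D"
    and sv: "second_singular_value (normalized_adjacency M D) \<le> s" "0 \<le> s" "s < 1"
    and m: "of_nat (card (rverts M)) * m = (\<Sum>x\<in>rverts M. nbr_avg M f x)"
  shows "(\<Sum>x\<in>rverts M. (cmod (nbr_avg M f x - m))\<^sup>2)
    \<le> s\<^sup>2 * (\<Sum>x\<in>rverts M. nbr_avg M (\<lambda>x'. (cmod (f x'))\<^sup>2) x)"
proof -
  have re: "Re (nbr_avg M f x) = nbr_avg M (\<lambda>x'. Re (f x')) x" and im: "Im (nbr_avg M f x) = nbr_avg M (\<lambda>x'. Im (f x')) x" for x
    by (simp_all add: nbr_avg_def)
  have "(\<Sum>x\<in>rverts M. (cmod (nbr_avg M f x - m))\<^sup>2)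
    = (\<Sum>x\<in>rverts M. (nbr_avg M (\<lambda>x'. Re (f x')) x - Re m)\<^sup>2) + (\<Sum>x\<in>rverts M. (nbr_avg M (\<lambda>x'. Im (f x')) x - Im m)\<^sup>2)"
    by (simp add: cmod_power2 re im sum.distrib)
  also have "\<dots> \<le> s\<^sup>2 * (\<Sum>x\<in>rverts M. nbr_avg M (\<lambda>x'. (Re (f x'))\<^sup>2) x) + s\<^sup>2 * (\<Sum>x\<in>rverts M. nbr_avg M (\<lambda>x'. (Im (f x'))\<^sup>2) x)"
    using arg_cong[OF m, of Re] arg_cong[OF m, of Im]
    by (intro add_mono expander_deviation_real[OF M D sv]) (simp_all add: re im)
  also have "\<dots> = s\<^sup>2 * (\<Sum>x\<in>rverts M. nbr_avg M (\<lambda>x'. (cmod (f x'))\<^sup>2) x)"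
    by (simp add: cmod_power2 nbr_avg_def sum.distrib algebra_simps)
  finally show ?thesis .
qed

section \<open>Values of complete strategies\<close>

lemma psd_mat_avg:
  assumes "finite I" "\<And>k. k \<in> I \<Longrightarrow> psd d (F k)"
  shows "psd d (mat_avg d I F)"
proof -
  have "mat_avg d I F = complex_of_real (1 / real (card I)) \<cdot>\<^sub>m mat_sum d I F" by (simp add: mat_avg_def)
  thus ?thesis using psd_smult[of d "mat_sum d I F" "1 / real (card I)"] psd_mat_sum[of I d F] assms by simp
qed

lemma mat_avg_dim [simp]: "dim_row (mat_avg d I F) = d" "dim_col (mat_avg d I F) = d"
  by (simp_all add: mat_avg_def)

lemma mat_avg_index [simp]: "i < d \<Longrightarrow> j < d \<Longrightarrow> mat_avg d I F $$ (i, j) = (\<Sum>k\<in>I. F k $$ (i, j)) / of_nat (card I)"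
  by (simp add: mat_avg_def)

lemma psd_one_minus_mat_avg:
  assumes "finite I" "I \<noteq> {}" "\<And>k. k \<in> I \<Longrightarrow> F k \<in> carrier_mat d d" "\<And>k. k \<in> I \<Longrightarrow> psd d (1\<^sub>m d - F k)"
  shows "psd d (1\<^sub>m d - mat_avg d I F)"
proof -
  have n: "of_nat (card I) \<noteq> (0 :: complex)" using assms(1,2) by simp
  have "1\<^sub>m d - mat_avg d I F = mat_avg d I (\<lambda>k. 1\<^sub>m d - F k)"
  proof (rule eq_matI)
    fix i j assume "i < dim_row (mat_avg d I (\<lambda>k. 1\<^sub>m d - F k))" "j < dim_col (mat_avg d I (\<lambda>k. 1\<^sub>m d - F k))"
    hence ij: "i < d" "j < d" by auto
    have "(\<Sum>k\<in>I. (1\<^sub>m d - F k) $$ (i, j)) = (\<Sum>k\<in>I. 1\<^sub>m d $$ (i, j) - F k $$ (i, j))"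
    proof (rule sum.cong[OF refl])
      fix k assume "k \<in> I"
      from carrier_matD[OF assms(3)[OF this]] show "(1\<^sub>m d - F k) $$ (i, j) = 1\<^sub>m d $$ (i, j) - F k $$ (i, j)"
        using ij by simp
    qed
    thus "(1\<^sub>m d - mat_avg d I F) $$ (i, j) = mat_avg d I (\<lambda>k. 1\<^sub>m d - F k) $$ (i, j)"
      using ij n by (simp add: sum_subtractf diff_divide_distrib)
  qed auto
  thus ?thesis using psd_mat_avg[OF assms(1,4)] by simp
qed

lemma mat_avg_mult_index:
  assumes "\<And>k. k \<in> I \<Longrightarrow> F k \<in> carrier_mat d d" "X \<in> carrier_mat d d" "i < d" "j < d"
  shows "(mat_avg d I F * X) $$ (i, j) = (\<Sum>k\<in>I. (F k * X) $$ (i, j)) / of_nat (card I)"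
proof -
  have "(mat_avg d I F * X) $$ (i, j) = (\<Sum>l<d. \<Sum>k\<in>I. F k $$ (i, l) * X $$ (l, j)) / of_nat (card I)"
    using assms(2-4) by (simp add: scalar_prod_def atLeast0LessThan sum_distrib_right sum_divide_distrib)
  also have "(\<Sum>l<d. \<Sum>k\<in>I. F k $$ (i, l) * X $$ (l, j)) = (\<Sum>k\<in>I. \<Sum>l<d. F k $$ (i, l) * X $$ (l, j))"
    by (rule sum.swap)
  also have "\<dots> = (\<Sum>k\<in>I. (F k * X) $$ (i, j))"
  proof (rule sum.cong[OF refl])
    fix k assume "k \<in> I"
    from carrier_matD[OF assms(1)[OF this]] show "(\<Sum>l<d. F k $$ (i, l) * X $$ (l, j)) = (F k * X) $$ (i, j)"
      using assms(2-4) by (simp add: scalar_prod_def atLeast0LessThan)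
  qed
  finally show ?thesis .
qed

text \<open>From 0 \<le> T \<le> 1 follows T^2 \<le> T, because T - T^2 is 1 - T conjugated by the
  square root of T.\<close>

lemma hs_inner_contraction:
  assumes T: "psd d T" "psd d (1\<^sub>m d - T)" and X: "X \<in> carrier_mat d d"
  shows "hs_inner d (T * X) (T * X) \<le> hs_inner d X X"
proof -
  obtain F where F: "F \<in> carrier_mat d d" "mat_adjoint F = F" "T = F * F" by (rule psd_sqrt[OF T(1)])
  have Tc: "T \<in> carrier_mat d d" by (rule psd_carrier[OF T(1)])
  have "F * (1\<^sub>m d - T) * mat_adjoint F = F * F - F * (F * F) * F"
    using F Tc by (simp add: mult_minus_distrib_mat[of _ d d _ d] minus_mult_distrib_mat[of _ d d _ _ d] right_mult_one_mat[of _ d d])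
  also have "\<dots> = T - T * T" using F(1) by (simp add: F(3) assoc_square[where d=d])
  finally have "psd d (T - T * T)" using psd_conj[OF T(2) F(1)] by simp
  have "hs_inner d (T * X) (T * X) = bip_form d (T * T) (1\<^sub>m d) X"
    using Tc X psd_hermitian[OF T(1)] by (simp add: bip_form_square)
  also have "\<dots> \<le> bip_form d T (1\<^sub>m d) X"
    using Tc X by (intro bip_form_mono_left[OF _ \<open>psd d (T - T * T)\<close>] psd_one) auto
  also have "\<dots> \<le> bip_form d (1\<^sub>m d) (1\<^sub>m d) X"
    using Tc X by (intro bip_form_mono_left[OF _ T(2)] psd_one) auto
  finally show ?thesis using X by (simp add: bip_form_one)
qed

lemma bip_form_le_hs_inner:
  assumes "psd d M" "psd d (1\<^sub>m d - M)" "psd d N" "psd d (1\<^sub>m d - N)" "X \<in> carrier_mat d d"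
  shows "bip_form d M N X \<le> hs_inner d X X"
proof -
  have "bip_form d M N X \<le> bip_form d (1\<^sub>m d) N X"
    using assms psd_carrier[of d M] by (intro bip_form_mono_left) auto
  also have "\<dots> \<le> bip_form d (1\<^sub>m d) (1\<^sub>m d) X"
    using assms psd_carrier[of d N] by (intro bip_form_mono_right psd_one) auto
  finally show ?thesis using assms by (simp add: bip_form_one)
qed

lemma bip_form_smult_vec:
  assumes "M \<in> carrier_mat d d" "N \<in> carrier_mat d d" "X \<in> carrier_mat d d"
  shows "bip_form d M N (complex_of_real c \<cdot>\<^sub>m X) = c\<^sup>2 * bip_form d M N X"
proof -
  have "bip_form d M N (complex_of_real c \<cdot>\<^sub>m X) = hs_inner d (complex_of_real c \<cdot>\<^sub>m (M * X * N\<^sup>T)) (complex_of_real c \<cdot>\<^sub>m X)"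
    using assms by (simp add: bip_form_def mult_smult_distrib[of _ d d _ d] mult_smult_assoc_mat[of _ d d _ d])
  also have "\<dots> = c * hs_inner d (complex_of_real c \<cdot>\<^sub>m X) (M * X * N\<^sup>T)"
    using assms by (subst hs_inner_smult) (auto simp: hs_inner_commute)
  also have "\<dots> = c\<^sup>2 * bip_form d M N X"
    using assms by (subst hs_inner_smult) (auto simp: hs_inner_commute bip_form_def power2_eq_square)
  finally show ?thesis .
qed

lemma bip_form_product_lower:
  assumes "M \<in> carrier_mat d d" "N \<in> carrier_mat d d" "mat_adjoint N = N" "X \<in> carrier_mat d d"
  shows "- (hs_inner d (M * X) (M * X) + hs_inner d (N * X\<^sup>T) (N * X\<^sup>T)) / 2 \<le> bip_form d M N X"
proof -
  have a: "mat_adjoint N\<^sup>T = N\<^sup>T" using assms by (simp add: transpose_mat_adjoint)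
  have "bip_form d M N X = hs_inner d (M * X) (X * N\<^sup>T)"
    using assms unfolding bip_form_def by (subst hs_inner_mult_right) (auto simp: a)
  moreover have "hs_inner d (N * X\<^sup>T) (N * X\<^sup>T) = hs_inner d (X * N\<^sup>T) (X * N\<^sup>T)"
    using assms hs_inner_transpose[of "X * N\<^sup>T" d "X * N\<^sup>T"] by (simp add: transpose_mult[of _ d d _ d])
  moreover have "0 \<le> hs_inner d (M * X) (M * X) - 2 * (-1) * hs_inner d (M * X) (X * N\<^sup>T) + (-1)\<^sup>2 * hs_inner d (X * N\<^sup>T) (X * N\<^sup>T)"
    using assms by (subst hs_inner_diff_smult[symmetric]) auto
  ultimately show ?thesis by simp
qed

section \<open>Games as finite weighted sums and their entangled value\<close>

lemma expectation_pair:
  fixes f :: "'x \<Rightarrow> 'y \<Rightarrow> real"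
  assumes "finite X" "finite Y" "set_pmf p \<subseteq> X \<times> Y"
  shows "measure_pmf.expectation p (\<lambda>(x, y). f x y) = (\<Sum>x\<in>X. \<Sum>y\<in>Y. pmf p (x, y) * f x y)"
proof -
  have "measure_pmf.expectation p (\<lambda>(x, y). f x y) = (\<Sum>z\<in>X \<times> Y. (case z of (x, y) \<Rightarrow> f x y) * pmf p z)"
    using assms by (intro integral_measure_pmf_real) auto
  thus ?thesis by (simp add: sum.cartesian_product case_prod_unfold mult.commute)
qed

lemma marginal_weights:
  assumes G: "two_player_game G" "biregular G"
  shows "qX G \<noteq> {}" "qY G \<noteq> {}"
    "\<And>x. x \<in> qX G \<Longrightarrow> (\<Sum>y\<in>qY G. pmf (qdist G) (x, y)) = 1 / real (card (qX G))"
    "\<And>y. y \<in> qY G \<Longrightarrow> (\<Sum>x\<in>qX G. pmf (qdist G) (x, y)) = 1 / real (card (qY G))"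
proof -
  have fin: "finite (qX G)" "finite (qY G)" "set_pmf (qdist G) \<subseteq> qX G \<times> qY G"
    using G by (auto simp: two_player_game_def)
  show ne: "qX G \<noteq> {}" "qY G \<noteq> {}" using fin(3) set_pmf_not_empty[of "qdist G"] by auto
  show "(\<Sum>y\<in>qY G. pmf (qdist G) (x, y)) = 1 / real (card (qX G))" if "x \<in> qX G" for x
  proof -
    have "1 / real (card (qX G)) = measure_pmf.expectation (map_pmf fst (qdist G)) (\<lambda>x'. of_bool (x' = x))"
      using G that fin ne by (simp add: biregular_def integral_pmf_of_set of_bool_def)
    also have "\<dots> = measure_pmf.expectation (qdist G) (\<lambda>(x', y). of_bool (x' = x))"
      by (simp add: case_prod_unfold)
    also have "\<dots> = (\<Sum>x'\<in>qX G. \<Sum>y\<in>qY G. pmf (qdist G) (x', y) * of_bool (x' = x))"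
      by (rule expectation_pair[OF fin])
    also have "\<dots> = (\<Sum>y\<in>qY G. pmf (qdist G) (x, y))"
      using that fin by (subst sum.swap) (simp add: of_bool_def if_distrib cong: if_cong)
    finally show ?thesis by simp
  qed
  show "(\<Sum>x\<in>qX G. pmf (qdist G) (x, y)) = 1 / real (card (qY G))" if "y \<in> qY G" for y
  proof -
    have "1 / real (card (qY G)) = measure_pmf.expectation (map_pmf snd (qdist G)) (\<lambda>y'. of_bool (y' = y))"
      using G that fin ne by (simp add: biregular_def integral_pmf_of_set of_bool_def)
    also have "\<dots> = measure_pmf.expectation (qdist G) (\<lambda>(x, y'). of_bool (y' = y))"
      by (simp add: case_prod_unfold)
    also have "\<dots> = (\<Sum>x\<in>qX G. \<Sum>y'\<in>qY G. pmf (qdist G) (x, y') * of_bool (y' = y))"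
      by (rule expectation_pair[OF fin])
    also have "\<dots> = (\<Sum>x\<in>qX G. pmf (qdist G) (x, y))"
      using that fin by (simp add: of_bool_def if_distrib sum.delta cong: if_cong)
    finally show ?thesis by simp
  qed
qed

lemma strategy_value_eq:
  assumes G: "two_player_game G" and \<psi>: "\<psi> \<in> carrier_vec (d * d)"
    and "\<And>x a. x \<in> qX G \<Longrightarrow> a \<in> ansA G \<Longrightarrow> A x a \<in> carrier_mat d d"
    and "\<And>y b. y \<in> qY G \<Longrightarrow> b \<in> ansB G \<Longrightarrow> B y b \<in> carrier_mat d d"
  shows "strategy_value G \<psi> A B = game_form d (qX G) (qY G) (\<lambda>x y. pmf (qdist G) (x, y))
    (ansA G) (ansB G) (pred G) A B (unvec d \<psi>)"
  unfolding strategy_value_def game_form_def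
  by (subst expectation_pair[of "qX G" "qY G"])
    (use assms in \<open>auto simp: two_player_game_def expval_kron intro!: sum.cong\<close>)

lemma game_form_total:
  assumes "finite SA" "finite SB" "\<And>x a. x \<in> X \<Longrightarrow> a \<in> SA \<Longrightarrow> A x a \<in> carrier_mat d d"
    "\<And>y b. y \<in> Y \<Longrightarrow> b \<in> SB \<Longrightarrow> B y b \<in> carrier_mat d d" "\<Psi> \<in> carrier_mat d d"
  shows "game_form d X Y w SA SB (\<lambda>_ _ _ _. True) A B \<Psi>
    = (\<Sum>x\<in>X. \<Sum>y\<in>Y. w x y * bip_form d (mat_sum d SA (A x)) (mat_sum d SB (B y)) \<Psi>)"
  unfolding game_form_def using assms
  by (intro sum.cong refl arg_cong2[of _ _ _ _ "(*)"]) (simp, subst bip_form_sum_left, auto simp: bip_form_sum_right)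

lemma game_form_mono:
  assumes w: "\<And>x y. 0 \<le> w x y"
    and le: "\<And>x y a b. x \<in> X \<Longrightarrow> y \<in> Y \<Longrightarrow> a \<in> SA \<Longrightarrow> b \<in> SB \<Longrightarrow>
      of_bool (V a b x y) * bip_form d (A x a) (B y b) \<Psi> \<le> of_bool (V' a b x y) * bip_form d (A' x a) (B' y b) \<Psi>"
  shows "game_form d X Y w SA SB V A B \<Psi> \<le> game_form d X Y w SA SB V' A' B' \<Psi>"
  unfolding game_form_def by (intro sum_mono mult_left_mono le w)

text \<open>Supplies the upper bound without which the supremum defining
  \<open>entangled_value\<close> could not be compared with its members.\<close>

lemma complete_strategy_value_le_1:
  assumes G: "two_player_game G"
    and S: "complete_strategy (qX G) (\<lambda>_. ansA G) (qY G) (\<lambda>_. ansB G) d \<psi> A B"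
  shows "strategy_value G \<psi> A B \<le> 1"
proof -
  have fin: "finite (qX G)" "finite (qY G)" "finite (ansA G)" "finite (ansB G)" "set_pmf (qdist G) \<subseteq> qX G \<times> qY G"
    using G by (auto simp: two_player_game_def)
  have \<psi>: "\<psi> \<in> carrier_vec (d * d)" "\<psi> \<bullet>c \<psi> = 1"
    and A: "\<And>x a. x \<in> qX G \<Longrightarrow> a \<in> ansA G \<Longrightarrow> psd d (A x a)" "\<And>x. x \<in> qX G \<Longrightarrow> mat_sum d (ansA G) (A x) = 1\<^sub>m d"
    and B: "\<And>y b. y \<in> qY G \<Longrightarrow> b \<in> ansB G \<Longrightarrow> psd d (B y b)" "\<And>y. y \<in> qY G \<Longrightarrow> mat_sum d (ansB G) (B y) = 1\<^sub>m d"
    using S by (auto simp: complete_strategy_def entangled_substrategy_def)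
  let ?w = "\<lambda>x y. pmf (qdist G) (x, y)" and ?\<Psi> = "unvec d \<psi>"
  have "strategy_value G \<psi> A B = game_form d (qX G) (qY G) ?w (ansA G) (ansB G) (pred G) A B ?\<Psi>"
    using A(1) B(1) by (intro strategy_value_eq[OF G \<psi>(1)]) (auto simp: psd_carrier)
  also have "\<dots> \<le> game_form d (qX G) (qY G) ?w (ansA G) (ansB G) (\<lambda>_ _ _ _. True) A B ?\<Psi>"
    by (intro game_form_mono) (auto simp: bip_form_nonneg A B)
  also have "\<dots> = (\<Sum>x\<in>qX G. \<Sum>y\<in>qY G. ?w x y * bip_form d (1\<^sub>m d) (1\<^sub>m d) ?\<Psi>)"
    using fin A B by (subst game_form_total) (auto simp: psd_carrier)
  also have "\<dots> = (\<Sum>x\<in>qX G. \<Sum>y\<in>qY G. ?w x y)"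
    using \<psi> by (simp add: bip_form_one hs_inner_unvec)
  also have "\<dots> = 1" using expectation_pair[OF fin(1,2,5), of "\<lambda>_ _. 1"] by (simp add: case_prod_unfold)
  finally show ?thesis .
qed

text \<open>The missing mass \<open>1\<^sub>m d - mat_sum d S A\<close> is given to one fixed
  answer. No operator decreases, so no value does.\<close>

lemma complete_measurement:
  assumes "finite S" "S \<noteq> {}" "\<And>a. a \<in> S \<Longrightarrow> psd d (A a)" "psd d (1\<^sub>m d - mat_sum d S A)"
  shows "\<exists>A'. (\<forall>a\<in>S. psd d (A' a) \<and> psd d (A' a - A a)) \<and> mat_sum d S A' = 1\<^sub>m d"
proof -
  obtain a0 where a0: "a0 \<in> S" using assms(2) by auto
  define A' where "A' a = (if a = a0 then A a + (1\<^sub>m d - mat_sum d S A) else A a)" for a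
  have 1: "psd d (A' a)" if "a \<in> S" for a using assms that by (auto simp: A'_def intro: psd_add)
  have c: "A a \<in> carrier_mat d d" if "a \<in> S" for a using assms(3)[OF that] by (rule psd_carrier)
  have 2: "psd d (A' a - A a)" if "a \<in> S" for a
  proof (cases "a = a0")
    case True
    have "A a + (1\<^sub>m d - mat_sum d S A) - A a = 1\<^sub>m d - mat_sum d S A"
      using c[OF that] by (intro eq_matI) auto
    thus ?thesis using assms(4) True by (simp add: A'_def)
  next
    case False
    have "A a - A a = 0\<^sub>m d d" using c[OF that] by (intro eq_matI) auto
    thus ?thesis using False psd_zero by (simp add: A'_def)
  qed
  have R: "finite (S - {a0})" "a0 \<notin> S - {a0}" "insert a0 (S - {a0}) = S" using assms a0 by auto
  have c0: "A a0 \<in> carrier_mat d d" using c a0 by simp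
  have D: "1\<^sub>m d - mat_sum d S A \<in> carrier_mat d d" by (simp add: minus_carrier_mat)
  have "mat_sum d S A' = A' a0 + mat_sum d (S - {a0}) A'"
    using mat_sum_insert[OF R(1,2), of A' d] c0 D unfolding R(3) by (simp add: A'_def)
  also have "mat_sum d (S - {a0}) A' = mat_sum d (S - {a0}) A" by (intro mat_sum_cong) (auto simp: A'_def)
  also have "A' a0 = A a0 + (1\<^sub>m d - mat_sum d S A)" by (simp add: A'_def)
  finally have sA': "mat_sum d S A' = (A a0 + (1\<^sub>m d - mat_sum d S A)) + mat_sum d (S - {a0}) A" .
  have sA: "mat_sum d S A = A a0 + mat_sum d (S - {a0}) A"
    using mat_sum_insert[where F = A, OF R(1,2) c0] unfolding R(3) .
  have "mat_sum d S A' = 1\<^sub>m d" unfolding sA' unfolding sA using c0 by (intro eq_matI) auto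
  thus ?thesis using 1 2 by blast
qed

text \<open>Both sides are quadratic in the matrix \<Phi>, so a nonzero \<Phi> may be normalized to
  a unit state. Completing the measurements of both players can only raise the left side, since all
  forms involved are monotone in positive operators.\<close>

lemma game_form_le_entangled_value:
  assumes G: "two_player_game G" and ne: "ansA G \<noteq> {}" "ansB G \<noteq> {}"
    and A: "\<And>x a. x \<in> qX G \<Longrightarrow> a \<in> ansA G \<Longrightarrow> psd d (A x a)"
    and A1: "\<And>x. x \<in> qX G \<Longrightarrow> psd d (1\<^sub>m d - mat_sum d (ansA G) (A x))"
    and B: "\<And>y b. y \<in> qY G \<Longrightarrow> b \<in> ansB G \<Longrightarrow> psd d (B y b)"
    and B1: "\<And>y. y \<in> qY G \<Longrightarrow> psd d (1\<^sub>m d - mat_sum d (ansB G) (B y))"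
    and \<Phi>: "\<Phi> \<in> carrier_mat d d"
  shows "game_form d (qX G) (qY G) (\<lambda>x y. pmf (qdist G) (x, y)) (ansA G) (ansB G) (pred G) A B \<Phi>
    \<le> entangled_value G * hs_inner d \<Phi> \<Phi>"
proof -
  have fin: "finite (ansA G)" "finite (ansB G)" using G by (auto simp: two_player_game_def)
  let ?gf = "\<lambda>A B. game_form d (qX G) (qY G) (\<lambda>x y. pmf (qdist G) (x, y)) (ansA G) (ansB G) (pred G) A B"
  define r where "r = hs_inner d \<Phi> \<Phi>"
  show ?thesis
  proof (cases "r = 0")
    case True
    hence "\<Phi> $$ (i, j) = 0" if "i < d" "j < d" for i j using hs_inner_eq_0[of d \<Phi> i j] True that by (simp add: r_def)
    hence "bip_form d M N \<Phi> = 0" if "M \<in> carrier_mat d d" "N \<in> carrier_mat d d" for M N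
      using that \<Phi> by (simp add: bip_form_expand)
    hence "?gf A B \<Phi> = 0" unfolding game_form_def using A B by (simp add: psd_carrier)
    thus ?thesis using True r_def by simp
  next
    case False
    hence r: "r > 0" using hs_inner_self_nonneg[of d \<Phi>] unfolding r_def by linarith
    have "\<exists>A'. (\<forall>a\<in>ansA G. psd d (A' a) \<and> psd d (A' a - A x a)) \<and> mat_sum d (ansA G) A' = 1\<^sub>m d" if "x \<in> qX G" for x
      using complete_measurement[OF fin(1) ne(1) A A1] that by blast
    then obtain A' where A': "\<And>x a. x \<in> qX G \<Longrightarrow> a \<in> ansA G \<Longrightarrow> psd d (A' x a)"
      "\<And>x. x \<in> qX G \<Longrightarrow> mat_sum d (ansA G) (A' x) = 1\<^sub>m d"
      "\<And>x a. x \<in> qX G \<Longrightarrow> a \<in> ansA G \<Longrightarrow> psd d (A' x a - A x a)" by metis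
    have "\<exists>B'. (\<forall>b\<in>ansB G. psd d (B' b) \<and> psd d (B' b - B y b)) \<and> mat_sum d (ansB G) B' = 1\<^sub>m d" if "y \<in> qY G" for y
      using complete_measurement[OF fin(2) ne(2) B B1] that by blast
    then obtain B' where B': "\<And>y b. y \<in> qY G \<Longrightarrow> b \<in> ansB G \<Longrightarrow> psd d (B' y b)"
      "\<And>y. y \<in> qY G \<Longrightarrow> mat_sum d (ansB G) (B' y) = 1\<^sub>m d"
      "\<And>y b. y \<in> qY G \<Longrightarrow> b \<in> ansB G \<Longrightarrow> psd d (B' y b - B y b)" by metis
    define c where "c = 1 / sqrt r"
    have c2: "c\<^sup>2 = 1 / r" using r by (simp add: c_def power_divide)
    define \<psi> where "\<psi> = Matrix.vec (d * d) (\<lambda>p. complex_of_real c * \<Phi> $$ (p div d, p mod d))"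
    have \<psi>: "\<psi> \<in> carrier_vec (d * d)" by (simp add: \<psi>_def)
    have uv: "unvec d \<psi> = complex_of_real c \<cdot>\<^sub>m \<Phi>"
    proof (rule eq_matI)
      fix i j assume "i < dim_row (complex_of_real c \<cdot>\<^sub>m \<Phi>)" "j < dim_col (complex_of_real c \<cdot>\<^sub>m \<Phi>)"
      hence ij: "i < d" "j < d" using \<Phi> by auto
      have "i * d + j < i * d + d" using ij by simp
      also have "\<dots> = Suc i * d" by simp
      also have "\<dots> \<le> d * d" using ij by (intro mult_right_mono) auto
      finally show "unvec d \<psi> $$ (i, j) = (complex_of_real c \<cdot>\<^sub>m \<Phi>) $$ (i, j)"
        using ij \<Phi> by (simp add: unvec_def \<psi>_def)
    qed (use \<Phi> in \<open>auto simp: unvec_def\<close>)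
    have "hs_inner d (unvec d \<psi>) (unvec d \<psi>) = 1"
      unfolding uv hs_inner_smult_self[OF \<Phi>] using r by (simp add: c2 flip: r_def)
    moreover have "0 \<le> \<psi> \<bullet>c \<psi>" by (rule conjugate_square_ge_0_vec)
    ultimately have \<psi>1: "\<psi> \<bullet>c \<psi> = 1" unfolding hs_inner_unvec[OF \<psi>] by (simp add: complex_eq_iff less_eq_complex_def)
    have lo: "loewner_le d (1\<^sub>m d) (1\<^sub>m d)"
    proof -
      have "1\<^sub>m d - 1\<^sub>m d = (0\<^sub>m d d :: complex mat)" by (intro eq_matI) auto
      thus ?thesis by (simp only: loewner_le_def one_carrier_mat psd_zero simp_thms)
    qed
    have S: "complete_strategy (qX G) (\<lambda>_. ansA G) (qY G) (\<lambda>_. ansB G) d \<psi> A' B'"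
      unfolding complete_strategy_def entangled_substrategy_def
      using \<psi> \<psi>1 A'(1,2) B'(1,2) by (auto simp: lo)
    have bdd: "bdd_above {strategy_value G \<psi> A B | d \<psi> A B.
      complete_strategy (qX G) (\<lambda>_. ansA G) (qY G) (\<lambda>_. ansB G) d \<psi> A B}"
      using complete_strategy_value_le_1[OF G] by (intro bdd_aboveI[of _ 1]) auto
    have "?gf A B \<Phi> \<le> ?gf A' B' \<Phi>"
    proof (rule game_form_mono)
      fix x y a b assume *: "x \<in> qX G" "y \<in> qY G" "a \<in> ansA G" "b \<in> ansB G"
      have "bip_form d (A x a) (B y b) \<Phi> \<le> bip_form d (A' x a) (B y b) \<Phi>"
        using * A A' B \<Phi> by (intro bip_form_mono_left) (auto simp: psd_carrier)
      also have "\<dots> \<le> bip_form d (A' x a) (B' y b) \<Phi>"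
        using * A A' B B' \<Phi> by (intro bip_form_mono_right) (auto simp: psd_carrier)
      finally show "of_bool (pred G a b x y) * bip_form d (A x a) (B y b) \<Phi>
        \<le> of_bool (pred G a b x y) * bip_form d (A' x a) (B' y b) \<Phi>" by (simp add: mult_left_mono)
    qed simp
    also have "?gf A' B' (unvec d \<psi>) = c\<^sup>2 * ?gf A' B' \<Phi>"
      unfolding uv game_form_def sum_distrib_left using A'(1) B'(1) \<Phi>
      by (intro sum.cong refl) (simp add: bip_form_smult_vec psd_carrier sum_distrib_left mult_ac)
    hence "?gf A' B' \<Phi> = r * ?gf A' B' (unvec d \<psi>)" using r by (simp add: c2)
    also have "?gf A' B' (unvec d \<psi>) = strategy_value G \<psi> A' B'"
      using A'(1) B'(1) by (intro strategy_value_eq[OF G \<psi>, symmetric]) (auto simp: psd_carrier)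
    also have "\<dots> \<le> entangled_value G"
      unfolding entangled_value_def using S by (intro cSup_upper bdd) auto
    finally show ?thesis using r by (simp add: r_def mult.commute)
  qed
qed

section \<open>Induced substrategies\<close>

lemma finite_concat_answers:
  assumes "bipartite_graph M" "finite S"
  shows "finite (concat_answers M S x')"
  unfolding concat_answers_def using assms finite_nbrs(2)[OF assms(1)] by (intro finite_PiE) auto

text \<open>Adjacency puts \<open>x\<close> into the domain of every answer map to
  \<open>x'\<close>, so the value at \<open>x\<close> is a genuine answer in \<open>S\<close> and
  grouping by it counts each map once.\<close>

lemma sum_concat_answers:
  assumes "bipartite_graph M" "finite S" "x' \<in> lnbrs M x"
  shows "(\<Sum>a\<in>S. \<Sum>a'\<in>{a' \<in> concat_answers M S x'. a' x = a}. g a') = (\<Sum>a'\<in>concat_answers M S x'. g a')"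
proof (rule sum.group)
  show "(\<lambda>a'. a' x) ` concat_answers M S x' \<subseteq> S"
    using assms(3) by (auto simp: concat_answers_def lnbrs_def rnbrs_def)
qed (use assms finite_concat_answers in auto)

lemma induced_carrier [simp]: "induced d M S A x a \<in> carrier_mat d d"
  by (simp add: induced_def)

lemma induced_total_carrier [simp]: "induced_total d M S A x \<in> carrier_mat d d"
  by (simp add: induced_total_def)

lemma induced_total_eq:
  assumes "bipartite_graph M" "finite S"
  shows "induced_total d M S A x = mat_avg d (lnbrs M x) (\<lambda>x'. mat_sum d (concat_answers M S x') (A x'))"
proof (rule eq_matI)
  fix i j assume "i < dim_row (mat_avg d (lnbrs M x) (\<lambda>x'. mat_sum d (concat_answers M S x') (A x')))"
    "j < dim_col (mat_avg d (lnbrs M x) (\<lambda>x'. mat_sum d (concat_answers M S x') (A x')))"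
  hence ij: "i < d" "j < d" by auto
  have "(\<Sum>a\<in>S. \<Sum>x'\<in>lnbrs M x. \<Sum>a'\<in>{a' \<in> concat_answers M S x'. a' x = a}. A x' a' $$ (i, j))
      = (\<Sum>x'\<in>lnbrs M x. \<Sum>a'\<in>concat_answers M S x'. A x' a' $$ (i, j))"
    by (subst sum.swap) (simp add: sum_concat_answers[OF assms])
  thus "induced_total d M S A x $$ (i, j)
      = mat_avg d (lnbrs M x) (\<lambda>x'. mat_sum d (concat_answers M S x') (A x')) $$ (i, j)"
    using ij by (simp add: induced_total_def induced_def flip: sum_divide_distrib)
qed (auto simp: induced_total_def)

text \<open>The coefficient \<open>c\<close> stands for the winning predicate with the questions and
  the other player's answer fixed; it is what allows the averages over neighbours to be pulled out
  for one player at a time.\<close>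

lemma bip_form_induced:
  assumes M: "bipartite_graph M" and S: "finite S"
    and A: "\<And>x' a'. x' \<in> lverts M \<Longrightarrow> a' \<in> concat_answers M S x' \<Longrightarrow> A x' a' \<in> carrier_mat d d"
    and N: "N \<in> carrier_mat d d" and X: "X \<in> carrier_mat d d"
  shows "(\<Sum>a\<in>S. c a * bip_form d (induced d M S A x a) N X)
    = nbr_avg M (\<lambda>x'. \<Sum>a'\<in>concat_answers M S x'. c (a' x) * bip_form d (A x' a') N X) x"
proof -
  have A': "A x' a' \<in> carrier_mat d d" if "x' \<in> lnbrs M x" "a' \<in> concat_answers M S x'" for x' a'
    using A that finite_nbrs(3)[OF M] by blast
  have "bip_form d (induced d M S A x a) N X
      = (\<Sum>x'\<in>lnbrs M x. \<Sum>a'\<in>{a' \<in> concat_answers M S x'. a' x = a}. bip_form d (A x' a') N X) / real (card (lnbrs M x))" for a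
    unfolding induced_def using A' N X finite_nbrs(1)[OF M] finite_concat_answers[OF M S]
    by (subst bip_form_avg_left) (auto intro!: sum.cong bip_form_sum_left arg_cong2[of _ _ _ _ "(/)"])
  hence "(\<Sum>a\<in>S. c a * bip_form d (induced d M S A x a) N X)
      = (\<Sum>a\<in>S. \<Sum>x'\<in>lnbrs M x. \<Sum>a'\<in>{a' \<in> concat_answers M S x'. a' x = a}. c (a' x) * bip_form d (A x' a') N X) / real (card (lnbrs M x))"
    by (simp add: sum_distrib_left sum_divide_distrib)
  also have "(\<Sum>a\<in>S. \<Sum>x'\<in>lnbrs M x. \<Sum>a'\<in>{a' \<in> concat_answers M S x'. a' x = a}. c (a' x) * bip_form d (A x' a') N X)
      = (\<Sum>x'\<in>lnbrs M x. \<Sum>a'\<in>concat_answers M S x'. c (a' x) * bip_form d (A x' a') N X)"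
    by (subst sum.swap) (intro sum.cong refl sum_concat_answers[OF M S])
  finally show ?thesis by (simp add: nbr_avg_def divide_inverse mult.commute)
qed

text \<open>The reduction to \<open>G\<close>: by linearity in each player's operators, a
  substrategy is worth in the concatenated game what its induced substrategy is worth in
  \<open>G\<close>. Right regularity makes the neighbourhoods finite and nonempty, so the uniform
  distributions on them are plain averages. The second player is treated by transposing the
  state.\<close>

lemma concat_value_eq:
  assumes G: "two_player_game G" and M: "bipartite_graph M" "right_regular M D" "rverts M = qX G"
    and P: "bipartite_graph P" "right_regular P D'" "rverts P = qY G"
    and A: "\<And>x' a'. x' \<in> lverts M \<Longrightarrow> a' \<in> concat_answers M (ansA G) x' \<Longrightarrow> A x' a' \<in> carrier_mat d d"
    and B: "\<And>y' b'. y' \<in> lverts P \<Longrightarrow> b' \<in> concat_answers P (ansB G) y' \<Longrightarrow> B y' b' \<in> carrier_mat d d"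
    and \<psi>: "\<psi> \<in> carrier_vec (d * d)"
  shows "concat_value M G P \<psi> A B = game_form d (qX G) (qY G) (\<lambda>x y. pmf (qdist G) (x, y))
    (ansA G) (ansB G) (pred G) (induced d M (ansA G) A) (induced d P (ansB G) B) (unvec d \<psi>)"
proof -
  have fin: "finite (qX G)" "finite (qY G)" "finite (ansA G)" "finite (ansB G)" "set_pmf (qdist G) \<subseteq> qX G \<times> qY G"
    using G by (auto simp: two_player_game_def)
  let ?CA = "concat_answers M (ansA G)" and ?CB = "concat_answers P (ansB G)" and ?X = "unvec d \<psi>"
  have nbr: "measure_pmf.expectation (pmf_of_set (lnbrs K z)) f = nbr_avg K f z"
    if "bipartite_graph K" "right_regular K E" "z \<in> rverts K" for K :: "('k, 'z) bigraph" and E z and f :: "'k \<Rightarrow> real"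
  proof -
    have "card (lnbrs K z) \<noteq> 0" using that by (simp add: right_regular_def)
    hence "lnbrs K z \<noteq> {}" "finite (lnbrs K z)" by (auto simp: card_eq_0_iff)
    thus ?thesis by (simp add: integral_pmf_of_set nbr_avg_def divide_inverse mult.commute)
  qed
  have "nbr_avg M (\<lambda>x'. nbr_avg P (\<lambda>y'. \<Sum>a'\<in>?CA x'. \<Sum>b'\<in>?CB y'.
           of_bool (pred G (a' x) (b' y) x y) * expval \<psi> (kron (A x' a') (B y' b'))) y) x
     = (\<Sum>a\<in>ansA G. \<Sum>b\<in>ansB G. of_bool (pred G a b x y) *
          bip_form d (induced d M (ansA G) A x a) (induced d P (ansB G) B y b) ?X)" (is "?L = ?R") for x y
  proof -
    have "?R = (\<Sum>b\<in>ansB G. \<Sum>a\<in>ansA G. of_bool (pred G a b x y) *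
          bip_form d (induced d M (ansA G) A x a) (induced d P (ansB G) B y b) ?X)" by (rule sum.swap)
    also have "\<dots> = (\<Sum>b\<in>ansB G. nbr_avg M (\<lambda>x'. \<Sum>a'\<in>?CA x'. of_bool (pred G (a' x) b x y) *
          bip_form d (A x' a') (induced d P (ansB G) B y b) ?X) x)"
      using A by (subst bip_form_induced[OF M(1) fin(3)]) auto
    also have "\<dots> = nbr_avg M (\<lambda>x'. \<Sum>a'\<in>?CA x'. \<Sum>b\<in>ansB G. of_bool (pred G (a' x) b x y) *
          bip_form d (A x' a') (induced d P (ansB G) B y b) ?X) x"
      unfolding nbr_avg_def
      by (subst scaleR_right.sum[symmetric], subst sum.swap, intro arg_cong[of _ _ "(*\<^sub>R) _"] sum.cong refl, rule sum.swap)
    also have "\<dots> = nbr_avg M (\<lambda>x'. \<Sum>a'\<in>?CA x'. nbr_avg P (\<lambda>y'. \<Sum>b'\<in>?CB y'. of_bool (pred G (a' x) (b' y) x y) *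
          bip_form d (A x' a') (B y' b') ?X) y) x"
      unfolding nbr_avg_def[of M]
    proof (intro arg_cong[of _ _ "(*\<^sub>R) _"] sum.cong refl)
      fix x' a' assume "x' \<in> lnbrs M x" "a' \<in> ?CA x'"
      hence Ac: "A x' a' \<in> carrier_mat d d" using A finite_nbrs(3)[OF M(1)] by blast
      have tr: "bip_form d (A x' a') N ?X = bip_form d N (A x' a') ?X\<^sup>T" if "N \<in> carrier_mat d d" for N
        using Ac that by (rule bip_form_transpose) simp
      have "(\<Sum>b\<in>ansB G. of_bool (pred G (a' x) b x y) * bip_form d (A x' a') (induced d P (ansB G) B y b) ?X)
         = (\<Sum>b\<in>ansB G. of_bool (pred G (a' x) b x y) * bip_form d (induced d P (ansB G) B y b) (A x' a') ?X\<^sup>T)"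
        by (simp add: tr)
      also have "\<dots> = nbr_avg P (\<lambda>y'. \<Sum>b'\<in>?CB y'. of_bool (pred G (a' x) (b' y) x y) * bip_form d (B y' b') (A x' a') ?X\<^sup>T) y"
        using B Ac by (intro bip_form_induced[OF P(1) fin(4)]) auto
      also have "\<dots> = nbr_avg P (\<lambda>y'. \<Sum>b'\<in>?CB y'. of_bool (pred G (a' x) (b' y) x y) * bip_form d (A x' a') (B y' b') ?X) y"
        unfolding nbr_avg_def using B finite_nbrs(3)[OF P(1)]
        by (intro arg_cong[of _ _ "(*\<^sub>R) _"] sum.cong refl) (subst tr, auto)
      finally show "(\<Sum>b\<in>ansB G. of_bool (pred G (a' x) b x y) * bip_form d (A x' a') (induced d P (ansB G) B y b) ?X)
        = nbr_avg P (\<lambda>y'. \<Sum>b'\<in>?CB y'. of_bool (pred G (a' x) (b' y) x y) * bip_form d (A x' a') (B y' b') ?X) y" .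
    qed
    also have "\<dots> = nbr_avg M (\<lambda>x'. nbr_avg P (\<lambda>y'. \<Sum>a'\<in>?CA x'. \<Sum>b'\<in>?CB y'. of_bool (pred G (a' x) (b' y) x y) *
          bip_form d (A x' a') (B y' b') ?X) y) x"
      unfolding nbr_avg_def
      by (intro arg_cong[of _ _ "(*\<^sub>R) _"] sum.cong refl, subst scaleR_right.sum[symmetric], subst sum.swap, rule refl)
    also have "\<dots> = ?L"
      unfolding nbr_avg_def
    proof (intro arg_cong[of _ _ "(*\<^sub>R) _"] sum.cong refl)
      fix x' y' a' b' assume "x' \<in> lnbrs M x" "y' \<in> lnbrs P y" "a' \<in> ?CA x'" "b' \<in> ?CB y'"
      hence "A x' a' \<in> carrier_mat d d" "B y' b' \<in> carrier_mat d d"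
        using A B finite_nbrs(3)[OF M(1)] finite_nbrs(3)[OF P(1)] by blast+
      thus "of_bool (pred G (a' x) (b' y) x y) * bip_form d (A x' a') (B y' b') ?X
        = of_bool (pred G (a' x) (b' y) x y) * expval \<psi> (kron (A x' a') (B y' b'))"
        by (simp add: expval_kron[OF _ _ \<psi>])
    qed
    finally show ?thesis by simp
  qed
  thus ?thesis
    unfolding concat_value_def game_form_def using M P
    by (subst expectation_pair[OF fin(1,2,5)])
      (intro sum.cong refl, simp add: nbr[OF M(1,2)] nbr[OF P(1,2)])
qed

lemma sum_swap3: "(\<Sum>i\<in>I. \<Sum>j\<in>J. \<Sum>k\<in>K. g i j k) = (\<Sum>k\<in>K. \<Sum>i\<in>I. \<Sum>j\<in>J. g i j k)"
proof -
  have "(\<Sum>i\<in>I. \<Sum>j\<in>J. \<Sum>k\<in>K. g i j k) = (\<Sum>i\<in>I. \<Sum>k\<in>K. \<Sum>j\<in>J. g i j k)"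
    by (intro sum.cong refl sum.swap)
  thus ?thesis by (subst sum.swap)
qed

text \<open>For the last claim the scalar expander bound is summed over the matrix entries of the
  totals applied to \<Theta>. Both of its sides are sums of squares, so they become Hilbert-Schmidt
  norms and no factor depending on \<open>d\<close> appears; the totals at left vertices are
  contractions, which bounds the right side by the norm of \<Theta>.\<close>

lemma induced_properties:
  assumes M: "bipartite_graph M" and D: "right_regular M D"
    and sv: "second_singular_value (normalized_adjacency M D) \<le> s" "0 \<le> s" "s < 1"
    and S: "finite S" and ne: "rverts M \<noteq> {}"
    and A: "\<And>x' a'. x' \<in> lverts M \<Longrightarrow> a' \<in> concat_answers M S x' \<Longrightarrow> psd d (A x' a')"
    and A1: "\<And>x'. x' \<in> lverts M \<Longrightarrow> loewner_le d (mat_sum d (concat_answers M S x') (A x')) (1\<^sub>m d)"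
  defines "A0 \<equiv> mat_avg d (rverts M) (induced_total d M S A)"
  shows "\<And>x a. psd d (induced d M S A x a)"
    and "\<And>x. psd d (induced_total d M S A x)"
    and "\<And>x. x \<in> rverts M \<Longrightarrow> psd d (1\<^sub>m d - induced_total d M S A x)"
    and "psd d A0" and "psd d (1\<^sub>m d - A0)"
    and "\<And>\<Theta>. \<Theta> \<in> carrier_mat d d \<Longrightarrow>
      (\<Sum>x\<in>rverts M. hs_inner d ((induced_total d M S A x - A0) * \<Theta>) ((induced_total d M S A x - A0) * \<Theta>)) / real (card (rverts M))
      \<le> s\<^sup>2 * hs_inner d \<Theta> \<Theta>"
proof -
  have fin: "finite (rverts M)" using M by (simp add: bipartite_graph_def)
  note fn = finite_nbrs[OF M] and fc = finite_concat_answers[OF M S]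
  have lv: "x' \<in> lverts M" if "x' \<in> lnbrs M x" for x x' using fn(3) that by blast
  have nn: "card (lnbrs M x) \<noteq> 0" if "x \<in> rverts M" for x using D that by (simp add: right_regular_def)
  define T where "T x' = mat_sum d (concat_answers M S x') (A x')" for x'
  have Tc: "T x' \<in> carrier_mat d d" for x' by (simp add: T_def)
  have Tp: "psd d (T x')" if "x' \<in> lverts M" for x' unfolding T_def using fc A that by (intro psd_mat_sum)
  have T1: "psd d (1\<^sub>m d - T x')" if "x' \<in> lverts M" for x' using A1[OF that] by (simp add: loewner_le_def T_def)
  have tot: "induced_total d M S A x = mat_avg d (lnbrs M x) T" for x
    unfolding induced_total_eq[OF M S] T_def ..
  show "psd d (induced d M S A x a)" for x a
    unfolding induced_def using fn fc A lv by (intro psd_mat_avg psd_mat_sum) auto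
  show tp: "psd d (induced_total d M S A x)" for x
    unfolding tot using fn Tp lv by (intro psd_mat_avg) auto
  show t1: "psd d (1\<^sub>m d - induced_total d M S A x)" if "x \<in> rverts M" for x
    unfolding tot using fn T1 lv Tc nn[OF that] by (intro psd_one_minus_mat_avg) auto
  show "psd d A0" unfolding A0_def using fin tp by (intro psd_mat_avg)
  show "psd d (1\<^sub>m d - A0)" unfolding A0_def using fin ne t1 by (intro psd_one_minus_mat_avg) auto
  fix \<Theta> :: "complex mat" assume \<Theta>: "\<Theta> \<in> carrier_mat d d"
  have A0c: "A0 \<in> carrier_mat d d" by (simp add: A0_def)
  have n: "real (card (rverts M)) > 0" using fin ne by (simp add: card_gt_0_iff)
  define f where "f i j x' = (T x' * \<Theta>) $$ (i, j)" for i j x'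
  have ent: "(induced_total d M S A x * \<Theta>) $$ (i, j) = nbr_avg M (f i j) x" if "i < d" "j < d" for x i j
    unfolding tot f_def nbr_avg_def using Tc \<Theta> that
    by (subst mat_avg_mult_index) (auto simp: scaleR_conv_of_real divide_inverse mult.commute)
  have ent0: "(A0 * \<Theta>) $$ (i, j) = (\<Sum>x\<in>rverts M. nbr_avg M (f i j) x) / of_nat (card (rverts M))" if "i < d" "j < d" for i j
    unfolding A0_def using \<Theta> that by (subst mat_avg_mult_index) (auto simp: ent)
  have dev: "(\<Sum>x\<in>rverts M. (cmod (nbr_avg M (f i j) x - (A0 * \<Theta>) $$ (i, j)))\<^sup>2)
     \<le> s\<^sup>2 * (\<Sum>x\<in>rverts M. nbr_avg M (\<lambda>x'. (cmod (f i j x'))\<^sup>2) x)" if "i < d" "j < d" for i j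
    using n by (intro expander_deviation[OF M D sv]) (simp add: ent0[OF that])
  have "(\<Sum>x\<in>rverts M. hs_inner d ((induced_total d M S A x - A0) * \<Theta>) ((induced_total d M S A x - A0) * \<Theta>))
     = (\<Sum>x\<in>rverts M. \<Sum>i<d. \<Sum>j<d. (cmod (nbr_avg M (f i j) x - (A0 * \<Theta>) $$ (i, j)))\<^sup>2)"
  proof (intro sum.cong refl)
    fix x
    have eq: "(induced_total d M S A x - A0) * \<Theta> = induced_total d M S A x * \<Theta> - A0 * \<Theta>"
      using A0c \<Theta> by (intro minus_mult_distrib_mat) auto
    have "((induced_total d M S A x - A0) * \<Theta>) $$ (i, j) = nbr_avg M (f i j) x - (A0 * \<Theta>) $$ (i, j)" if "i < d" "j < d" for i j
      unfolding eq using ent[OF that, of x] A0c \<Theta> that by (subst index_minus_mat) (auto simp del: index_mult_mat(1))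
    thus "hs_inner d ((induced_total d M S A x - A0) * \<Theta>) ((induced_total d M S A x - A0) * \<Theta>)
      = (\<Sum>i<d. \<Sum>j<d. (cmod (nbr_avg M (f i j) x - (A0 * \<Theta>) $$ (i, j)))\<^sup>2)"
      unfolding hs_inner_self by (intro sum.cong refl) (simp del: index_mult_mat(1))
  qed
  also have "\<dots> = (\<Sum>i<d. \<Sum>j<d. \<Sum>x\<in>rverts M. (cmod (nbr_avg M (f i j) x - (A0 * \<Theta>) $$ (i, j)))\<^sup>2)"
    by (subst sum.swap) (intro sum.cong refl sum.swap)
  also have "\<dots> \<le> (\<Sum>i<d. \<Sum>j<d. s\<^sup>2 * (\<Sum>x\<in>rverts M. nbr_avg M (\<lambda>x'. (cmod (f i j x'))\<^sup>2) x))"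
    by (intro sum_mono dev) auto
  also have "\<dots> = s\<^sup>2 * (\<Sum>i<d. \<Sum>j<d. \<Sum>x\<in>rverts M. nbr_avg M (\<lambda>x'. (cmod (f i j x'))\<^sup>2) x)"
    by (simp add: sum_distrib_left)
  also have "(\<Sum>i<d. \<Sum>j<d. \<Sum>x\<in>rverts M. nbr_avg M (\<lambda>x'. (cmod (f i j x'))\<^sup>2) x)
     = (\<Sum>x\<in>rverts M. \<Sum>i<d. \<Sum>j<d. nbr_avg M (\<lambda>x'. (cmod (f i j x'))\<^sup>2) x)"
    by (rule sum_swap3)
  also have "\<dots> = (\<Sum>x\<in>rverts M. nbr_avg M (\<lambda>x'. hs_inner d (T x' * \<Theta>) (T x' * \<Theta>)) x)"
  proof (intro sum.cong refl)
    fix x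
    have "(\<Sum>i<d. \<Sum>j<d. \<Sum>x'\<in>lnbrs M x. (cmod (f i j x'))\<^sup>2) = (\<Sum>x'\<in>lnbrs M x. \<Sum>i<d. \<Sum>j<d. (cmod (f i j x'))\<^sup>2)"
      by (rule sum_swap3)
    thus "(\<Sum>i<d. \<Sum>j<d. nbr_avg M (\<lambda>x'. (cmod (f i j x'))\<^sup>2) x) = nbr_avg M (\<lambda>x'. hs_inner d (T x' * \<Theta>) (T x' * \<Theta>)) x"
      by (simp add: nbr_avg_def hs_inner_self f_def flip: sum_distrib_left)
  qed
  also have "\<dots> \<le> (\<Sum>x\<in>rverts M. hs_inner d \<Theta> \<Theta>)"
  proof (intro sum_mono)
    fix x assume x: "x \<in> rverts M"
    have "(\<Sum>x'\<in>lnbrs M x. hs_inner d (T x' * \<Theta>) (T x' * \<Theta>)) \<le> (\<Sum>x'\<in>lnbrs M x. hs_inner d \<Theta> \<Theta>)"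
      using lv Tp T1 \<Theta> by (intro sum_mono hs_inner_contraction) auto
    thus "nbr_avg M (\<lambda>x'. hs_inner d (T x' * \<Theta>) (T x' * \<Theta>)) x \<le> hs_inner d \<Theta> \<Theta>"
      using nn[OF x] by (simp add: nbr_avg_def field_simps)
  qed
  finally have "(\<Sum>x\<in>rverts M. hs_inner d ((induced_total d M S A x - A0) * \<Theta>) ((induced_total d M S A x - A0) * \<Theta>))
    \<le> s\<^sup>2 * (real (card (rverts M)) * hs_inner d \<Theta> \<Theta>)" by (simp add: mult_left_mono)
  thus "(\<Sum>x\<in>rverts M. hs_inner d ((induced_total d M S A x - A0) * \<Theta>) ((induced_total d M S A x - A0) * \<Theta>)) / real (card (rverts M))
      \<le> s\<^sup>2 * hs_inner d \<Theta> \<Theta>"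
    using n by (simp add: field_simps)
qed

section \<open>The value of a concatenated game\<close>

lemma bip_form_diff_right:
  assumes "M \<in> carrier_mat d d" "N \<in> carrier_mat d d" "N' \<in> carrier_mat d d" "X \<in> carrier_mat d d"
  shows "bip_form d M (N - N') X = bip_form d M N X - bip_form d M N' X"
  using assms bip_form_diff_left[of N d N' M "X\<^sup>T"]
  by (simp add: bip_form_transpose[of M d _ X] minus_carrier_mat)

lemma weighted_sum_fst:
  fixes w :: "'x \<Rightarrow> 'y \<Rightarrow> real"
  assumes "\<And>x. x \<in> X \<Longrightarrow> (\<Sum>y\<in>Y. w x y) = 1 / real (card X)"
  shows "(\<Sum>x\<in>X. \<Sum>y\<in>Y. w x y * g x) = (\<Sum>x\<in>X. g x) / real (card X)"
proof -
  have "(\<Sum>x\<in>X. \<Sum>y\<in>Y. w x y * g x) = (\<Sum>x\<in>X. (\<Sum>y\<in>Y. w x y) * g x)" by (simp add: sum_distrib_right)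
  also have "\<dots> = (\<Sum>x\<in>X. g x) / real (card X)" by (simp add: assms sum_divide_distrib)
  finally show ?thesis .
qed

lemma weighted_sum_snd:
  fixes w :: "'x \<Rightarrow> 'y \<Rightarrow> real"
  assumes "\<And>y. y \<in> Y \<Longrightarrow> (\<Sum>x\<in>X. w x y) = 1 / real (card Y)"
  shows "(\<Sum>x\<in>X. \<Sum>y\<in>Y. w x y * g y) = (\<Sum>y\<in>Y. g y) / real (card Y)"
  by (subst sum.swap) (rule weighted_sum_fst[OF assms])

text \<open>The two questions may be correlated, so the averaged product is not the product of the
  means. In the expansion around the means the terms with one deviation depend on a single question
  and vanish by the uniform marginals. The term with two deviations is a covariance, bounded below
  through the two spreads.\<close>

lemma mean_form_le:
  fixes w :: "'x \<Rightarrow> 'y \<Rightarrow> real"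
  assumes fin: "finite X" "finite Y" and w0: "\<And>x y. 0 \<le> w x y" and w1: "(\<Sum>x\<in>X. \<Sum>y\<in>Y. w x y) = 1"
    and mX: "\<And>x. x \<in> X \<Longrightarrow> (\<Sum>y\<in>Y. w x y) = 1 / real (card X)"
    and mY: "\<And>y. y \<in> Y \<Longrightarrow> (\<Sum>x\<in>X. w x y) = 1 / real (card Y)"
    and T: "\<And>x. psd d (T x)" and U: "\<And>y. psd d (U y)"
    and A0: "A0 = mat_avg d X T" and B0: "B0 = mat_avg d Y U"
    and sX: "\<And>\<Theta>. \<Theta> \<in> carrier_mat d d \<Longrightarrow>
      (\<Sum>x\<in>X. hs_inner d ((T x - A0) * \<Theta>) ((T x - A0) * \<Theta>)) / real (card X) \<le> s\<^sup>2 * hs_inner d \<Theta> \<Theta>"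
    and sY: "\<And>\<Theta>. \<Theta> \<in> carrier_mat d d \<Longrightarrow>
      (\<Sum>y\<in>Y. hs_inner d ((U y - B0) * \<Theta>) ((U y - B0) * \<Theta>)) / real (card Y) \<le> s\<^sup>2 * hs_inner d \<Theta> \<Theta>"
    and X: "\<Psi> \<in> carrier_mat d d"
  shows "bip_form d A0 B0 \<Psi> \<le> (\<Sum>x\<in>X. \<Sum>y\<in>Y. w x y * bip_form d (T x) (U y) \<Psi>) + s\<^sup>2 * hs_inner d \<Psi> \<Psi>"
proof -
  have Tc: "T x \<in> carrier_mat d d" and Uc: "U y \<in> carrier_mat d d" for x y using T U by (auto dest: psd_carrier)
  have c0: "A0 \<in> carrier_mat d d" "B0 \<in> carrier_mat d d" by (simp_all add: A0 B0)
  have "psd d B0" unfolding B0 using fin U by (intro psd_mat_avg)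
  hence Uh: "mat_adjoint (U y - B0) = U y - B0" for y
    using Uc c0 psd_hermitian[OF U] psd_hermitian[of d B0] by (simp add: mat_adjoint_minus[of _ d d])
  let ?a = "\<lambda>x. hs_inner d ((T x - A0) * \<Psi>) ((T x - A0) * \<Psi>)"
  let ?b = "\<lambda>y. hs_inner d ((U y - B0) * \<Psi>\<^sup>T) ((U y - B0) * \<Psi>\<^sup>T)"
  have fst: "(\<Sum>x\<in>X. \<Sum>y\<in>Y. w x y * g x) = (\<Sum>x\<in>X. g x) / real (card X)" for g
    by (rule weighted_sum_fst) (rule mX)
  have snd: "(\<Sum>x\<in>X. \<Sum>y\<in>Y. w x y * g y) = (\<Sum>y\<in>Y. g y) / real (card Y)" for g
    by (rule weighted_sum_snd) (rule mY)
  have exp: "bip_form d (T x) (U y) \<Psi> = bip_form d (T x - A0) (U y - B0) \<Psi>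
      + bip_form d (T x) B0 \<Psi> + bip_form d A0 (U y) \<Psi> - bip_form d A0 B0 \<Psi>" for x y
    using Tc Uc c0 X by (simp add: bip_form_diff_left bip_form_diff_right minus_carrier_mat)
  have low: "- (?a x + ?b y) / 2 \<le> bip_form d (T x - A0) (U y - B0) \<Psi>" for x y
    using c0 X Uh by (intro bip_form_product_lower) (auto simp: minus_carrier_mat)
  define Sa Sb S where "Sa = (\<Sum>x\<in>X. \<Sum>y\<in>Y. w x y * ?a x)" and "Sb = (\<Sum>x\<in>X. \<Sum>y\<in>Y. w x y * ?b y)"
    and "S = (\<Sum>x\<in>X. \<Sum>y\<in>Y. w x y * bip_form d (T x - A0) (U y - B0) \<Psi>)"
  have "(\<Sum>x\<in>X. \<Sum>y\<in>Y. w x y * (- (?a x + ?b y) / 2)) \<le> S"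
    unfolding S_def by (intro sum_mono mult_left_mono low w0)
  moreover have "(\<Sum>x\<in>X. \<Sum>y\<in>Y. w x y * (- (?a x + ?b y) / 2))
      = - (Sa + Sb) / 2"
  proof -
    have "w x y * (- (?a x + ?b y) / 2) = (- 1 / 2) * (w x y * ?a x) + (- 1 / 2) * (w x y * ?b y)" for x y
      by (simp add: field_simps)
    thus ?thesis by (simp only: sum.distrib sum_distrib_left[symmetric] Sa_def Sb_def) simp
  qed
  moreover have "Sa \<le> s\<^sup>2 * hs_inner d \<Psi> \<Psi>"
    unfolding Sa_def fst by (rule sX[OF X])
  moreover have "Sb \<le> s\<^sup>2 * hs_inner d \<Psi> \<Psi>"
    unfolding Sb_def snd using sY[of "\<Psi>\<^sup>T"] X by (simp add: hs_inner_transpose)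
  ultimately have "- (s\<^sup>2 * hs_inner d \<Psi> \<Psi>) \<le> S" by simp
  moreover have "(\<Sum>x\<in>X. \<Sum>y\<in>Y. w x y * bip_form d (T x) B0 \<Psi>) = bip_form d A0 B0 \<Psi>"
    unfolding fst unfolding A0 using fin Tc c0 X by (subst bip_form_avg_left) auto
  moreover have "(\<Sum>x\<in>X. \<Sum>y\<in>Y. w x y * bip_form d A0 (U y) \<Psi>) = bip_form d A0 B0 \<Psi>"
    unfolding snd unfolding B0 using fin Uc c0 X by (subst bip_form_avg_right) auto
  moreover have "(\<Sum>x\<in>X. \<Sum>y\<in>Y. w x y * bip_form d A0 B0 \<Psi>) = bip_form d A0 B0 \<Psi>"
    using w1 by (simp flip: sum_distrib_right)
  moreover have "(\<Sum>x\<in>X. \<Sum>y\<in>Y. w x y * bip_form d (T x) (U y) \<Psi>)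
      = S + (\<Sum>x\<in>X. \<Sum>y\<in>Y. w x y * bip_form d (T x) B0 \<Psi>) + (\<Sum>x\<in>X. \<Sum>y\<in>Y. w x y * bip_form d A0 (U y) \<Psi>)
      - (\<Sum>x\<in>X. \<Sum>y\<in>Y. w x y * bip_form d A0 B0 \<Psi>)"
    unfolding S_def by (subst exp) (simp add: distrib_left right_diff_distrib sum.distrib sum_subtractf)
  ultimately show ?thesis by linarith
qed

text \<open>Of the terms of the expansion, the two mixed ones cost at most \<open>s\<close> times
  the squared norm each, since \<open>M\<close> and \<open>N\<close> are at most 1, and the last one
  costs s^2 times it.\<close>

lemma bip_form_shift:
  assumes "psd d M" "psd d (1\<^sub>m d - M)" "psd d N" "psd d (1\<^sub>m d - N)" "X \<in> carrier_mat d d" "0 \<le> s"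
  shows "bip_form d (M + complex_of_real s \<cdot>\<^sub>m 1\<^sub>m d) (N + complex_of_real s \<cdot>\<^sub>m 1\<^sub>m d) X
    \<le> bip_form d M N X + (2 * s + s\<^sup>2) * hs_inner d X X"
proof -
  have c: "M \<in> carrier_mat d d" "N \<in> carrier_mat d d" using assms by (auto dest: psd_carrier)
  have left: "bip_form d (K + complex_of_real s \<cdot>\<^sub>m 1\<^sub>m d) K' Y = bip_form d K K' Y + s * bip_form d (1\<^sub>m d) K' Y"
    if "K \<in> carrier_mat d d" "K' \<in> carrier_mat d d" "Y \<in> carrier_mat d d" for K K' Y
    using that by (simp add: bip_form_add_left bip_form_smult_left)
  have right: "bip_form d K (K' + complex_of_real s \<cdot>\<^sub>m 1\<^sub>m d) Y = bip_form d K K' Y + s * bip_form d K (1\<^sub>m d) Y"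
    if "K \<in> carrier_mat d d" "K' \<in> carrier_mat d d" "Y \<in> carrier_mat d d" for K K' Y
    using left[of K' K "Y\<^sup>T"] that by (simp add: bip_form_transpose[of K d _ Y])
  have o: "psd d (1\<^sub>m d - 1\<^sub>m d)"
  proof -
    have "1\<^sub>m d - 1\<^sub>m d = (0\<^sub>m d d :: complex mat)" by (intro eq_matI) auto
    thus ?thesis by (simp only: psd_zero)
  qed
  have "bip_form d (M + complex_of_real s \<cdot>\<^sub>m 1\<^sub>m d) (N + complex_of_real s \<cdot>\<^sub>m 1\<^sub>m d) X
    = bip_form d M N X + s * bip_form d M (1\<^sub>m d) X + s * bip_form d (1\<^sub>m d) N X + s\<^sup>2 * hs_inner d X X"
    using c assms(5) by (simp add: left right bip_form_one power2_eq_square algebra_simps)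
  moreover have "s * bip_form d M (1\<^sub>m d) X \<le> s * hs_inner d X X"
    using assms o by (intro mult_left_mono bip_form_le_hs_inner psd_one)
  moreover have "s * bip_form d (1\<^sub>m d) N X \<le> s * hs_inner d X X"
    using assms o by (intro mult_left_mono bip_form_le_hs_inner psd_one)
  ultimately show ?thesis by (simp add: algebra_simps)
qed

text \<open>\<open>s\<close> and \<open>t\<close> stay free because vanishing \<epsilon> or \<delta>
  calls for another choice than the generic case. In W + 2 s + 2 s^2 the part 2 s + s^2 comes from
  shifting both means and the other s^2 from the correlation of the questions. The factor 1 + s
  bounds the squared norm of \<open>L * \<Psi>\<close>, the state on which the second replacement
  acts.\<close>

lemma concat_value_bound:
  fixes G :: "('x, 'y, 'a, 'b) game" and M :: "('x1, 'x) bigraph" and P :: "('y1, 'y) bigraph"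
  assumes G: "two_player_game G" "biregular G" and ne: "ansA G \<noteq> {}" "ansB G \<noteq> {}"
    and M: "bipartite_graph M" "right_regular M D" "rverts M = qX G"
      "second_singular_value (normalized_adjacency M D) \<le> s"
    and P: "bipartite_graph P" "right_regular P D'" "rverts P = qY G"
      "second_singular_value (normalized_adjacency P D') \<le> s"
    and s: "0 < s" "s < 1"
    and sub: "concat_substrategy M G P d \<psi> A B"
  defines "W \<equiv> measure_pmf.expectation (qdist G) (\<lambda>(x, y). expval \<psi>
            (kron (induced_total d M (ansA G) A x) (induced_total d P (ansB G) B y)))"
  shows "0 \<le> W" "W \<le> 1" "0 \<le> entangled_value G" "entangled_value G \<le> 1"
    and "\<And>t. 0 < t \<Longrightarrow> concat_value M G P \<psi> A B
      \<le> (1 + t)\<^sup>2 * (entangled_value G * (W + 2 * s + 2 * s\<^sup>2)) + (1 + 1 / t) * (s / 2) * (1 + (1 + t) * (1 + s))"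
proof -
  have fin: "finite (qX G)" "finite (qY G)" "finite (ansA G)" "finite (ansB G)" "set_pmf (qdist G) \<subseteq> qX G \<times> qY G"
    using G by (auto simp: two_player_game_def)
  note mw = marginal_weights[OF G]
  define w where "w x y = pmf (qdist G) (x, y)" for x y
  have w0: "0 \<le> w x y" for x y by (simp add: w_def)
  have w1: "(\<Sum>x\<in>qX G. \<Sum>y\<in>qY G. w x y) = 1"
    using expectation_pair[OF fin(1,2,5), of "\<lambda>_ _. 1"] by (simp add: case_prod_unfold w_def)
  have mX: "(\<Sum>y\<in>qY G. w x y) = 1 / real (card (qX G))" if "x \<in> qX G" for x using mw(3)[OF that] by (simp add: w_def)
  have mY: "(\<Sum>x\<in>qX G. w x y) = 1 / real (card (qY G))" if "y \<in> qY G" for y using mw(4)[OF that] by (simp add: w_def)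
  have \<psi>: "\<psi> \<in> carrier_vec (d * d)" "\<psi> \<bullet>c \<psi> = 1"
    and Ap: "\<And>x' a'. x' \<in> lverts M \<Longrightarrow> a' \<in> concat_answers M (ansA G) x' \<Longrightarrow> psd d (A x' a')"
    and A1: "\<And>x'. x' \<in> lverts M \<Longrightarrow> loewner_le d (mat_sum d (concat_answers M (ansA G) x') (A x')) (1\<^sub>m d)"
    and Bp: "\<And>y' b'. y' \<in> lverts P \<Longrightarrow> b' \<in> concat_answers P (ansB G) y' \<Longrightarrow> psd d (B y' b')"
    and B1: "\<And>y'. y' \<in> lverts P \<Longrightarrow> loewner_le d (mat_sum d (concat_answers P (ansB G) y') (B y')) (1\<^sub>m d)"
    using sub by (auto simp: concat_substrategy_def entangled_substrategy_def)
  define \<Psi> where "\<Psi> = unvec d \<psi>"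
  have \<Psi>: "\<Psi> \<in> carrier_mat d d" by (simp add: \<Psi>_def)
  have \<Psi>1: "hs_inner d \<Psi> \<Psi> = 1" unfolding \<Psi>_def hs_inner_unvec[OF \<psi>(1)] \<psi>(2) by simp
  define IA IB where "IA = induced d M (ansA G) A" and "IB = induced d P (ansB G) B"
  define T U where "T = induced_total d M (ansA G) A" and "U = induced_total d P (ansB G) B"
  have TI: "T x = mat_sum d (ansA G) (IA x)" for x by (simp add: T_def IA_def induced_total_def)
  have UI: "U y = mat_sum d (ansB G) (IB y)" for y by (simp add: U_def IB_def induced_total_def)
  define A0 B0 where "A0 = mat_avg d (qX G) T" and "B0 = mat_avg d (qY G) U"
  note iA = induced_properties[OF M(1,2,4) less_imp_le[OF s(1)] s(2) fin(3) _ Ap A1,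
      unfolded M(3), OF mw(1), folded IA_def T_def A0_def]
  note iB = induced_properties[OF P(1,2,4) less_imp_le[OF s(1)] s(2) fin(4) _ Bp B1,
      unfolded P(3), OF mw(2), folded IB_def U_def B0_def]
  have Wsum: "W = (\<Sum>x\<in>qX G. \<Sum>y\<in>qY G. w x y * bip_form d (T x) (U y) \<Psi>)"
    unfolding W_def w_def \<Psi>_def T_def U_def by (subst expectation_pair[OF fin(1,2,5)]) (simp add: expval_kron[OF _ _ \<psi>(1)])
  show W0: "0 \<le> W"
    unfolding Wsum using w0 iA(2) iB(2) \<Psi> by (intro sum_nonneg mult_nonneg_nonneg bip_form_nonneg)
  have "W \<le> (\<Sum>x\<in>qX G. \<Sum>y\<in>qY G. w x y * 1)"
    unfolding Wsum using bip_form_le_hs_inner[OF iA(2) iA(3) iB(2) iB(3) \<Psi>] \<Psi>1 w0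
    by (intro sum_mono mult_left_mono) auto
  thus "W \<le> 1" using w1 by simp
  let ?gf = "game_form d (qX G) (qY G) w (ansA G) (ansB G) (pred G)"
  let ?v = "entangled_value G"
  have val: "?gf A' B' \<Phi> \<le> ?v * hs_inner d \<Phi> \<Phi>"
    if "\<And>x a. x \<in> qX G \<Longrightarrow> a \<in> ansA G \<Longrightarrow> psd d (A' x a)" "\<And>x. x \<in> qX G \<Longrightarrow> psd d (1\<^sub>m d - mat_sum d (ansA G) (A' x))"
      "\<And>y b. y \<in> qY G \<Longrightarrow> b \<in> ansB G \<Longrightarrow> psd d (B' y b)" "\<And>y. y \<in> qY G \<Longrightarrow> psd d (1\<^sub>m d - mat_sum d (ansB G) (B' y))"
      "\<Phi> \<in> carrier_mat d d" for A' B' \<Phi>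
    unfolding w_def by (rule game_form_le_entangled_value[OF G(1) ne that])
  have "0 \<le> ?gf IA IB \<Psi>"
    unfolding game_form_def using w0 iA(1) iB(1) \<Psi>
    by (intro sum_nonneg mult_nonneg_nonneg bip_form_nonneg) auto
  also have "\<dots> \<le> ?v * hs_inner d \<Psi> \<Psi>"
    using iA(1,3) iB(1,3) \<Psi> by (intro val) (auto simp: TI UI)
  finally show v0: "0 \<le> ?v" using \<Psi>1 by simp
  \<comment> \<open>Bounding a supremum from above needs a nonempty set. A complete strategy is
    obtained by completing the zero measurement and keeping the state of the given
    substrategy.\<close>
  show v1: "?v \<le> 1"
    unfolding entangled_value_def
  proof (rule cSup_least)
    obtain a0 b0 where ab0: "a0 \<in> ansA G" "b0 \<in> ansB G" using ne by auto
    have zero: "psd d (1\<^sub>m d - mat_sum d S (\<lambda>_. 0\<^sub>m d d))" for S :: "'z set"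
    proof -
      have "1\<^sub>m d - mat_sum d S (\<lambda>_. 0\<^sub>m d d) = (1\<^sub>m d :: complex mat)" by (intro eq_matI) auto
      thus ?thesis using psd_one by simp
    qed
    obtain A' where A': "\<forall>a\<in>ansA G. psd d (A' a)" "mat_sum d (ansA G) A' = 1\<^sub>m d"
      using complete_measurement[OF fin(3) ne(1) psd_zero zero] by blast
    obtain B' where B': "\<forall>b\<in>ansB G. psd d (B' b)" "mat_sum d (ansB G) B' = 1\<^sub>m d"
      using complete_measurement[OF fin(4) ne(2) psd_zero zero] by blast
    have "1\<^sub>m d - 1\<^sub>m d = (0\<^sub>m d d :: complex mat)" by (intro eq_matI) auto
    hence lo: "loewner_le d (1\<^sub>m d) (1\<^sub>m d)" by (simp only: loewner_le_def one_carrier_mat psd_zero simp_thms)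
    have "complete_strategy (qX G) (\<lambda>_. ansA G) (qY G) (\<lambda>_. ansB G) d \<psi> (\<lambda>_. A') (\<lambda>_. B')"
      unfolding complete_strategy_def entangled_substrategy_def using \<psi> A' B' lo by auto
    thus "{strategy_value G \<psi> A B | d \<psi> A B. complete_strategy (qX G) (\<lambda>_. ansA G) (qY G) (\<lambda>_. ansB G) d \<psi> A B} \<noteq> {}"
      by blast
  qed (use complete_strategy_value_le_1[OF G(1)] in auto)
  fix t :: real assume t: "0 < t"
  obtain L A' where L: "L \<in> carrier_mat d d" "mat_adjoint L = L" "L * L = A0 + complex_of_real s \<cdot>\<^sub>m 1\<^sub>m d"
    and A': "\<And>x a. x \<in> qX G \<Longrightarrow> a \<in> ansA G \<Longrightarrow> psd d (A' x a)"
      "\<And>x. x \<in> qX G \<Longrightarrow> psd d (1\<^sub>m d - mat_sum d (ansA G) (A' x))"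
    and stepA: "\<And>\<Psi> t. \<Psi> \<in> carrier_mat d d \<Longrightarrow> 0 < t \<Longrightarrow> ?gf IA IB \<Psi>
      \<le> (1 + t) * ?gf A' IB (L * \<Psi>) + (1 + 1 / t) * (s / 2) * hs_inner d \<Psi> \<Psi>"
  proof (rule substrategy_replacement[where X = "qX G" and Y = "qY G" and SA = "ansA G" and SB = "ansB G"
        and A = IA and B = IB and Am = A0 and w = w and V = "pred G" and s = s and d = d])
    show "A0 = mat_avg d (qX G) (\<lambda>x. mat_sum d (ansA G) (IA x))"
      unfolding A0_def by (rule arg_cong[of _ _ "mat_avg d (qX G)"], rule ext, rule TI)
  qed (use fin mw w0 mX iA iB s in \<open>auto simp: TI[symmetric] UI[symmetric]\<close>)
  \<comment> \<open>The second replacement is the first one with the players exchanged, played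
    against the corrected operators \<open>A'\<close>. These are again a substrategy, which is all
    that the replacement asks of the opponent.\<close>
  let ?gf' = "game_form d (qY G) (qX G) (\<lambda>y x. w x y) (ansB G) (ansA G) (\<lambda>b a y x. pred G a b x y)"
  obtain K B' where K: "K \<in> carrier_mat d d" "mat_adjoint K = K" "K * K = B0 + complex_of_real s \<cdot>\<^sub>m 1\<^sub>m d"
    and B': "\<And>y b. y \<in> qY G \<Longrightarrow> b \<in> ansB G \<Longrightarrow> psd d (B' y b)"
      "\<And>y. y \<in> qY G \<Longrightarrow> psd d (1\<^sub>m d - mat_sum d (ansB G) (B' y))"
    and stepB: "\<And>\<Psi> t. \<Psi> \<in> carrier_mat d d \<Longrightarrow> 0 < t \<Longrightarrow> ?gf' IB A' \<Psi>
      \<le> (1 + t) * ?gf' B' A' (K * \<Psi>) + (1 + 1 / t) * (s / 2) * hs_inner d \<Psi> \<Psi>"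
  proof (rule substrategy_replacement[where X = "qY G" and Y = "qX G" and SA = "ansB G" and SB = "ansA G"
        and A = IB and B = A' and Am = B0 and w = "\<lambda>y x. w x y" and V = "\<lambda>b a y x. pred G a b x y" and s = s and d = d])
    show "B0 = mat_avg d (qY G) (\<lambda>y. mat_sum d (ansB G) (IB y))"
      unfolding B0_def by (rule arg_cong[of _ _ "mat_avg d (qY G)"], rule ext, rule UI)
  qed (use fin mw w0 mY iB A' s in \<open>auto simp: UI[symmetric]\<close>)
  have IBc: "IB y b \<in> carrier_mat d d" for y b by (simp add: IB_def)
  define \<Psi>L where "\<Psi>L = (L * \<Psi>)\<^sup>T"
  have \<Psi>L: "\<Psi>L \<in> carrier_mat d d" using L \<Psi> by (simp add: \<Psi>L_def)
  define \<Phi> where "\<Phi> = K * \<Psi>L"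
  have \<Phi>: "\<Phi> \<in> carrier_mat d d" using K \<Psi>L by (simp add: \<Phi>_def)
  have A0s: "A0 + complex_of_real s \<cdot>\<^sub>m 1\<^sub>m d \<in> carrier_mat d d" and B0s: "B0 + complex_of_real s \<cdot>\<^sub>m 1\<^sub>m d \<in> carrier_mat d d"
    by (simp_all add: A0_def B0_def)
  have nL: "hs_inner d \<Psi>L \<Psi>L \<le> 1 + s"
  proof -
    have "hs_inner d \<Psi>L \<Psi>L = bip_form d (L * L) (1\<^sub>m d) \<Psi>"
      using L(1) \<Psi> bip_form_square[OF L(1,2) \<Psi>] by (simp add: \<Psi>L_def hs_inner_transpose)
    also have "\<dots> = bip_form d A0 (1\<^sub>m d) \<Psi> + s * bip_form d (1\<^sub>m d) (1\<^sub>m d) \<Psi>"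
      unfolding L(3) using \<Psi> psd_carrier[OF iA(4)] by (simp add: bip_form_add_left bip_form_smult_left)
    also have "bip_form d A0 (1\<^sub>m d) \<Psi> \<le> bip_form d (1\<^sub>m d) (1\<^sub>m d) \<Psi>"
      using \<Psi> psd_carrier[OF iA(4)] by (intro bip_form_mono_left[OF _ iA(5)] psd_one) auto
    finally show ?thesis using \<Psi> \<Psi>1 by (simp add: bip_form_one)
  qed
  have n\<Phi>: "hs_inner d \<Phi> \<Phi> \<le> W + 2 * s + 2 * s\<^sup>2"
  proof -
    have "hs_inner d \<Phi> \<Phi> = bip_form d (K * K) (1\<^sub>m d) \<Psi>L"
      using bip_form_square[OF K(1,2) \<Psi>L] by (simp add: \<Phi>_def)
    also have "\<dots> = bip_form d (1\<^sub>m d) (K * K) (L * \<Psi>)"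
      using K L \<Psi> by (subst bip_form_transpose) (auto simp: \<Psi>L_def)
    also have "\<dots> = bip_form d (L * L) (K * K) \<Psi>"
      using bip_form_sandwich_left[OF L(1) one_carrier_mat _ \<Psi>, of "K * K"] L K by simp
    also have "\<dots> \<le> bip_form d A0 B0 \<Psi> + (2 * s + s\<^sup>2)"
      unfolding L(3) K(3) using bip_form_shift[OF iA(4,5) iB(4,5) \<Psi>, of s] s \<Psi>1 by simp
    also have "bip_form d A0 B0 \<Psi> \<le> W + s\<^sup>2"
      unfolding Wsum using mean_form_le[where T = T and U = U, OF fin(1,2) w0 w1 mX mY iA(2) iB(2) A0_def B0_def iA(6) iB(6) \<Psi>] \<Psi>1
      by simp
    finally show ?thesis by simp
  qed
  have "concat_value M G P \<psi> A B = ?gf IA IB \<Psi>"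
    unfolding w_def IA_def IB_def \<Psi>_def
    by (rule concat_value_eq[OF G(1) M(1-3) P(1-3) _ _ \<psi>(1)]) (use Ap Bp psd_carrier in blast)+
  also have "\<dots> \<le> (1 + t) * ?gf A' IB (L * \<Psi>) + (1 + 1 / t) * (s / 2)"
    using stepA[OF \<Psi> t] \<Psi>1 by simp
  also have "?gf A' IB (L * \<Psi>) = ?gf' IB A' \<Psi>L"
    unfolding \<Psi>L_def using A' IBc L \<Psi> by (intro game_form_transpose) (auto simp: psd_carrier)
  also have "\<dots> \<le> (1 + t) * ?gf' B' A' \<Phi> + (1 + 1 / t) * (s / 2) * hs_inner d \<Psi>L \<Psi>L"
    unfolding \<Phi>_def by (rule stepB[OF \<Psi>L t])
  also have "?gf' B' A' \<Phi> = ?gf A' B' \<Phi>\<^sup>T"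
    using A' B' \<Phi> by (subst (2) game_form_transpose) (auto simp: psd_carrier)
  also have "\<dots> \<le> ?v * hs_inner d \<Phi>\<^sup>T \<Phi>\<^sup>T"
    using A' B' \<Phi> by (intro val) auto
  also have "hs_inner d \<Phi>\<^sup>T \<Phi>\<^sup>T = hs_inner d \<Phi> \<Phi>" using \<Phi> by (simp add: hs_inner_transpose)
  also have "?v * hs_inner d \<Phi> \<Phi> \<le> ?v * (W + 2 * s + 2 * s\<^sup>2)" by (rule mult_left_mono[OF n\<Phi> v0])
  also have "(1 + 1 / t) * (s / 2) * hs_inner d \<Psi>L \<Psi>L \<le> (1 + 1 / t) * (s / 2) * (1 + s)"
    by (rule mult_left_mono[OF nL]) (use s t in auto)
  finally have "concat_value M G P \<psi> A B \<le> (1 + t) * ((1 + t) * (?v * (W + 2 * s + 2 * s\<^sup>2)) + (1 + 1 / t) * (s / 2) * (1 + s)) + (1 + 1 / t) * (s / 2)"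
    using t by (simp add: mult_left_mono)
  also have "\<dots> = (1 + t)\<^sup>2 * (?v * (W + 2 * s + 2 * s\<^sup>2)) + (1 + 1 / t) * (s / 2) * (1 + (1 + t) * (1 + s))"
    by (simp only: power2_eq_square algebra_simps)
  finally show "concat_value M G P \<psi> A B
    \<le> (1 + t)\<^sup>2 * (?v * (W + 2 * s + 2 * s\<^sup>2)) + (1 + 1 / t) * (s / 2) * (1 + (1 + t) * (1 + s))" .
qed

section \<open>Choice of the parameters and the degenerate cases\<close>

text \<open>The choice of \<open>t\<close> gives (1 + t)^2 \<le> 1 + \<epsilon>, so the
  multiplicative loss on v W fits into \<epsilon> W. What remains is at most 8 s from the shifts and
  6 s / \<epsilon> from the two replacements, hence at most 8 \<delta> / 56 and 6 \<delta> /
  56.\<close>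

lemma fortification_arith_pos:
  fixes v W \<epsilon> \<delta> :: real
  assumes "0 \<le> v" "v \<le> 1" "0 \<le> W" "0 < \<epsilon>" "\<epsilon> \<le> 1" "0 < \<delta>" "\<delta> \<le> 1"
  defines "s \<equiv> \<epsilon>\<^sup>2 * \<delta> / 56" and "t \<equiv> \<epsilon> / 3"
  shows "(1 + t)\<^sup>2 * (v * (W + 2 * s + 2 * s\<^sup>2)) + (1 + 1 / t) * (s / 2) * (1 + (1 + t) * (1 + s)) \<le> (v + \<epsilon>) * W + \<delta>"
proof -
  have e2: "\<epsilon>\<^sup>2 \<le> \<epsilon>" using assms by (simp add: power2_eq_square mult_left_le)
  have ed: "\<epsilon> * \<delta> \<le> \<delta>" using assms by (simp add: mult_left_le_one_le)
  have s0: "0 < s" using assms(4,6) by (simp add: s_def)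
  have "\<epsilon>\<^sup>2 * \<delta> \<le> \<epsilon> * \<delta>" using e2 assms(6) by simp
  hence s1: "s \<le> \<delta> / 56" using ed by (simp add: s_def)
  hence s2: "s \<le> 1 / 56" using assms(7) by simp
  define k where "k = 2 * s + 2 * s\<^sup>2"
  have "s\<^sup>2 \<le> s" using s0 s2 by (simp add: power2_eq_square mult_left_le)
  hence k: "0 \<le> k" "k \<le> 4 * s" using s0 by (auto simp: k_def)
  have vk: "v * k \<le> k" using assms(2) k(1) mult_left_le_one_le[of k v] assms(1) by simp
  have vW: "v * W \<le> W" using assms(2,3) mult_left_le_one_le[of W v] assms(1) by simp
  have "(1 + t)\<^sup>2 = 1 + 2 / 3 * \<epsilon> + \<epsilon>\<^sup>2 / 9" by (simp add: t_def power2_eq_square field_simps)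
  hence "(1 + t)\<^sup>2 \<le> 1 + \<epsilon>" using e2 assms(4) by linarith
  hence "(1 + t)\<^sup>2 * (v * (W + k)) \<le> (1 + \<epsilon>) * (v * (W + k))"
    using assms(1,3) k by (intro mult_right_mono) auto
  also have "\<dots> = v * W + v * k + \<epsilon> * (v * W) + \<epsilon> * (v * k)" by (simp add: algebra_simps)
  also have "\<dots> \<le> v * W + k + \<epsilon> * W + 1 * k"
    using assms(1,4,5) vk vW k by (intro add_mono mult_mono order_refl mult_left_mono) auto
  finally have A: "(1 + t)\<^sup>2 * (v * (W + k)) \<le> (v + \<epsilon>) * W + 8 * s" using k by (simp add: algebra_simps)
  have "1 + (1 + t) * (1 + s) \<le> 1 + (4 / 3) * (1 + 1 / 56)"
    using s2 s0 assms(4,5) by (intro add_left_mono mult_mono) (auto simp: t_def)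
  hence q: "1 + (1 + t) * (1 + s) \<le> 3" by simp
  have p: "1 + 1 / t \<le> 4 / \<epsilon>" using assms(4,5) by (simp add: t_def field_simps)
  have "(1 + 1 / t) * (s / 2) * (1 + (1 + t) * (1 + s)) \<le> 4 / \<epsilon> * (s / 2) * 3"
    using p q s0 assms(4) by (intro mult_mono) (auto simp: t_def)
  also have "\<dots> = 6 * (\<epsilon> * \<delta> / 56)" using assms(4) by (simp add: s_def power2_eq_square field_simps)
  finally have "(1 + 1 / t) * (s / 2) * (1 + (1 + t) * (1 + s)) \<le> 6 * \<delta> / 56" using ed by linarith
  moreover have eq: "W + 2 * s + 2 * s\<^sup>2 = W + k" by (simp add: k_def)
  ultimately show ?thesis unfolding eq using A s1 assms(6) by linarith
qed

text \<open>When \<epsilon> or \<delta> is 0 the bound on the expansion parameter is 0, which cannot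
  serve as a shift. With s = r^2 and t = r, both the multiplicative loss, of order t, and the
  additive error, of order s/t, are of order r and disappear as r tends to 0.\<close>

lemma fortification_arith_zero:
  fixes v W r :: real
  assumes "0 \<le> v" "v \<le> 1" "0 \<le> W" "W \<le> 1" "0 < r" "r \<le> 1 / 2"
  shows "(1 + r)\<^sup>2 * (v * (W + 2 * r\<^sup>2 + 2 * (r\<^sup>2)\<^sup>2)) + (1 + 1 / r) * (r\<^sup>2 / 2) * (1 + (1 + r) * (1 + r\<^sup>2)) \<le> v * W + 14 * r"
proof -
  have r2: "r\<^sup>2 \<le> r / 2" using assms(5,6) by (simp add: power2_eq_square mult_left_mono)
  have r4: "(r\<^sup>2)\<^sup>2 \<le> r\<^sup>2" using r2 assms(6) by (simp add: power2_eq_square mult_left_le)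
  define k where "k = 2 * r\<^sup>2 + 2 * (r\<^sup>2)\<^sup>2"
  have k: "0 \<le> k" "k \<le> 2 * r" using r2 r4 by (auto simp: k_def)
  have vk: "v * k \<le> k" using assms(2) k(1) mult_left_le_one_le[of k v] assms(1) by simp
  have vW: "v * W \<le> 1" using assms by (simp add: mult_le_one)
  have "(1 + r)\<^sup>2 \<le> 1 + 3 * r" using r2 assms(5) by (simp add: power2_eq_square algebra_simps)
  hence "(1 + r)\<^sup>2 * (v * (W + k)) \<le> (1 + 3 * r) * (v * (W + k))"
    using assms(1,3) k by (intro mult_right_mono) auto
  also have "\<dots> = v * W + v * k + 3 * r * (v * W) + 3 * r * (v * k)" by (simp add: algebra_simps)
  finally have "(1 + r)\<^sup>2 * (v * (W + k)) \<le> v * W + v * k + 3 * r * (v * W) + 3 * r * (v * k)" .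
  moreover have "3 * r * (v * W) \<le> 3 * r * 1" using assms(5) vW by (intro mult_left_mono) auto
  moreover have "3 * r * (v * k) \<le> 3 / 2 * (2 * r)"
  proof (rule mult_mono)
    show "v * k \<le> 2 * r" using vk k(2) by linarith
  qed (use assms(1,5,6) k(1) in auto)
  ultimately have A: "(1 + r)\<^sup>2 * (v * (W + k)) \<le> v * W + 8 * r" using vk k by linarith
  have q: "1 + (1 + r) * (1 + r\<^sup>2) \<le> 1 + (3 / 2) * (5 / 4)"
    using assms(5,6) r2 by (intro add_left_mono mult_mono) auto
  have "(1 + 1 / r) * (r\<^sup>2 / 2) = (r\<^sup>2 + r) / 2" using assms(5) by (simp add: power2_eq_square field_simps)
  also have "\<dots> \<le> r" using r2 assms(5) by simp
  finally have p: "(1 + 1 / r) * (r\<^sup>2 / 2) \<le> r" .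
  have B: "(1 + 1 / r) * (r\<^sup>2 / 2) * (1 + (1 + r) * (1 + r\<^sup>2)) \<le> r * (1 + (3 / 2) * (5 / 4))"
    using p q assms(5) by (intro mult_mono) auto
  have eq: "W + 2 * r\<^sup>2 + 2 * (r\<^sup>2)\<^sup>2 = W + k" by (simp add: k_def)
  show ?thesis unfolding eq by (rule order_trans[OF add_mono[OF A B]]) (use assms(5) in simp)
qed

text \<open>Without answers for one of the players there is no complete strategy, so
  \<open>entangled_value\<close> is the supremum of the empty set and nothing is known about it. It
  does no harm, since it is multiplied by a mass that is 0.\<close>

lemma concat_value_no_answers:
  assumes G: "two_player_game G" and emp: "ansA G = {} \<or> ansB G = {}"
    and M: "bipartite_graph M" "right_regular M D" "rverts M = qX G"
    and P: "bipartite_graph P" "right_regular P D'" "rverts P = qY G"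
    and sub: "concat_substrategy M G P d \<psi> A B"
  shows "concat_value M G P \<psi> A B = 0"
    and "measure_pmf.expectation (qdist G) (\<lambda>(x, y). expval \<psi>
            (kron (induced_total d M (ansA G) A x) (induced_total d P (ansB G) B y))) = 0"
proof -
  have \<psi>: "\<psi> \<in> carrier_vec (d * d)"
    and Ap: "\<And>x' a'. x' \<in> lverts M \<Longrightarrow> a' \<in> concat_answers M (ansA G) x' \<Longrightarrow> psd d (A x' a')"
    and Bp: "\<And>y' b'. y' \<in> lverts P \<Longrightarrow> b' \<in> concat_answers P (ansB G) y' \<Longrightarrow> psd d (B y' b')"
    using sub by (auto simp: concat_substrategy_def entangled_substrategy_def)
  have "concat_value M G P \<psi> A B = game_form d (qX G) (qY G) (\<lambda>x y. pmf (qdist G) (x, y))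
    (ansA G) (ansB G) (pred G) (induced d M (ansA G) A) (induced d P (ansB G) B) (unvec d \<psi>)"
    by (rule concat_value_eq[OF G M P _ _ \<psi>]) (use Ap Bp psd_carrier in blast)+
  thus "concat_value M G P \<psi> A B = 0" using emp by (auto simp: game_form_def)
  have "bip_form d (induced_total d M (ansA G) A x) (induced_total d P (ansB G) B y) (unvec d \<psi>) = 0" for x y
    using emp
  proof
    assume "ansA G = {}"
    thus ?thesis by (simp add: induced_total_def[of _ M] mat_sum_empty bip_form_zero_left)
  next
    assume "ansB G = {}"
    thus ?thesis by (subst bip_form_transpose) (simp_all add: induced_total_def[of _ P] mat_sum_empty bip_form_zero_left)
  qed
  thus "measure_pmf.expectation (qdist G) (\<lambda>(x, y). expval \<psi>
            (kron (induced_total d M (ansA G) A x) (induced_total d P (ansB G) B y))) = 0"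
    by (simp add: expval_kron[OF _ _ \<psi>] case_prod_unfold)
qed

theorem theorem1p3:
  fixes G :: "('x, 'y, 'a, 'b) game"
    and M :: "('x1, 'x) bigraph"
    and P :: "('y1, 'y) bigraph"
    and \<epsilon> \<delta> lam :: real
  assumes "\<epsilon> \<in> {0..1}" and "\<delta> \<in> {0..1}"
    and "two_player_game G" and "biregular G"
    and "spectral_expander M lam" and "rverts M = qX G"
    and "spectral_expander P lam" and "rverts P = qY G"
    and "lam \<le> \<epsilon>\<^sup>2 * \<delta> / 56"
  shows "weakly_fortified M G P \<epsilon> \<delta>"
  unfolding weakly_fortified_def
proof (intro allI impI)
  fix d :: nat and \<psi> :: "complex vec" and A :: "'x1 \<Rightarrow> ('x \<Rightarrow> 'a) \<Rightarrow> complex mat"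
    and B :: "'y1 \<Rightarrow> ('y \<Rightarrow> 'b) \<Rightarrow> complex mat"
  assume sub: "concat_substrategy M G P d \<psi> A B"
  define W where "W = measure_pmf.expectation (qdist G) (\<lambda>(x, y). expval \<psi>
            (kron (induced_total d M (ansA G) A x) (induced_total d P (ansB G) B y)))"
  obtain D where M: "bipartite_graph M" "right_regular M D" "rverts M = qX G"
    and sM: "second_singular_value (normalized_adjacency M D) \<le> lam"
    using assms(5,6) by (auto simp: spectral_expander_def)
  obtain D' where P: "bipartite_graph P" "right_regular P D'" "rverts P = qY G"
    and sP: "second_singular_value (normalized_adjacency P D') \<le> lam"
    using assms(7,8) by (auto simp: spectral_expander_def)
  have "concat_value M G P \<psi> A B \<le> (entangled_value G + \<epsilon>) * W + \<delta>"
  proof (cases "ansA G = {} \<or> ansB G = {}")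
    case True
    show ?thesis
      using concat_value_no_answers[OF assms(3) True M P sub] assms(2) by (simp add: W_def)
  next
    case False
    hence ne: "ansA G \<noteq> {}" "ansB G \<noteq> {}" by auto
    note bound = concat_value_bound[OF assms(3,4) ne M _ P _ _ _ sub, folded W_def]
    show ?thesis
    proof (cases "\<epsilon> = 0 \<or> \<delta> = 0")
      case False
      hence pos: "0 < \<epsilon>" "\<epsilon> \<le> 1" "0 < \<delta>" "\<delta> \<le> 1" using assms(1,2) by auto
      have s0: "0 < \<epsilon>\<^sup>2 * \<delta> / 56" using pos by simp
      have "\<epsilon>\<^sup>2 * \<delta> \<le> 1" using pos by (simp add: mult_le_one power_le_one)
      hence s1: "\<epsilon>\<^sup>2 * \<delta> / 56 < 1" by simp
      \<comment> \<open>The shift is the upper bound on \<open>lam\<close> rather than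
        \<open>lam\<close> itself, which may be 0.\<close>
      note b = bound[OF order_trans[OF sM assms(9)] order_trans[OF sP assms(9)] s0 s1]
      show ?thesis
        using b(5)[of "\<epsilon> / 3"] fortification_arith_pos[OF b(3,4,1) pos] pos by simp
    next
      case True
      \<comment> \<open>Now every r^2 with r positive is an admissible shift, so the estimate holds
        up to 14 r for arbitrarily small r.\<close>
      hence lam: "lam \<le> 0" using assms(9) by auto
      have small: "concat_value M G P \<psi> A B \<le> entangled_value G * W + 14 * r"
        and nn: "0 \<le> W" if r: "0 < r" "r \<le> 1 / 2" for r
      proof -
        have s0: "0 < r\<^sup>2" using r by simp
        have s1: "r\<^sup>2 < 1" using r by (simp add: power_less_one_iff)
        have "lam \<le> r\<^sup>2" using lam s0 by linarith
        note b = bound[OF order_trans[OF sM this] order_trans[OF sP this] s0 s1]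
        show "concat_value M G P \<psi> A B \<le> entangled_value G * W + 14 * r"
          using b(5)[OF r(1)] fortification_arith_zero[OF b(3,4,1,2) r] by linarith
        show "0 \<le> W" by (rule b(1))
      qed
      have "concat_value M G P \<psi> A B \<le> entangled_value G * W"
      proof (rule field_le_epsilon)
        fix e :: real assume "0 < e"
        define r where "r = min (1 / 2) (e / 14)"
        have "0 < r" "r \<le> 1 / 2" "14 * r \<le> e" using \<open>0 < e\<close> by (auto simp: r_def min_def)
        thus "concat_value M G P \<psi> A B \<le> entangled_value G * W + e"
          using small[of r] by linarith
      qed
      moreover have "0 \<le> \<epsilon> * W" using nn[of "1 / 2"] assms(1) by simp
      ultimately show ?thesis using assms(2) by (simp add: algebra_simps)
    qed
  qed
  thus "concat_value M G P \<psi> A B \<le> (entangled_value G + \<epsilon>) *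
          measure_pmf.expectation (qdist G) (\<lambda>(x, y). expval \<psi>
            (kron (induced_total d M (ansA G) A x) (induced_total d P (ansB G) B y))) + \<delta>"
    by (simp add: W_def)
qed

end
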